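(* Let $\{(\mathcal{A}_{i,\ell},\mathcal{A}_{i,r})\}_{i\in I}$ be a family of pairs of faces in a noncommutative probability space $(\mathcal{A},\varphi)$ (each $\mathcal{A}_{i,\ell}$, $\mathcal{A}_{i,r}$ a not necessarily unital subalgebra of $\mathcal{A}$). Then the family $\{(\mathcal{A}_{i,\ell},\mathcal{A}_{i,r})\}_{i\in I}$ is free-Boolean independent if and only if it is combinatorially free-Boolean independent.
   Context: All vector spaces and algebras are over $\mathbb{C}$. A noncommutative probability space is a pair $(\mathcal{A},\varphi)$ with $\mathcal{A}$ a unital algebra and $\varphi:\mathcal{A}\to\mathbb{C}$ linear with $\varphi(1)=1$. Algebra homomorphisms are not required to be unital. **Reduced free products.** A vector space with a specified vector is a triple $(\mathcal{X},\mathcal{X}^\circ,\xi)$, where $\mathcal{X}^\circ\subset\mathcal{X}$ is a subspace of codimension 1 and $\xi\in\mathcal{X}\setminus\mathcal{X}^\circ$. Let $\phi$ be the linear functional on $\mathcal{X}$ with $\phi(\xi)=1$, $\ker\phi=\mathcal{X}^\circ$; $\mathcal{L}(\mathcal{X})$ is the algebra of linear operators on $\mathcal{X}$ and $\phi_\xi(T)=\phi(T\xi)$ for $T\in\mathcal{L}(\mathcal{X})$. The reduced free product of $(\mathcal{X}_i,\mathcal{X}_i^\circ,\xi_i)_{i\in I}$ is $(\mathcal{X},\mathcal{X}^\circ,\xi)$ with $\mathcal{X}=\mathbb{C}\xi\oplus\mathcal{X}^\circ$ and $\mathcal{X}^\circ=\bigoplus_{n\ge1}\bigoplus_{i_1\ne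 i_2\ne\cdots\ne i_n}\mathcal{X}_{i_1}^\circ\otimes\cdots\otimes\mathcal{X}_{i_n}^\circ$. Let $\mathcal{X}(\ell,i)$ (resp. $\mathcal{X}(r,i)$) be the sum of $\mathbb{C}\xi$ and those summands with $i_1\ne i$ (resp. $i_n\neq i$). There are natural isomorphisms $V_i:\mathcal{X}_i\otimes\mathcal{X}(\ell,i)\to\mathcal{X}$ and $W_i:\mathcal{X}(r,i)\otimes\mathcal{X}_i\to\mathcal{X}$ (concatenate tensors, identify $\xi_i\otimes w$, resp. $w\otimes\xi_i$, with $w$, and $x\otimes\xi$, resp. $\xi\otimes x$, with $x$ for $x\in\mathcal X_i^\circ$, and $\xi_i\otimes \xi$, resp. $\xi\otimes\xi_i$, with $\xi$). Set $\lambda_i(T)=V_i(T\otimes I)V_i^{-1}$ and $\rho_i(T)=W_i(I\otimes T)W_i^{-1}$ for $T\in\mathcal{L}(\mathcal{X}_i)$. Let $P_{\uplus,i}$ be the projection of $\mathcal{X}$ onto $\mathbb{C}\xi\oplus\mathcal{X}_i^\circ$ vanishing on all other summands. (One has $P_{\uplus,i}\lambda_i(T)P_{\uplus,i}=P_{\uplus,i}\rho_i(T)P_{\uplus,i}$.) **Free-Boolean independence.** The joint distribution of a family of pairs of algebras $(B_i,C_i)$ mapped by homomorphisms $\beta_i:B_i\to\mathcal{A}$, $\gamma_i:C_i\to\mathcal{A}$ is the linear functional $\varphi\circ\alpha$ on the non-unital universal free product of all the algebras $B_i,C_i$ ($i\in I$), where $\alpha$ is the homomorphism extending all $\beta_i,\gamma_i$.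 The family $(\mathcal{A}_{i,\ell},\mathcal{A}_{i,r})_{i\in I}$ (with inclusion maps) is free-Boolean independent if there exist vector spaces with specified vectors $(\mathcal{X}_i,\mathcal{X}_i^\circ,\xi_i)_{i\in I}$ and homomorphisms $\ell_i:\mathcal{A}_{i,\ell}\to\mathcal{L}(\mathcal{X}_i)$, $r_i:\mathcal{A}_{i,r}\to\mathcal{L}(\mathcal{X}_i)$ such that, with $(\mathcal{X},\mathcal{X}^\circ,\xi)$ their reduced free product, the joint distribution of the pairs $(\mathcal{A}_{i,\ell},\mathcal{A}_{i,r})$ mapped into $(\mathcal{L}(\mathcal{X}),\phi_\xi)$ by $\lambda_i(\ell_i(\cdot))$ and $P_{\uplus,i}\rho_i(r_i(\cdot))P_{\uplus,i}$ equals their joint distribution in $(\mathcal{A},\varphi)$. **Interval-noncrossing partitions.** Let $\chi:[n]\to\{\bullet,\circ\}$, $[n]=\{1,\dots,n\}$. A block $V$ of a partition $\pi$ is inner if there are a block $W$ of $\pi$ and $s,t\in W$ with $s<v<t$ for all $v\in V$. $INC(\chi)$ is the set of noncrossing partitions $\pi$ of $[n]$ such that no element of $\chi^{-1}(\circ)$ lies in an inner block of $\pi$. It is a finite lattice under $\sigma\le\pi$ iff each block of $\sigma$ is contained in a block of $\pi$; $\mu_{INC}$ denotes its Möbius function. $1_n$ is the partition with one block. **Cumulants.** For $\sigma\in INC(\chi)$, $\varphi_\sigma(z_1,\dots,z_n)=\prod_{V\in\sigma}\varphi\big(\prod_{k\in V}z_k\big)$, products inside $\varphi$ taken in increasing order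 of index. For $\pi\in INC(\chi)$, $\kappa_{\chi,\pi}(z_1,\dots,z_n)=\sum_{\sigma\in INC(\chi),\,\sigma\le\pi}\mu_{INC}(\sigma,\pi)\varphi_\sigma(z_1,\dots,z_n)$. **Combinatorial free-Boolean independence.** The family is combinatorially free-Boolean independent if $\kappa_{\chi,1_n}(z_1,\dots,z_n)=0$ whenever $n\ge1$, $\chi:[n]\to\{\bullet,\circ\}$, $\beta:[n]\to\{\ell,r\}$ with $\beta^{-1}(\ell)=\chi^{-1}(\bullet)$, $\omega:[n]\to I$ is not constant, and $z_k\in\mathcal{A}_{\omega(k),\beta(k)}$ for all $k$. *)

theory Defs
  imports Complex_Main "HOL-Library.Disjoint_Sets" "HOL-Library.Function_Algebras"
begin

section \<open>Noncommutative probability spaces and faces\<close>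

locale nc_prob_space = vector_space scale
  for scale :: "complex \<Rightarrow> 'a::ring_1 \<Rightarrow> 'a" +
  fixes \<phi> :: "'a \<Rightarrow> complex"
  assumes scale_mult_left: "scale c (x * y) = scale c x * y"
    and scale_mult_right: "scale c (x * y) = x * scale c y"
    and linear_state: "Vector_Spaces.linear scale (*) \<phi>"
    and state_one: "\<phi> 1 = 1"

definition nonunital_subalgebra :: "(complex \<Rightarrow> 'a::ring_1 \<Rightarrow> 'a) \<Rightarrow> 'a set \<Rightarrow> bool" where
  "nonunital_subalgebra s B \<longleftrightarrow> module.subspace s B \<and> (\<forall>x\<in>B. \<forall>y\<in>B. x * y \<in> B)"

datatype face = LeftFace | RightFace


section \<open>Linear maps between subspaces\<close>

text \<open>Scalar multiplication on a function space, induced pointwise from the codomain; addition on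
  functions is the pointwise one of \<^theory>\<open>HOL-Library.Function_Algebras\<close>.\<close>

definition pscale :: "(complex \<Rightarrow> 'e \<Rightarrow> 'e) \<Rightarrow> complex \<Rightarrow> ('x \<Rightarrow> 'e) \<Rightarrow> ('x \<Rightarrow> 'e)" where
  "pscale s c f = (\<lambda>x. s c (f x))"

abbreviation cspan :: "('x \<Rightarrow> complex) set \<Rightarrow> ('x \<Rightarrow> complex) set" where
  "cspan \<equiv> module.span (pscale (*))"

text \<open>Maps defined on a subspace \<open>D\<close> are represented by functions vanishing off \<open>D\<close>. In this way
  equality of functions is equality of maps on \<open>D\<close>, and pointwise sums, scalar multiples and
  compositions of functions are those of the maps.\<close>

definition lin_maps ::
  "(complex \<Rightarrow> 'd::ab_group_add \<Rightarrow> 'd) \<Rightarrow> (complex \<Rightarrow> 'e::ab_group_add \<Rightarrow> 'e) \<Rightarrow> 'd set \<Rightarrow> 'e set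
    \<Rightarrow> ('d \<Rightarrow> 'e) set" where
  "lin_maps sD sE D E = {L.
     (\<forall>x\<in>D. \<forall>y\<in>D. L (x + y) = L x + L y) \<and> (\<forall>c. \<forall>x\<in>D. L (sD c x) = sE c (L x)) \<and>
     (\<forall>x\<in>D. L x \<in> E) \<and> (\<forall>x. x \<notin> D \<longrightarrow> L x = 0)}"

definition lin_ops :: "(complex \<Rightarrow> 'd::ab_group_add \<Rightarrow> 'd) \<Rightarrow> 'd set \<Rightarrow> ('d \<Rightarrow> 'd) set" where
  "lin_ops s X = lin_maps s s X X"

definition algebra_hom_into_lin_ops ::
  "(complex \<Rightarrow> 'a::ring_1 \<Rightarrow> 'a) \<Rightarrow> 'a set \<Rightarrow> (complex \<Rightarrow> 'd::ab_group_add \<Rightarrow> 'd) \<Rightarrow> 'd set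
    \<Rightarrow> ('a \<Rightarrow> 'd \<Rightarrow> 'd) \<Rightarrow> bool" where
  "algebra_hom_into_lin_ops sA B s X h \<longleftrightarrow>
     (\<forall>a\<in>B. h a \<in> lin_ops s X) \<and>
     (\<forall>a\<in>B. \<forall>b\<in>B. h (a + b) = h a + h b) \<and>
     (\<forall>c. \<forall>a\<in>B. h (sA c a) = pscale s c (h a)) \<and>
     (\<forall>a\<in>B. \<forall>b\<in>B. h (a * b) = h a \<circ> h b)"

text \<open>The linear map on \<open>D\<close> with prescribed values \<open>gen g \<mapsto> F g\<close> on a spanning family
  \<open>gen g\<close>, \<open>g \<in> G\<close>, of \<open>D\<close>.\<close>

definition lin_extension ::
  "(complex \<Rightarrow> 'e::ab_group_add \<Rightarrow> 'e) \<Rightarrow> ('x \<Rightarrow> complex) set \<Rightarrow> ('g \<Rightarrow> 'x \<Rightarrow> complex) \<Rightarrow> 'g set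
    \<Rightarrow> ('g \<Rightarrow> 'e) \<Rightarrow> ('x \<Rightarrow> complex) \<Rightarrow> 'e" where
  "lin_extension sE D gen G F =
     (THE L. L \<in> lin_maps (pscale (*)) sE D UNIV \<and> (\<forall>g\<in>G. L (gen g) = F g))"


section \<open>Vector spaces given by generators and relations\<close>

text \<open>Let \<open>M\<close> be the space of those functions on a set \<open>G\<close> of generators which respect a given set
  of linear relations (for instance the multilinear functions). The free vector space on \<open>G\<close> modulo
  these relations has \<open>M\<close> as its dual space, and, as functionals separate points, it is realised in
  the dual of \<open>M\<close> as the span of the evaluations \<open>evaluation M g\<close>, \<open>g \<in> G\<close>. Its universal property
  is the lemma \<open>lin_extension_evaluation\<close> below.\<close>

definition evaluation :: "('g \<Rightarrow> complex) set \<Rightarrow> 'g \<Rightarrow> ('g \<Rightarrow> complex) \<Rightarrow> complex" where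
  "evaluation M g = (\<lambda>f. if f \<in> M then f g else 0)"

interpretation fun_space: vector_space "pscale (*) :: complex \<Rightarrow> ('x \<Rightarrow> complex) \<Rightarrow> 'x \<Rightarrow> complex"
  by unfold_locales (auto simp: pscale_def algebra_simps fun_eq_iff)

lemma sum_fun_apply: "(\<Sum>a\<in>A. F a) x = (\<Sum>a\<in>A. F a x)"
  for F :: "'b \<Rightarrow> 'x \<Rightarrow> 'e::comm_monoid_add"
  by (induction A rule: infinite_finite_induct) auto

lemma lin_maps_eqI:
  assumes sE: "vector_space sE"
    and L: "L \<in> lin_maps (pscale (*)) sE (cspan S) E" and K: "K \<in> lin_maps (pscale (*)) sE (cspan S) E"
    and eq: "\<And>x. x \<in> S \<Longrightarrow> L x = K x"
  shows "L = K"
proof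
  interpret E: vector_space sE by (rule sE)
  have zero: "J 0 = 0" if "J \<in> lin_maps (pscale (*)) sE (cspan S) E" for J
  proof -
    have "J (0 + 0) = J 0 + J 0"
      using that fun_space.span_zero[of S] unfolding lin_maps_def by blast
    then show ?thesis by simp
  qed
  fix x show "L x = K x"
  proof (cases "x \<in> cspan S")
    case True
    then have "x \<in> cspan S \<and> L x = K x"
    proof (induction rule: fun_space.span_induct_alt)
      case base
      then show ?case using zero[OF L] zero[OF K] fun_space.span_zero by metis
    next
      case (step c x y)
      have m: "pscale (*) c x \<in> cspan S" "x \<in> cspan S"
        using step(1) fun_space.span_base fun_space.span_scale by blast+
      have y: "y \<in> cspan S" using step(2) by blast
      have "J (pscale (*) c x + y) = sE c (J x) + J y"
        if "J \<in> lin_maps (pscale (*)) sE (cspan S) E" for J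
        using that m y unfolding lin_maps_def by auto
      with L K step eq m y show ?case by (metis fun_space.span_add)
    qed
    then show ?thesis by blast
  qed (use L K in \<open>auto simp: lin_maps_def\<close>)
qed

lemma lin_extension_evaluation:
  fixes sE :: "complex \<Rightarrow> 'e::ab_group_add \<Rightarrow> 'e" and G :: "'g set"
  assumes sE: "vector_space sE"
    and F: "\<And>h. Vector_Spaces.linear sE (*) h \<Longrightarrow> (\<lambda>g. h (F g)) \<in> M"
  defines "D \<equiv> cspan (evaluation M ` G)"
  defines "L \<equiv> lin_extension sE D (evaluation M) G F"
  shows "L \<in> lin_maps (pscale (*)) sE D UNIV" and "g \<in> G \<Longrightarrow> L (evaluation M g) = F g"
proof -
  interpret E: vector_space sE by (rule sE)
  interpret fE: vector_space_pair "pscale (*) :: complex \<Rightarrow> (('g \<Rightarrow> complex) \<Rightarrow> complex) \<Rightarrow> _" sE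
    by unfold_locales
  interpret EC: vector_space_pair sE "(*) :: complex \<Rightarrow> complex \<Rightarrow> complex"
    by unfold_locales (auto simp: algebra_simps)
  obtain B where B: "B \<subseteq> evaluation M ` G" "fun_space.independent B" "evaluation M ` G \<subseteq> cspan B"
    using fun_space.maximal_independent_subset[of "evaluation M ` G"] by blast
  define gb where "gb b = (SOME g. g \<in> G \<and> evaluation M g = b)" for b
  have gb: "gb b \<in> G" "evaluation M (gb b) = b" if "b \<in> B" for b
  proof -
    have "\<exists>g. g \<in> G \<and> evaluation M g = b" using B(1) that by auto
    from someI_ex[OF this] show "gb b \<in> G" "evaluation M (gb b) = b" by (simp_all add: gb_def)
  qed
  obtain K where K: "Vector_Spaces.linear (pscale (*)) sE K" "\<And>b. b \<in> B \<Longrightarrow> K b = F (gb b)"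
    using fE.linear_independent_extend[OF B(2), of "\<lambda>b. F (gb b)"] by blast
  interpret K: Vector_Spaces.linear "pscale (*)" sE K by (rule K(1))
  have KF: "K (evaluation M g) = F g" if g: "g \<in> G" for g
  proof (rule ccontr)
    assume "K (evaluation M g) \<noteq> F g"
    define d where "d = K (evaluation M g) - F g"
    have d: "d \<noteq> 0" using \<open>K (evaluation M g) \<noteq> F g\<close> by (simp add: d_def)
    then have "E.independent {d}" by (simp add: E.independent_insert)
    then obtain h where h: "Vector_Spaces.linear sE (*) h" "h d = 1"
      using EC.linear_independent_extend[of "{d}" "\<lambda>_. 1"] by auto
    interpret h: Vector_Spaces.linear sE "(*)" h by (rule h(1))
    have "evaluation M g \<in> cspan B" using B(3) g by blast
    then obtain S r where S: "finite S" "S \<subseteq> B" "evaluation M g = (\<Sum>b\<in>S. pscale (*) (r b) b)"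
      unfolding fun_space.span_explicit by blast
    have fm: "(\<lambda>g. h (F g)) \<in> M" using F h(1) by blast
    have "h (F g) = evaluation M g (\<lambda>g. h (F g))" using fm by (simp add: evaluation_def)
    also have "\<dots> = (\<Sum>b\<in>S. r b * b (\<lambda>g. h (F g)))"
      by (simp add: S(3) sum_fun_apply pscale_def)
    also have "\<dots> = (\<Sum>b\<in>S. r b * h (K b))"
    proof (rule sum.cong)
      fix b assume "b \<in> S"
      then have b: "b \<in> B" using S(2) by blast
      have "b (\<lambda>g. h (F g)) = evaluation M (gb b) (\<lambda>g. h (F g))" using gb(2)[OF b] by simp
      also have "\<dots> = h (F (gb b))" using fm by (simp add: evaluation_def)
      finally show "r b * b (\<lambda>g. h (F g)) = r b * h (K b)" using K(2)[OF b] by simp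
    qed simp
    also have "\<dots> = h (K (evaluation M g))"
      by (simp add: S(3) K.sum h.sum K.scale h.scale)
    finally have "h d = 0" by (simp add: d_def h.diff)
    with h(2) show False by simp
  qed
  define K' where "K' x = (if x \<in> D then K x else 0)" for x
  have K': "K' \<in> lin_maps (pscale (*)) sE D UNIV"
    unfolding lin_maps_def K'_def D_def
    by (auto simp: K.add K.scale fun_space.span_add fun_space.span_scale)
  have in_D: "evaluation M g \<in> D" if "g \<in> G" for g
    unfolding D_def using that by (intro fun_space.span_base) auto
  have K'F: "\<forall>g\<in>G. K' (evaluation M g) = F g" using KF in_D by (simp add: K'_def)
  have "L = K'"
    unfolding L_def lin_extension_def
  proof (rule the_equality)
    fix J assume "J \<in> lin_maps (pscale (*)) sE D UNIV \<and> (\<forall>g\<in>G. J (evaluation M g) = F g)"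
    then show "J = K'"
      using K' K'F unfolding D_def
      by (intro lin_maps_eqI[OF sE, of J "evaluation M ` G" UNIV K']) auto
  qed (use K' K'F in auto)
  then show "L \<in> lin_maps (pscale (*)) sE D UNIV" "g \<in> G \<Longrightarrow> L (evaluation M g) = F g"
    using K' K'F by auto
qed

text \<open>Functions on a set \<open>G\<close> of words of labelled vectors which are linear in every letter.\<close>

definition multilinear_forms ::
  "(complex \<Rightarrow> 'v::ab_group_add \<Rightarrow> 'v) \<Rightarrow> ('j \<times> 'v) list set \<Rightarrow> (('j \<times> 'v) list \<Rightarrow> complex) set" where
  "multilinear_forms s G = {f.
     (\<forall>p q j x y. p @ (j, x) # q \<in> G \<and> p @ (j, y) # q \<in> G \<longrightarrow>
        f (p @ (j, x + y) # q) = f (p @ (j, x) # q) + f (p @ (j, y) # q)) \<and>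
     (\<forall>p q j x c. p @ (j, x) # q \<in> G \<longrightarrow> f (p @ (j, s c x) # q) = c * f (p @ (j, x) # q))}"


section \<open>Tensor product of two spaces\<close>

definition bilinear_forms ::
  "(complex \<Rightarrow> 'u::ab_group_add \<Rightarrow> 'u) \<Rightarrow> 'u set \<Rightarrow> (complex \<Rightarrow> 'w::ab_group_add \<Rightarrow> 'w) \<Rightarrow> 'w set
    \<Rightarrow> ('u \<times> 'w \<Rightarrow> complex) set" where
  "bilinear_forms sU U sW W = {f.
     (\<forall>u\<in>U. \<forall>u'\<in>U. \<forall>w\<in>W. f (u + u', w) = f (u, w) + f (u', w)) \<and>
     (\<forall>u\<in>U. \<forall>w\<in>W. \<forall>w'\<in>W. f (u, w + w') = f (u, w) + f (u, w')) \<and>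
     (\<forall>c. \<forall>u\<in>U. \<forall>w\<in>W. f (sU c u, w) = c * f (u, w) \<and> f (u, sW c w) = c * f (u, w))}"

definition tensor ::
  "(complex \<Rightarrow> 'u::ab_group_add \<Rightarrow> 'u) \<Rightarrow> 'u set \<Rightarrow> (complex \<Rightarrow> 'w::ab_group_add \<Rightarrow> 'w) \<Rightarrow> 'w set
    \<Rightarrow> 'u \<times> 'w \<Rightarrow> ('u \<times> 'w \<Rightarrow> complex) \<Rightarrow> complex" where
  "tensor sU U sW W = evaluation (bilinear_forms sU U sW W)"

definition tensor_space ::
  "(complex \<Rightarrow> 'u::ab_group_add \<Rightarrow> 'u) \<Rightarrow> 'u set \<Rightarrow> (complex \<Rightarrow> 'w::ab_group_add \<Rightarrow> 'w) \<Rightarrow> 'w set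
    \<Rightarrow> (('u \<times> 'w \<Rightarrow> complex) \<Rightarrow> complex) set" where
  "tensor_space sU U sW W = cspan (tensor sU U sW W ` (U \<times> W))"

text \<open>\<open>S \<otimes> T\<close> for operators \<open>S\<close> on \<open>U\<close> and \<open>T\<close> on \<open>W\<close>\<close>

definition tensor_op ::
  "(complex \<Rightarrow> 'u::ab_group_add \<Rightarrow> 'u) \<Rightarrow> 'u set \<Rightarrow> (complex \<Rightarrow> 'w::ab_group_add \<Rightarrow> 'w) \<Rightarrow> 'w set
    \<Rightarrow> ('u \<Rightarrow> 'u) \<Rightarrow> ('w \<Rightarrow> 'w)
    \<Rightarrow> (('u \<times> 'w \<Rightarrow> complex) \<Rightarrow> complex) \<Rightarrow> (('u \<times> 'w \<Rightarrow> complex) \<Rightarrow> complex)" where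
  "tensor_op sU U sW W S T =
     lin_extension (pscale (*)) (tensor_space sU U sW W) (tensor sU U sW W) (U \<times> W)
       (\<lambda>(u, w). tensor sU U sW W (S u, T w))"


section \<open>Vector spaces with a specified vector and their reduced free product\<close>

definition specified_vector_space ::
  "(complex \<Rightarrow> 'v::ab_group_add \<Rightarrow> 'v) \<Rightarrow> 'v set \<Rightarrow> 'v set \<Rightarrow> 'v \<Rightarrow> bool" where
  "specified_vector_space s X X0 \<xi> \<longleftrightarrow>
     module.subspace s X \<and> module.subspace s X0 \<and> X0 \<subseteq> X \<and>
     (\<exists>v\<in>X - X0. X = module.span s (insert v X0)) \<and> \<xi> \<in> X - X0"

text \<open>The functional \<open>\<phi>\<close> with \<open>\<phi> \<xi> = 1\<close> and kernel \<open>X0\<close>\<close>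

definition specified_functional ::
  "(complex \<Rightarrow> 'v::ab_group_add \<Rightarrow> 'v) \<Rightarrow> 'v set \<Rightarrow> 'v set \<Rightarrow> 'v \<Rightarrow> 'v \<Rightarrow> complex" where
  "specified_functional s X X0 \<xi> =
     (THE f. f \<in> lin_maps s (*) X UNIV \<and> f \<xi> = 1 \<and> {x\<in>X. f x = 0} = X0)"

text \<open>The spaces \<open>X i\<close> are subspaces of an ambient space; every family of vector spaces has this
  form up to isomorphism (embed it into its direct sum).\<close>

locale specified_family = vector_space scale
  for scale :: "complex \<Rightarrow> 'v::ab_group_add \<Rightarrow> 'v" +
  fixes I :: "'i set" and X X0 :: "'i \<Rightarrow> 'v set" and \<xi> :: "'i \<Rightarrow> 'v"
  assumes specified: "i \<in> I \<Longrightarrow> specified_vector_space scale (X i) (X0 i) (\<xi> i)"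
begin

text \<open>A word \<open>[(i\<^sub>1, x\<^sub>1), \<dots>, (i\<^sub>n, x\<^sub>n)]\<close> with neighbouring indices distinct stands for
  \<open>x\<^sub>1 \<otimes> \<dots> \<otimes> x\<^sub>n\<close>, the empty word for the vacuum vector. Functions on words are unconstrained between
  distinct index sequences, so that the span of all words is the direct sum of the tensor products.\<close>

definition words :: "('i \<times> 'v) list set" where
  "words = {w. set w \<subseteq> Sigma I X0 \<and> distinct_adj (map fst w)}"

definition words_left :: "'i \<Rightarrow> ('i \<times> 'v) list set" where
  "words_left i = {w\<in>words. w = [] \<or> fst (hd w) \<noteq> i}"

definition words_right :: "'i \<Rightarrow> ('i \<times> 'v) list set" where
  "words_right i = {w\<in>words. w = [] \<or> fst (last w) \<noteq> i}"

definition word_tensor :: "('i \<times> 'v) list \<Rightarrow> (('i \<times> 'v) list \<Rightarrow> complex) \<Rightarrow> complex" where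
  "word_tensor = evaluation (multilinear_forms scale words)"

definition FX :: "((('i \<times> 'v) list \<Rightarrow> complex) \<Rightarrow> complex) set" where
  "FX = cspan (word_tensor ` words)"

definition FX0 :: "((('i \<times> 'v) list \<Rightarrow> complex) \<Rightarrow> complex) set" where
  "FX0 = cspan (word_tensor ` (words - {[]}))"

definition vacuum :: "(('i \<times> 'v) list \<Rightarrow> complex) \<Rightarrow> complex" where
  "vacuum = word_tensor []"

definition FX_left :: "'i \<Rightarrow> ((('i \<times> 'v) list \<Rightarrow> complex) \<Rightarrow> complex) set" where
  "FX_left i = cspan (word_tensor ` words_left i)"

definition FX_right :: "'i \<Rightarrow> ((('i \<times> 'v) list \<Rightarrow> complex) \<Rightarrow> complex) set" where
  "FX_right i = cspan (word_tensor ` words_right i)"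

text \<open>The isomorphisms \<open>V\<^sub>i : X\<^sub>i \<otimes> X(\<ell>,i) \<rightarrow> X\<close> and \<open>W\<^sub>i : X(r,i) \<otimes> X\<^sub>i \<rightarrow> X\<close>, given by their values
  on \<open>x \<otimes> w\<close> resp. \<open>w \<otimes> x\<close> with \<open>x = \<xi>\<^sub>i\<close> or \<open>x\<close> in the distinguished hyperplane, \<open>w\<close> a word.\<close>

definition V where
  "V i = lin_extension (pscale (*))
     (tensor_space scale (X i) (pscale (*)) (FX_left i))
     (\<lambda>(x, w). tensor scale (X i) (pscale (*)) (FX_left i) (x, word_tensor w))
     (insert (\<xi> i) (X0 i) \<times> words_left i)
     (\<lambda>(x, w). if x = \<xi> i then word_tensor w else word_tensor ((i, x) # w))"

definition W where
  "W i = lin_extension (pscale (*))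
     (tensor_space (pscale (*)) (FX_right i) scale (X i))
     (\<lambda>(w, x). tensor (pscale (*)) (FX_right i) scale (X i) (word_tensor w, x))
     (words_right i \<times> insert (\<xi> i) (X0 i))
     (\<lambda>(w, x). if x = \<xi> i then word_tensor w else word_tensor (w @ [(i, x)]))"

definition left_rep where
  "left_rep i T = (\<lambda>t. if t \<in> FX
     then V i (tensor_op scale (X i) (pscale (*)) (FX_left i) T id
       (inv_into (tensor_space scale (X i) (pscale (*)) (FX_left i)) (V i) t))
     else 0)"

definition right_rep where
  "right_rep i T = (\<lambda>t. if t \<in> FX
     then W i (tensor_op (pscale (*)) (FX_right i) scale (X i) id T
       (inv_into (tensor_space (pscale (*)) (FX_right i) scale (X i)) (W i) t))
     else 0)"

definition P_uplus where
  "P_uplus i = lin_extension (pscale (*)) FX word_tensor words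
     (\<lambda>w. if w = [] \<or> (\<exists>x. w = [(i, x)]) then word_tensor w else 0)"

definition vacuum_functional where
  "vacuum_functional T = specified_functional (pscale (*)) FX FX0 vacuum (T vacuum)"

end


section \<open>Joint distributions and free-Boolean independence\<close>

text \<open>The non-unital universal free product of subalgebras \<open>B j\<close>, \<open>j \<in> J\<close>: spanned by the nonempty
  words in letters \<open>(j, b)\<close>, \<open>b \<in> B j\<close>, subject to linearity in every letter and to multiplication of
  neighbouring letters with the same label; the product is concatenation of words.\<close>

definition free_product_words :: "'j set \<Rightarrow> ('j \<Rightarrow> 'a set) \<Rightarrow> ('j \<times> 'a) list set" where
  "free_product_words J B = {w. w \<noteq> [] \<and> set w \<subseteq> Sigma J B}"

definition free_product_forms ::
  "(complex \<Rightarrow> 'a::ring_1 \<Rightarrow> 'a) \<Rightarrow> 'j set \<Rightarrow> ('j \<Rightarrow> 'a set) \<Rightarrow> (('j \<times> 'a) list \<Rightarrow> complex) set" where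
  "free_product_forms s J B = {f \<in> multilinear_forms s (free_product_words J B).
     \<forall>p q j a b. p @ (j, a) # (j, b) # q \<in> free_product_words J B \<longrightarrow>
       f (p @ (j, a) # (j, b) # q) = f (p @ (j, a * b) # q)}"

definition free_product ::
  "(complex \<Rightarrow> 'a::ring_1 \<Rightarrow> 'a) \<Rightarrow> 'j set \<Rightarrow> ('j \<Rightarrow> 'a set)
    \<Rightarrow> ((('j \<times> 'a) list \<Rightarrow> complex) \<Rightarrow> complex) set" where
  "free_product s J B = cspan (evaluation (free_product_forms s J B) ` free_product_words J B)"

text \<open>Product of a nonempty list with respect to \<open>mult\<close>\<close>

definition nonempty_prod :: "('e \<Rightarrow> 'e \<Rightarrow> 'e) \<Rightarrow> 'e list \<Rightarrow> 'e" where
  "nonempty_prod mult xs = foldr mult (butlast xs) (last xs)"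

text \<open>The homomorphism on the free product extending homomorphisms \<open>h j\<close> from \<open>B j\<close> into an algebra
  with scalar multiplication \<open>sE\<close> and product \<open>mult\<close>\<close>

definition free_product_hom where
  "free_product_hom s J B sE mult h =
     lin_extension sE (free_product s J B) (evaluation (free_product_forms s J B))
       (free_product_words J B) (\<lambda>w. nonempty_prod mult (map (\<lambda>(j, b). h j b) w))"

definition joint_distribution where
  "joint_distribution s J B sE mult \<psi> h = (\<lambda>t. \<psi> (free_product_hom s J B sE mult h t))"

text \<open>Pairs of faces are indexed as \<open>A i f\<close>; the algebras of the family are labelled by \<open>(i, f)\<close>.
  HOL cannot quantify existentially over types, so the vector spaces realising the independence are
  sought among the subspaces of a given ambient space \<open>(sV :: complex \<Rightarrow> 'v \<Rightarrow> 'v)\<close>. Free-Boolean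
  independence means that this holds for some ambient space. A statement that independence implies
  something should thus be made for arbitrary \<open>sV\<close>, a statement that something implies independence
  should name an ambient space.\<close>

definition free_boolean_independent ::
  "(complex \<Rightarrow> 'v::ab_group_add \<Rightarrow> 'v) \<Rightarrow> (complex \<Rightarrow> 'a::ring_1 \<Rightarrow> 'a) \<Rightarrow> ('a \<Rightarrow> complex)
    \<Rightarrow> 'i set \<Rightarrow> ('i \<Rightarrow> face \<Rightarrow> 'a set) \<Rightarrow> bool" where
  "free_boolean_independent sV s \<phi> I A \<longleftrightarrow>
     (\<exists>X X0 \<xi> l r.
        specified_family sV I X X0 \<xi> \<and>
        (\<forall>i\<in>I. algebra_hom_into_lin_ops s (A i LeftFace) sV (X i) (l i)) \<and>
        (\<forall>i\<in>I. algebra_hom_into_lin_ops s (A i RightFace) sV (X i) (r i)) \<and>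
        (let J = I \<times> UNIV;
             B = (\<lambda>(i, f). A i f);
             P = specified_family.P_uplus sV I X0;
             lrep = specified_family.left_rep sV I X X0 \<xi>;
             rrep = specified_family.right_rep sV I X X0 \<xi>;
             h = (\<lambda>(i, f) a. case f of
                    LeftFace \<Rightarrow> lrep i (l i a)
                  | RightFace \<Rightarrow> P i \<circ> rrep i (r i a) \<circ> P i)
         in \<forall>t\<in>free_product s J B.
              joint_distribution s J B (pscale (pscale (*))) (\<circ>)
                (specified_family.vacuum_functional sV I X0) h t
            = joint_distribution s J B s (*) \<phi> (\<lambda>_ a. a) t))"


section \<open>Interval-noncrossing partitions and cumulants\<close>

datatype color = Bullet | Circle

definition noncrossing :: "nat set set \<Rightarrow> bool" where
  "noncrossing \<pi> \<longleftrightarrow> (\<forall>V\<in>\<pi>. \<forall>W\<in>\<pi>. V \<noteq> W \<longrightarrow>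
     \<not> (\<exists>a\<in>V. \<exists>b\<in>W. \<exists>c\<in>V. \<exists>d\<in>W. a < b \<and> b < c \<and> c < d))"

definition inner_block :: "nat set set \<Rightarrow> nat set \<Rightarrow> bool" where
  "inner_block \<pi> V \<longleftrightarrow> V \<in> \<pi> \<and> (\<exists>W\<in>\<pi>. \<exists>s\<in>W. \<exists>t\<in>W. \<forall>v\<in>V. s < v \<and> v < t)"

definition INC :: "nat \<Rightarrow> (nat \<Rightarrow> color) \<Rightarrow> nat set set set" where
  "INC n \<chi> = {\<pi>. partition_on {1..n} \<pi> \<and> noncrossing \<pi> \<and>
     (\<forall>V. inner_block \<pi> V \<longrightarrow> (\<forall>k\<in>V. \<chi> k \<noteq> Circle))}"

definition INC_order :: "nat \<Rightarrow> (nat \<Rightarrow> color) \<Rightarrow> (nat set set \<times> nat set set) set" where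
  "INC_order n \<chi> = {(\<sigma>, \<pi>). \<sigma> \<in> INC n \<chi> \<and> \<pi> \<in> INC n \<chi> \<and> refines {1..n} \<sigma> \<pi>}"

text \<open>Moebius function of a finite partial order, given as a relation; 0 on pairs that are not in
  the relation\<close>

function moebius :: "('p \<times> 'p) set \<Rightarrow> 'p \<Rightarrow> 'p \<Rightarrow> int" where
  "moebius r x y =
     (if finite r \<and> antisym r \<and> trans r \<and> (x, y) \<in> r
      then if x = y then 1
           else - (\<Sum>z\<in>{z. (x, z) \<in> r \<and> (z, y) \<in> r \<and> z \<noteq> y}. moebius r x z)
      else 0)"
  by pat_completeness auto
termination
proof (relation "measure (\<lambda>(r, x, y). card {w. (w, y) \<in> r \<and> w \<noteq> y})", goal_cases)
  case (2 r x y z)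
  then have r: "finite r" "antisym r" "trans r" and z: "(z, y) \<in> r" "z \<noteq> y" by auto
  have fin: "finite {w. (w, y) \<in> r \<and> w \<noteq> y}"
    by (rule finite_subset[of _ "fst ` r"]) (use r(1) in \<open>force+\<close>)
  have "{w. (w, z) \<in> r \<and> w \<noteq> z} \<subset> {w. (w, y) \<in> r \<and> w \<noteq> y}"
    using r(2,3) z by (auto dest: antisymD transD)
  from psubset_card_mono[OF fin this] show ?case by simp
qed simp

declare moebius.simps [simp del]

definition moment_partition ::
  "('a::ring_1 \<Rightarrow> complex) \<Rightarrow> nat set set \<Rightarrow> (nat \<Rightarrow> 'a) \<Rightarrow> complex" where
  "moment_partition \<phi> \<sigma> z = (\<Prod>V\<in>\<sigma>. \<phi> (prod_list (map z (sorted_list_of_set V))))"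

definition cumulant ::
  "('a::ring_1 \<Rightarrow> complex) \<Rightarrow> nat \<Rightarrow> (nat \<Rightarrow> color) \<Rightarrow> nat set set \<Rightarrow> (nat \<Rightarrow> 'a) \<Rightarrow> complex" where
  "cumulant \<phi> n \<chi> \<pi> z =
     (\<Sum>\<sigma>\<in>{\<sigma>. (\<sigma>, \<pi>) \<in> INC_order n \<chi>}.
        of_int (moebius (INC_order n \<chi>) \<sigma> \<pi>) * moment_partition \<phi> \<sigma> z)"

definition combinatorially_free_boolean_independent ::
  "('a::ring_1 \<Rightarrow> complex) \<Rightarrow> 'i set \<Rightarrow> ('i \<Rightarrow> face \<Rightarrow> 'a set) \<Rightarrow> bool" where
  "combinatorially_free_boolean_independent \<phi> I A \<longleftrightarrow>
     (\<forall>n (\<chi> :: nat \<Rightarrow> color) (\<beta> :: nat \<Rightarrow> face) (\<omega> :: nat \<Rightarrow> 'i) (z :: nat \<Rightarrow> 'a).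
        n \<ge> 1 \<and>
        {k\<in>{1..n}. \<beta> k = LeftFace} = {k\<in>{1..n}. \<chi> k = Bullet} \<and>
        (\<forall>k\<in>{1..n}. \<omega> k \<in> I) \<and>
        \<not> (\<exists>i. \<forall>k\<in>{1..n}. \<omega> k = i) \<and>
        (\<forall>k\<in>{1..n}. z k \<in> A (\<omega> k) (\<beta> k))
        \<longrightarrow> cumulant \<phi> n \<chi> {{1..n}} z = 0)"

end

theory Submission
  imports Defs "HOL-Library.FuncSet"
begin

text \<open>
The proof replaces the lattice \<open>INC(\<chi>)\<close> by Fock space operators. Let \<open>T a\<close> be operators, one for
each letter \<open>a\<close> of an alphabet coloured by bullets and circles, on a space with a vector \<open>\<xi>\<close> and a
functional \<open>\<phi>\<close> with \<open>\<phi> \<xi> = 1\<close>. Define \<^emph>\<open>Fock vectors\<close> \<open>y u\<close>, indexed by words \<open>u\<close>, by \<open>y [] = \<xi>\<close> and by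
requiring that
  \<open>T a (y u) = y (a u) + (\<Sum> K (a u') \<cdot> y u'')\<close>,
summed over those splittings \<open>u = u' u''\<close> for which \<open>u''\<close> is empty or \<open>a\<close> and \<open>u'\<close> consist of bullets,
where \<open>K (a u) = \<phi> (T a (y u))\<close>. Then \<open>\<phi>\<close> vanishes on \<open>y u\<close> for nonempty \<open>u\<close>. When a product of
operators is applied to \<open>\<xi>\<close> from right to left, \<open>u\<close> is the list of positions whose blocks are still open: a new
letter stays open itself (first term) or is the leftmost element of a block that it closes together
with \<open>u'\<close>. The restriction on the splittings says that a block containing a circle may only be closed
if no other position remains open, that is, if the block is not inner. So moments are sums of
products of \<open>K\<close> over interval-noncrossing partitions (\<open>moment_eq_sum_INC\<close>), and Moebius inversion identifies \<open>K\<close> with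
the cumulants (\<open>cumulant_top_eqI\<close>). No special feature of the representation enters.

In the reduced free product the Fock vectors can be computed: cut \<open>u\<close> into its maximal runs of letters
with the same index. If some circle in \<open>u\<close> is followed, further to the right, by a letter of another
index, then \<open>y u = 0\<close>; otherwise \<open>y u\<close> is the tensor product of the Fock vectors of the runs, taken in
the spaces \<open>X i\<close> (\<open>fock_factors_all\<close>). Consequently \<open>K\<close> vanishes on words with several indices (\<open>mixed_cum_zero\<close>)
and agrees on words with one index \<open>i\<close> with the \<open>K\<close> computed in \<open>X i\<close> (\<open>cum_mono\<close>). The first fact
shows that free-Boolean independence makes mixed cumulants vanish.

For the converse let every face act by left multiplication on a copy of the algebra, with the kernel
of the state as hyperplane and \<open>1\<close> as vector. The cumulants of the operators on the reduced free
product and those of the algebra agree: on words with one index by \<open>cum_mono\<close>, on the other words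
because both vanish. Hence the moments agree, which is free-Boolean independence.
\<close>

section \<open>Linear maps on subspaces\<close>

lemma vector_space_pscale: "vector_space s \<Longrightarrow> vector_space (pscale s)"
  unfolding vector_space_def by (auto simp: pscale_def fun_eq_iff)

lemma vector_space_mult: "vector_space ((*) :: complex \<Rightarrow> complex \<Rightarrow> complex)"
  by unfold_locales (auto simp: algebra_simps)

lemma lin_mapsD:
  assumes "H \<in> lin_maps sD sE D E"
  shows "x \<in> D \<Longrightarrow> y \<in> D \<Longrightarrow> H (x + y) = H x + H y" "x \<in> D \<Longrightarrow> H (sD c x) = sE c (H x)"
    "x \<in> D \<Longrightarrow> H x \<in> E" "x \<notin> D \<Longrightarrow> H x = 0"
  using assms by (auto simp: lin_maps_def)

lemma lin_opsD:
  assumes "T \<in> lin_ops s D"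
  shows "x \<in> D \<Longrightarrow> y \<in> D \<Longrightarrow> T (x + y) = T x + T y" "x \<in> D \<Longrightarrow> T (s c x) = s c (T x)"
    "x \<in> D \<Longrightarrow> T x \<in> D" "x \<notin> D \<Longrightarrow> T x = 0"
  using assms by (auto simp: lin_ops_def lin_maps_def)

lemma lin_maps_sum:
  assumes "vector_space sD" "vector_space sE" "module.subspace sD D" and H: "H \<in> lin_maps sD sE D E"
    and v: "\<And>x. x \<in> A \<Longrightarrow> v x \<in> D"
  shows "H (\<Sum>x\<in>A. v x) = (\<Sum>x\<in>A. H (v x))"
proof -
  interpret V: vector_space sD by fact
  interpret E: vector_space sE by fact
  have zero: "H 0 = 0"
    using lin_mapsD(2)[OF H V.subspace_0[OF assms(3)], of 0] by simp
  show ?thesis using v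
  proof (induction A rule: infinite_finite_induct)
    case (insert x A)
    then show ?case
      using lin_mapsD(1)[OF H, of "v x" "sum v A"] V.subspace_sum[OF assms(3), of A v] by simp
  qed (auto simp: zero)
qed

lemma lin_ops_add:
  assumes "vector_space s" "module.subspace s D" "S \<in> lin_ops s D" "T \<in> lin_ops s D"
  shows "S + T \<in> lin_ops s D"
proof -
  interpret vector_space s by fact
  show ?thesis using assms(3,4) subspace_add[OF assms(2)]
    by (simp add: lin_ops_def lin_maps_def algebra_simps)
qed

lemma lin_ops_pscale:
  assumes "vector_space s" "module.subspace s D" "S \<in> lin_ops s D"
  shows "pscale s c S \<in> lin_ops s D"
proof -
  interpret vector_space s by fact
  show ?thesis using assms(3) subspace_scale[OF assms(2)]
    by (simp add: lin_ops_def lin_maps_def pscale_def algebra_simps)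
qed

lemma lin_ops_comp:
  assumes "S \<in> lin_ops s D" "T \<in> lin_ops s D" "0 \<in> D" shows "S \<circ> T \<in> lin_ops s D"
proof -
  have "S 0 = 0 + S 0" by simp
  have "S (0 + 0) = S 0 + S 0" using assms unfolding lin_ops_def lin_maps_def by blast
  then have "S 0 = 0" by simp
  then show ?thesis using assms unfolding lin_ops_def lin_maps_def by simp
qed


section \<open>Moebius inversion\<close>

lemma sum_moebius_interval:
  assumes r: "finite r" "antisym r" "trans r" and xy: "(x, y) \<in> r" and refl: "(y, y) \<in> r"
  shows "(\<Sum>z\<in>{z. (x, z) \<in> r \<and> (z, y) \<in> r}. moebius r x z) = (if x = y then 1 else 0)"
proof (cases "x = y")
  case True
  then have "{z. (x, z) \<in> r \<and> (z, y) \<in> r} = {x}"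
    using r(2) xy by (auto dest: antisymD)
  then show ?thesis using True r xy by (simp add: moebius.simps)
next
  case False
  let ?B = "{z. (x, z) \<in> r \<and> (z, y) \<in> r \<and> z \<noteq> y}"
  have fin: "finite ?B"
    by (rule finite_subset[of _ "fst ` r"]) (use r(1) in force)+
  have "{z. (x, z) \<in> r \<and> (z, y) \<in> r} = insert y ?B" using xy refl by auto
  moreover have "moebius r x y = - sum (moebius r x) ?B"
    using False r xy by (subst moebius.simps) simp
  ultimately show ?thesis using fin False by simp
qed

text \<open>The recursion defining the Moebius function sums over its second argument, so it directly shows
that the sums of \<open>c y = (\<Sum>x\<le>y. \<mu> x y \<cdot> g x)\<close> over down-sets are \<open>g\<close>. The function \<open>k\<close> has the same down-set sums, and
these determine a function on a finite order by induction.\<close>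

lemma moebius_inversion:
  fixes g k :: "'p \<Rightarrow> complex"
  assumes r: "finite r" "antisym r" "trans r" and rfl: "\<And>x y. (x, y) \<in> r \<Longrightarrow> (x, x) \<in> r \<and> (y, y) \<in> r"
    and g: "\<And>y. (y, y) \<in> r \<Longrightarrow> g y = (\<Sum>x\<in>{x. (x, y) \<in> r}. k x)"
    and y: "(y, y) \<in> r"
  shows "(\<Sum>x\<in>{x. (x, y) \<in> r}. of_int (moebius r x y) * g x) = k y"
proof -
  define c where "c y = (\<Sum>x\<in>{x. (x, y) \<in> r}. of_int (moebius r x y) * g x)" for y
  have fin: "finite {x. (x, y) \<in> r}" for y
    by (rule finite_subset[of _ "fst ` r"]) (use r(1) in force)+
  have c: "(\<Sum>x\<in>{x. (x, y) \<in> r}. c x) = g y" if y: "(y, y) \<in> r" for y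
  proof -
    let ?D = "{x. (x, y) \<in> r}"
    have "(\<Sum>z\<in>?D. c z) = (\<Sum>z\<in>?D. \<Sum>x\<in>{x\<in>?D. (x, z) \<in> r}. of_int (moebius r x z) * g x)"
      unfolding c_def using r(3) by (intro sum.cong refl) (auto dest: transD)
    also have "\<dots> = (\<Sum>x\<in>?D. \<Sum>z\<in>{z\<in>?D. (x, z) \<in> r}. of_int (moebius r x z) * g x)"
      by (rule sum.swap_restrict) (use fin in auto)
    also have "\<dots> = (\<Sum>x\<in>?D. g x * of_int (\<Sum>z\<in>{z. (x, z) \<in> r \<and> (z, y) \<in> r}. moebius r x z))"
      by (intro sum.cong refl) (auto simp: sum_distrib_left mult.commute intro!: sum.cong)
    also have "\<dots> = (\<Sum>x\<in>?D. if x = y then g x else 0)"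
      using y by (intro sum.cong refl) (auto simp: sum_moebius_interval[OF r])
    also have "\<dots> = g y" using y fin by simp
    finally show ?thesis .
  qed
  have "(y, y) \<in> r \<longrightarrow> c y = k y" for y
  proof (induction "card {x. (x, y) \<in> r}" arbitrary: y rule: less_induct)
    case less
    show ?case
    proof
      assume y: "(y, y) \<in> r"
      let ?D = "{x. (x, y) \<in> r}"
      have eq: "c x = k x" if x: "x \<in> ?D - {y}" for x
      proof -
        have "{z. (z, x) \<in> r} \<subset> ?D" using x y r(2,3) by (auto dest: transD antisymD)
        from psubset_card_mono[OF fin this] show ?thesis using less x rfl by blast
      qed
      have "c y + sum c (?D - {y}) = k y + sum k (?D - {y})"
        using c[OF y] g[OF y] sum.remove[OF fin, of y y c] sum.remove[OF fin, of y y k] y by simp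
      then show "c y = k y" using sum.cong[OF refl eq, of "?D - {y}"] by simp
    qed
  qed
  with y show ?thesis by (simp add: c_def)
qed

section \<open>Interval-noncrossing partitions\<close>

text \<open>Interval-noncrossing partitions of an arbitrary set of positions; the blocks of a partition carry
such partitions themselves.\<close>

definition INC_on :: "nat set \<Rightarrow> (nat \<Rightarrow> color) \<Rightarrow> nat set set set" where
  "INC_on S \<chi> = {\<pi>. partition_on S \<pi> \<and> noncrossing \<pi> \<and>
     (\<forall>V. inner_block \<pi> V \<longrightarrow> (\<forall>k\<in>V. \<chi> k \<noteq> Circle))}"

lemma finite_INC_on: "finite S \<Longrightarrow> finite (INC_on S \<chi>)"
  by (rule finite_subset[OF _ finitely_many_partition_on]) (auto simp: INC_on_def)

lemma noncrossingD:
  assumes "noncrossing \<pi>" "V \<in> \<pi>" "W \<in> \<pi>" "V \<noteq> W"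
    and "a \<in> V" "b \<in> W" "c \<in> V" "d \<in> W" "a < b" "b < c" "c < d"
  shows False
  using assms unfolding noncrossing_def by meson

lemma inner_blockI_noncrossing:
  assumes "partition_on S \<pi>" "noncrossing \<pi>" "V \<in> \<pi>" "W \<in> \<pi>" "V \<noteq> W"
    and "s \<in> W" "t \<in> W" "k \<in> V" "s < k" "k < t"
  shows "inner_block \<pi> V"
proof -
  have disj: "V \<inter> W = {}"
    using assms(1,3-5) by (auto simp: partition_on_def disjoint_def)
  have "s < v \<and> v < t" if "v \<in> V" for v
  proof (rule ccontr)
    assume "\<not> ?thesis"
    moreover have "v \<noteq> s" "v \<noteq> t" using disj that assms by auto
    ultimately consider "v < s" | "t < v" by linarith
    then show False
      using noncrossingD[of \<pi> V W v s k t] noncrossingD[of \<pi> W V s k t v] assms that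
      by cases blast+
  qed
  then show ?thesis using assms unfolding inner_block_def by blast
qed

text \<open>A single condition on triples \<open>s < k < t\<close> with \<open>s, t\<close> in one block and \<open>k\<close> in another: noncrossingness
and the restriction on inner blocks are the two halves of its conclusion. This is the form in which
membership is checked below.\<close>

lemma INC_on_iff:
  "\<pi> \<in> INC_on S \<chi> \<longleftrightarrow> partition_on S \<pi> \<and>
     (\<forall>V\<in>\<pi>. \<forall>W\<in>\<pi>. V \<noteq> W \<longrightarrow> (\<forall>s\<in>W. \<forall>k\<in>V. \<forall>t\<in>W. s < k \<longrightarrow> k < t \<longrightarrow>
        \<chi> k \<noteq> Circle \<and> (\<forall>u\<in>V. u < t)))"
  (is "_ \<longleftrightarrow> _ \<and> ?R")
proof -
  have "noncrossing \<pi> \<and> (\<forall>V. inner_block \<pi> V \<longrightarrow> (\<forall>k\<in>V. \<chi> k \<noteq> Circle)) \<longleftrightarrow> ?R"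
    if p: "partition_on S \<pi>"
  proof
    have dj: "V \<inter> W = {}" if "V \<in> \<pi>" "W \<in> \<pi>" "V \<noteq> W" for V W
      using that p by (auto simp: partition_on_def disjoint_def)
    assume l: "noncrossing \<pi> \<and> (\<forall>V. inner_block \<pi> V \<longrightarrow> (\<forall>k\<in>V. \<chi> k \<noteq> Circle))"
    show ?R
    proof (intro ballI impI)
      fix V W s k t assume a: "V \<in> \<pi>" "W \<in> \<pi>" "V \<noteq> W" "s \<in> W" "k \<in> V" "t \<in> W" "s < k" "k < t"
      then have "inner_block \<pi> V" using inner_blockI_noncrossing[OF p, of V W s t k] l by blast
      moreover have "u < t" if "u \<in> V" for u
      proof -
        have "\<not> t < u" using noncrossingD[of \<pi> W V s k t u] l a that by blast
        moreover have "u \<noteq> t" using dj[OF a(1-3)] that a by auto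
        ultimately show ?thesis by simp
      qed
      ultimately show "\<chi> k \<noteq> Circle \<and> (\<forall>u\<in>V. u < t)" using l a(5) by blast
    qed
  next
    assume R: ?R
    show "noncrossing \<pi> \<and> (\<forall>V. inner_block \<pi> V \<longrightarrow> (\<forall>k\<in>V. \<chi> k \<noteq> Circle))"
    proof (intro conjI allI impI ballI)
      show "noncrossing \<pi>" unfolding noncrossing_def
      proof (intro ballI impI notI)
        fix V W assume VW: "V \<in> \<pi>" "W \<in> \<pi>" "V \<noteq> W"
          and "\<exists>a\<in>V. \<exists>b\<in>W. \<exists>c\<in>V. \<exists>d\<in>W. a < b \<and> b < c \<and> c < d"
        then obtain a b c d where "a \<in> V" "b \<in> W" "c \<in> V" "d \<in> W" "a < b" "b < c" "c < d" by blast
        with R[rule_format, of W V a b c] VW have "d < c" by blast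
        with \<open>c < d\<close> show False by simp
      qed
      fix V k assume i: "inner_block \<pi> V" and k: "k \<in> V"
      then obtain W s t where W: "W \<in> \<pi>" "s \<in> W" "t \<in> W" "\<forall>v\<in>V. s < v \<and> v < t" "V \<in> \<pi>"
        unfolding inner_block_def by blast
      then have "V \<noteq> W" by blast
      with R[rule_format, of V W s k t] W k show "\<chi> k \<noteq> Circle" by blast
    qed
  qed
  then show ?thesis unfolding INC_on_def mem_Collect_eq by (rule conj_cong[OF refl])
qed

lemma INC_onD:
  assumes "\<pi> \<in> INC_on S \<chi>" "V \<in> \<pi>" "W \<in> \<pi>" "V \<noteq> W"
    and "s \<in> W" "k \<in> V" "t \<in> W" "s < k" "k < t"
  shows "\<chi> k \<noteq> Circle \<and> (\<forall>u\<in>V. u < t)"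
  using assms unfolding INC_on_iff by meson

lemma INC_on_restrict:
  assumes "\<pi> \<in> INC_on S \<chi>" "refines S \<pi> \<tau>" "V \<in> \<tau>"
  shows "{U\<in>\<pi>. U \<subseteq> V} \<in> INC_on V \<chi>"
  unfolding INC_on_iff
proof (intro conjI ballI impI)
  show "partition_on V {U\<in>\<pi>. U \<subseteq> V}" by (rule refines_obtains_subset[OF assms(2,3)])
  fix U W s k t assume "U \<in> {U\<in>\<pi>. U \<subseteq> V}" "W \<in> {U\<in>\<pi>. U \<subseteq> V}" "U \<noteq> W"
    "s \<in> W" "k \<in> U" "t \<in> W" "s < k" "k < t"
  then have "\<chi> k \<noteq> Circle \<and> (\<forall>u\<in>U. u < t)"
    by (intro INC_onD[OF assms(1), of U W s k t]) auto
  then show "\<chi> k \<noteq> Circle" "\<And>u. u \<in> U \<Longrightarrow> u < t" by blast+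
qed

text \<open>Choosing interval-noncrossing partitions inside the blocks of one yields an interval-noncrossing
partition: a block that lies under a block coming from another part \<open>V'\<close> of \<open>\<tau>\<close> is contained in a part of
\<open>\<tau>\<close> that is inner to \<open>V'\<close>, so it contains no circle.\<close>

lemma INC_on_glue:
  assumes \<tau>: "\<tau> \<in> INC_on S \<chi>" and f: "\<And>V. V \<in> \<tau> \<Longrightarrow> f V \<in> INC_on V \<chi>"
  shows "(\<Union>V\<in>\<tau>. f V) \<in> INC_on S \<chi>" "refines S (\<Union>V\<in>\<tau>. f V) \<tau>"
    and "\<And>V. V \<in> \<tau> \<Longrightarrow> {U\<in>(\<Union>V\<in>\<tau>. f V). U \<subseteq> V} = f V"
proof -
  have p: "partition_on S \<tau>" using \<tau> by (simp add: INC_on_iff)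
  have pf: "partition_on V (f V)" if "V \<in> \<tau>" for V using f[OF that] by (simp add: INC_on_iff)
  have dj: "V \<inter> W = {}" if "V \<in> \<tau>" "W \<in> \<tau>" "V \<noteq> W" for V W
    using that p by (auto simp: partition_on_def disjoint_def)
  have sub: "U \<subseteq> V" "U \<noteq> {}" if "V \<in> \<tau>" "U \<in> f V" for U V
    using pf[OF that(1)] that(2) by (auto simp: partition_on_def)
  have pu: "partition_on S (\<Union>V\<in>\<tau>. f V)"
  proof (rule partition_onI)
    show "\<Union> (\<Union>V\<in>\<tau>. f V) = S"
      using p pf unfolding partition_on_def by blast
    show "{} \<notin> (\<Union>V\<in>\<tau>. f V)" using sub by blast
    fix U U' assume U: "U \<in> (\<Union>V\<in>\<tau>. f V)" "U' \<in> (\<Union>V\<in>\<tau>. f V)" "U \<noteq> U'"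
    then obtain V V' where V: "V \<in> \<tau>" "U \<in> f V" "V' \<in> \<tau>" "U' \<in> f V'" by blast
    show "disjnt U U'"
    proof (cases "V = V'")
      case True
      with V U pf[OF V(1)] show ?thesis by (auto simp: partition_on_def disjoint_def disjnt_def)
    next
      case False
      with V dj[of V V'] sub show ?thesis unfolding disjnt_def by blast
    qed
  qed
  then show "refines S (\<Union>V\<in>\<tau>. f V) \<tau>" using p sub unfolding refines_def by blast
  show "{U\<in>(\<Union>V\<in>\<tau>. f V). U \<subseteq> V} = f V" if "V \<in> \<tau>" for V
  proof
    show "{U\<in>(\<Union>V\<in>\<tau>. f V). U \<subseteq> V} \<subseteq> f V"
    proof
      fix U assume "U \<in> {U\<in>(\<Union>V\<in>\<tau>. f V). U \<subseteq> V}"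
      then obtain V' where V': "V' \<in> \<tau>" "U \<in> f V'" "U \<subseteq> V" by blast
      with dj[of V V'] sub[of V' U] that have "V = V'" by blast
      with V' show "U \<in> f V" by simp
    qed
  qed (use that sub in blast)
  show "(\<Union>V\<in>\<tau>. f V) \<in> INC_on S \<chi>"
    unfolding INC_on_iff
  proof (intro conjI pu ballI impI)
    fix U U' s k t
    assume a: "U \<in> (\<Union>V\<in>\<tau>. f V)" "U' \<in> (\<Union>V\<in>\<tau>. f V)" "U \<noteq> U'" "s \<in> U'" "k \<in> U" "t \<in> U'"
      "s < k" "k < t"
    then obtain V V' where V: "V \<in> \<tau>" "U \<in> f V" "V' \<in> \<tau>" "U' \<in> f V'" by blast
    have "\<chi> k \<noteq> Circle \<and> (\<forall>u\<in>U. u < t)"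
    proof (cases "V = V'")
      case True
      with f[OF V(1)] V have "U \<in> f V" "U' \<in> f V" "f V \<in> INC_on V \<chi>" by auto
      then show ?thesis
        using INC_onD[of "f V" V \<chi> U U' s k t] a by blast
    next
      case False
      have "k \<in> V" "s \<in> V'" "t \<in> V'" using sub V a by blast+
      with INC_onD[OF \<tau> V(1,3) False, of s k t] a have "\<chi> k \<noteq> Circle" "\<forall>u\<in>V. u < t" by blast+
      then show ?thesis using sub V by blast
    qed
    then show "\<chi> k \<noteq> Circle" "\<And>u. u \<in> U \<Longrightarrow> u < t" by blast+
  qed
qed

text \<open>The interval below \<open>\<tau>\<close> is the product of the lattices of its blocks. This makes the cumulants
multiplicative along blocks.\<close>

lemma prod_sum_INC_on:
  fixes K :: "nat set \<Rightarrow> complex"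
  assumes S: "finite S" and \<tau>: "\<tau> \<in> INC_on S \<chi>"
  shows "(\<Prod>V\<in>\<tau>. \<Sum>\<pi>\<in>INC_on V \<chi>. \<Prod>U\<in>\<pi>. K U) =
    (\<Sum>\<pi>\<in>{\<pi>\<in>INC_on S \<chi>. refines S \<pi> \<tau>}. \<Prod>U\<in>\<pi>. K U)"
proof -
  have p: "partition_on S \<tau>" using \<tau> by (simp add: INC_on_iff)
  have fin: "finite \<tau>" "\<And>V. V \<in> \<tau> \<Longrightarrow> finite V"
    using finite_elements[OF S p] p S by (auto simp: partition_on_def intro: finite_subset)
  have "(\<Prod>V\<in>\<tau>. \<Sum>\<pi>\<in>INC_on V \<chi>. \<Prod>U\<in>\<pi>. K U)
      = (\<Sum>f\<in>PiE \<tau> (\<lambda>V. INC_on V \<chi>). \<Prod>V\<in>\<tau>. \<Prod>U\<in>f V. K U)"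
    by (rule prod_sum_PiE) (use fin finite_INC_on in auto)
  also have "\<dots> = (\<Sum>\<pi>\<in>{\<pi>\<in>INC_on S \<chi>. refines S \<pi> \<tau>}. \<Prod>U\<in>\<pi>. K U)"
  proof (rule sum.reindex_bij_witness[where i = "\<lambda>\<pi>. \<lambda>V\<in>\<tau>. {U\<in>\<pi>. U \<subseteq> V}"
        and j = "\<lambda>f. \<Union>V\<in>\<tau>. f V"])
    fix f assume "f \<in> PiE \<tau> (\<lambda>V. INC_on V \<chi>)"
    then have f: "\<And>V. V \<in> \<tau> \<Longrightarrow> f V \<in> INC_on V \<chi>" and ex: "f \<in> extensional \<tau>"
      by (auto simp: PiE_def)
    note g = INC_on_glue[OF \<tau> f]
    show "(\<Union>V\<in>\<tau>. f V) \<in> {\<pi>\<in>INC_on S \<chi>. refines S \<pi> \<tau>}" using g(1,2) by simp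
    show "(\<lambda>V\<in>\<tau>. {U\<in>\<Union>V\<in>\<tau>. f V. U \<subseteq> V}) = f"
      using g(3) ex by (intro ext) (auto simp: restrict_def extensional_def)
    have "finite (f V)" if "V \<in> \<tau>" for V
      using f[OF that] fin(2)[OF that] by (auto simp: INC_on_iff intro: finite_elements)
    moreover have "f V \<inter> f V' = {}" if "V \<in> \<tau>" "V' \<in> \<tau>" "V \<noteq> V'" for V V'
    proof (rule ccontr)
      assume "f V \<inter> f V' \<noteq> {}"
      then obtain U where U: "U \<in> f V" "U \<in> f V'" by blast
      then have "U \<subseteq> V" "U \<subseteq> V'" "U \<noteq> {}"
        using f[OF that(1)] f[OF that(2)] by (auto simp: INC_on_iff partition_on_def)
      moreover have "V \<inter> V' = {}" using that p by (auto simp: partition_on_def disjoint_def)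
      ultimately show False by blast
    qed
    ultimately show "(\<Prod>U\<in>(\<Union>V\<in>\<tau>. f V). K U) = (\<Prod>V\<in>\<tau>. \<Prod>U\<in>f V. K U)"
      by (intro prod.UNION_disjoint) (use fin in auto)
  next
    fix \<pi> assume "\<pi> \<in> {\<pi>\<in>INC_on S \<chi>. refines S \<pi> \<tau>}"
    then have \<pi>: "\<pi> \<in> INC_on S \<chi>" "refines S \<pi> \<tau>" by auto
    show "(\<Union>V\<in>\<tau>. (\<lambda>V\<in>\<tau>. {U\<in>\<pi>. U \<subseteq> V}) V) = \<pi>"
      using \<pi>(2) unfolding refines_def by auto
    show "(\<lambda>V\<in>\<tau>. {U\<in>\<pi>. U \<subseteq> V}) \<in> PiE \<tau> (\<lambda>V. INC_on V \<chi>)"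
      using INC_on_restrict[OF \<pi>] by auto
  qed
  finally show ?thesis .
qed

text \<open>A function on sets of positions that satisfies the moment-cumulant relation on every nonempty subset is
the family of cumulants: by multiplicativity the relation holds below every \<open>\<tau>\<close>, and Moebius
inversion applies.\<close>

lemma cumulant_top_eqI:
  fixes K :: "nat set \<Rightarrow> complex"
  assumes n: "n \<ge> 1"
    and mom: "\<And>S. S \<subseteq> {1..n} \<Longrightarrow> S \<noteq> {} \<Longrightarrow>
      \<phi> (prod_list (map z (sorted_list_of_set S))) = (\<Sum>\<pi>\<in>INC_on S \<chi>. \<Prod>V\<in>\<pi>. K V)"
  shows "cumulant \<phi> n \<chi> {{1..n}} z = K {1..n}"
proof -
  let ?r = "INC_order n \<chi>"
  have INC: "INC n \<chi> = INC_on {1..n} \<chi>" by (simp add: INC_def INC_on_def)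
  have rr: "(\<sigma>, \<pi>) \<in> ?r \<longleftrightarrow> \<sigma> \<in> INC_on {1..n} \<chi> \<and> \<pi> \<in> INC_on {1..n} \<chi> \<and> refines {1..n} \<sigma> \<pi>" for \<sigma> \<pi>
    by (simp add: INC_order_def INC)
  have refl: "(\<pi>, \<pi>) \<in> ?r \<longleftrightarrow> \<pi> \<in> INC_on {1..n} \<chi>" for \<pi>
    unfolding rr by (auto simp: INC_on_def intro: refines_refl)
  have top: "({{1..n}}, {{1..n}}) \<in> ?r"
    unfolding refl using n by (auto simp: INC_on_iff partition_on_def)
  have "(\<Sum>\<sigma>\<in>{\<sigma>. (\<sigma>, {{1..n}}) \<in> ?r}. of_int (moebius ?r \<sigma> {{1..n}}) * moment_partition \<phi> \<sigma> z)
      = (\<Prod>V\<in>{{1..n}}. K V)"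
  proof (rule moebius_inversion[OF _ _ _ _ _ top])
    show "finite ?r"
      by (rule finite_subset[of _ "INC_on {1..n} \<chi> \<times> INC_on {1..n} \<chi>"])
        (auto simp: rr finite_INC_on)
    show "antisym ?r" unfolding antisym_def rr using refines_asym by blast
    show "trans ?r" by (rule transI) (auto simp: rr intro: refines_trans)
    show "(x, x) \<in> ?r \<and> (y, y) \<in> ?r" if "(x, y) \<in> ?r" for x y
      using that unfolding refl by (simp add: rr)
    show "moment_partition \<phi> \<tau> z = (\<Sum>\<pi>\<in>{\<pi>. (\<pi>, \<tau>) \<in> ?r}. \<Prod>V\<in>\<pi>. K V)"
      if "(\<tau>, \<tau>) \<in> ?r" for \<tau>
    proof -
      have \<tau>: "\<tau> \<in> INC_on {1..n} \<chi>" using that by (simp add: refl)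
      then have "V \<subseteq> {1..n} \<and> V \<noteq> {}" if "V \<in> \<tau>" for V
        using that by (auto simp: INC_on_iff partition_on_def)
      then have "moment_partition \<phi> \<tau> z = (\<Prod>V\<in>\<tau>. \<Sum>\<pi>\<in>INC_on V \<chi>. \<Prod>U\<in>\<pi>. K U)"
        unfolding moment_partition_def by (intro prod.cong) (auto simp: mom)
      also have "\<dots> = (\<Sum>\<pi>\<in>{\<pi>\<in>INC_on {1..n} \<chi>. refines {1..n} \<pi> \<tau>}. \<Prod>U\<in>\<pi>. K U)"
        by (rule prod_sum_INC_on[OF _ \<tau>]) simp
      also have "{\<pi>\<in>INC_on {1..n} \<chi>. refines {1..n} \<pi> \<tau>} = {\<pi>. (\<pi>, \<tau>) \<in> ?r}"
        using \<tau> by (auto simp: rr)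
      finally show ?thesis .
    qed
  qed
  then show ?thesis by (simp add: cumulant_def)
qed

section \<open>Partitions with open blocks\<close>

text \<open>Partitions of the set \<open>C\<close> of closed positions in the presence of a set \<open>A\<close> of open positions, each of which
will later be joined to some position further to the left. So no block may surround an open
position, and a circle to the left of an open position would become inner.\<close>

definition open_INC :: "nat set \<Rightarrow> nat set \<Rightarrow> (nat \<Rightarrow> color) \<Rightarrow> nat set set set" where
  "open_INC C A \<chi> = {\<pi>\<in>INC_on C \<chi>. (\<forall>W\<in>\<pi>. \<forall>s\<in>W. \<forall>t\<in>W. \<forall>a\<in>A. \<not> (s < a \<and> a < t)) \<and>
     (\<forall>k\<in>C. \<forall>a\<in>A. k < a \<longrightarrow> \<chi> k \<noteq> Circle)}"

definition open_sum :: "(nat \<Rightarrow> color) \<Rightarrow> (nat set \<Rightarrow> complex) \<Rightarrow> nat set \<Rightarrow> nat set \<Rightarrow> complex" where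
  "open_sum \<chi> K C A = (\<Sum>\<pi>\<in>open_INC C A \<chi>. \<Prod>V\<in>\<pi>. K V)"

text \<open>The sets \<open>U\<close> that may form a block with a new leftmost position \<open>k\<close> when the positions in \<open>A\<close> remain
open. The sets \<open>C\<close> and \<open>A\<close> are meant to lie to the right of \<open>k\<close>.\<close>

definition closing_sets :: "(nat \<Rightarrow> color) \<Rightarrow> nat \<Rightarrow> nat set \<Rightarrow> nat set \<Rightarrow> nat set set" where
  "closing_sets \<chi> k C A =
     {U. U \<subseteq> C \<and> (\<forall>u\<in>U. \<forall>a\<in>A. u < a) \<and> (A = {} \<or> (\<forall>v\<in>insert k U. \<chi> v = Bullet))}"

lemma open_INC_empty: "open_INC C {} \<chi> = INC_on C \<chi>"
  by (auto simp: open_INC_def)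

lemma finite_open_INC: "finite C \<Longrightarrow> finite (open_INC C A \<chi>)"
  by (simp add: open_INC_def finite_INC_on)

lemma INC_on_empty: "INC_on {} \<chi> = {{}}"
  by (auto simp: INC_on_iff partition_on_empty)

lemma open_INCD:
  assumes "\<pi> \<in> open_INC C A \<chi>"
  shows "\<pi> \<in> INC_on C \<chi>" "partition_on C \<pi>"
    and "W \<in> \<pi> \<Longrightarrow> s \<in> W \<Longrightarrow> t \<in> W \<Longrightarrow> a \<in> A \<Longrightarrow> s < a \<Longrightarrow> a < t \<Longrightarrow> False"
    and "k \<in> C \<Longrightarrow> a \<in> A \<Longrightarrow> k < a \<Longrightarrow> \<chi> k \<noteq> Circle"
  using assms unfolding open_INC_def INC_on_def by (simp, simp, (simp, meson)+)

lemma open_sum_insert_open: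
  assumes "\<And>c. c \<in> C \<Longrightarrow> k < c"
  shows "open_sum \<chi> K C (insert k A) = open_sum \<chi> K C A"
proof -
  have "\<not> s < k" if "\<pi> \<in> INC_on C \<chi>" "W \<in> \<pi>" "s \<in> W" for \<pi> W s
  proof -
    have "s \<in> C" using that by (auto simp: INC_on_iff partition_on_def)
    with assms[of s] show ?thesis by simp
  qed
  moreover have "\<not> c < k" if "c \<in> C" for c using assms[OF that] by simp
  ultimately have "open_INC C (insert k A) \<chi> = open_INC C A \<chi>"
    unfolding open_INC_def by auto
  then show ?thesis by (simp add: open_sum_def)
qed

lemma not_Circle: "c \<noteq> Circle \<longleftrightarrow> c = Bullet"
  by (cases c) auto

text \<open>The next two lemmas say that removing the block \<open>insert k U\<close> of the leftmost position \<open>k\<close> is a bijection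
if the elements of \<open>U\<close> are kept as open positions: what the block forbade for the other blocks is
exactly what open positions forbid.\<close>

lemma open_INC_close:
  assumes dj: "C \<inter> A = {}" and k: "\<And>x. x \<in> C \<union> A \<Longrightarrow> k < x"
    and U: "U \<in> closing_sets \<chi> k C A" and \<rho>: "\<rho> \<in> open_INC (C - U) (U \<union> A) \<chi>"
  shows "insert (insert k U) \<rho> \<in> open_INC (insert k C) A \<chi>" "insert k U \<notin> \<rho>"
proof -
  have \<rho>I: "\<rho> \<in> INC_on (C - U) \<chi>" and p: "partition_on (C - U) \<rho>"
    and gap: "\<And>W s t a. W \<in> \<rho> \<Longrightarrow> s \<in> W \<Longrightarrow> t \<in> W \<Longrightarrow> a \<in> U \<union> A \<Longrightarrow> s < a \<Longrightarrow> a < t \<Longrightarrow> False"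
    and bul: "\<And>x a. x \<in> C - U \<Longrightarrow> a \<in> U \<union> A \<Longrightarrow> x < a \<Longrightarrow> \<chi> x \<noteq> Circle"
    using open_INCD[OF \<rho>] by metis+
  have UC: "U \<subseteq> C" and UA: "\<And>u a. u \<in> U \<Longrightarrow> a \<in> A \<Longrightarrow> u < a"
    and Ub: "A = {} \<or> (\<forall>v\<in>insert k U. \<chi> v \<noteq> Circle)"
    using U by (auto simp: closing_sets_def)
  have sub: "W \<subseteq> C - U" if "W \<in> \<rho>" for W using p that by (auto simp: partition_on_def)
  have kC: "k \<notin> C" using k by blast
  show notin: "insert k U \<notin> \<rho>" using sub kC by blast
  have part: "partition_on (insert k C) (insert (insert k U) \<rho>)"
  proof (subst partition_on_insert)
    show "disjnt (insert k U) (\<Union> \<rho>)" using p kC by (auto simp: partition_on_def disjnt_def)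
    have "insert k C - insert k U = C - U" using kC by auto
    then show "partition_on (insert k C - insert k U) \<rho> \<and> insert k U \<subseteq> insert k C \<and> insert k U \<noteq> {}"
      using p UC by auto
  qed
  have "insert (insert k U) \<rho> \<in> INC_on (insert k C) \<chi>"
    unfolding INC_on_iff
  proof (intro conjI part ballI impI)
    fix V W s x t
    assume a: "V \<in> insert (insert k U) \<rho>" "W \<in> insert (insert k U) \<rho>" "V \<noteq> W" "s \<in> W" "x \<in> V"
      "t \<in> W" "s < x" "x < t"
    have "\<chi> x \<noteq> Circle \<and> (\<forall>u\<in>V. u < t)"
    proof (cases "V = insert k U")
      case True
      then have W: "W \<in> \<rho>" using a by blast
      then have "s \<in> C" using a sub by blast
      then have "x \<in> U" using a True k[of s] by auto
      then show ?thesis using gap[OF W a(4,6), of x] a by blast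
    next
      case False
      then have V: "V \<in> \<rho>" using a by blast
      show ?thesis
      proof (cases "W = insert k U")
        case True
        have xC: "x \<in> C - U" using V a sub by blast
        then have t: "t \<in> U" using True a k[of x] by auto
        then have "\<chi> x \<noteq> Circle" using bul[OF xC, of t] a by blast
        moreover have "u < t" if u: "u \<in> V" for u
        proof -
          have "u \<noteq> t" using u V sub t by blast
          moreover have "\<not> t < u" using gap[OF V a(5) u, of t] t a by blast
          ultimately show ?thesis by simp
        qed
        ultimately show ?thesis by blast
      next
        case False
        then have "W \<in> \<rho>" using a by blast
        then show ?thesis using INC_onD[OF \<rho>I V _ a(3-8)] by blast
      qed
    qed
    then show "\<chi> x \<noteq> Circle" "\<And>u. u \<in> V \<Longrightarrow> u < t" by blast+
  qed
  moreover have "\<not> (s < a \<and> a < t)"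
    if W: "W \<in> insert (insert k U) \<rho>" "s \<in> W" "t \<in> W" "a \<in> A" for W s t a
  proof (cases "W = insert k U")
    case True
    then have "t < a" using W UA k[of a] by auto
    then show ?thesis by simp
  next
    case False
    with W gap[of W s t a] show ?thesis by blast
  qed
  moreover have "\<chi> x \<noteq> Circle" if x: "x \<in> insert k C" "a \<in> A" "x < a" for x a
  proof (cases "x \<in> insert k U")
    case True
    with Ub x show ?thesis by blast
  next
    case False
    with bul[of x a] x show ?thesis by blast
  qed
  ultimately show "insert (insert k U) \<rho> \<in> open_INC (insert k C) A \<chi>"
    unfolding open_INC_def by blast
qed

lemma open_INC_reopen:
  assumes dj: "C \<inter> A = {}" and k: "\<And>x. x \<in> C \<union> A \<Longrightarrow> k < x"
    and \<pi>: "\<pi> \<in> open_INC (insert k C) A \<chi>" and V: "V \<in> \<pi>" "k \<in> V"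
  shows "V - {k} \<in> closing_sets \<chi> k C A"
    and "\<pi> - {V} \<in> open_INC (C - (V - {k})) ((V - {k}) \<union> A) \<chi>"
proof -
  have \<pi>I: "\<pi> \<in> INC_on (insert k C) \<chi>" and p: "partition_on (insert k C) \<pi>"
    and gap: "\<And>W s t a. W \<in> \<pi> \<Longrightarrow> s \<in> W \<Longrightarrow> t \<in> W \<Longrightarrow> a \<in> A \<Longrightarrow> s < a \<Longrightarrow> a < t \<Longrightarrow> False"
    and bul: "\<And>x a. x \<in> insert k C \<Longrightarrow> a \<in> A \<Longrightarrow> x < a \<Longrightarrow> \<chi> x \<noteq> Circle"
    using open_INCD[OF \<pi>] by metis+
  have VC: "V \<subseteq> insert k C" using p V by (auto simp: partition_on_def)
  have kC: "k \<notin> C" "k \<notin> A" using k by blast+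
  have VA: "u < a" if "u \<in> V" "a \<in> A" for u a
  proof -
    have "k < a" using k that by blast
    then have "\<not> a < u" using gap[OF V that(1), of a] that by blast
    moreover have "u \<noteq> a" using that VC dj kC by blast
    ultimately show ?thesis by simp
  qed
  have "\<chi> v = Bullet" if "v \<in> V" "A \<noteq> {}" for v
  proof -
    obtain a where "a \<in> A" using \<open>A \<noteq> {}\<close> by blast
    then show ?thesis using bul[of v a] VA[of v a] that VC not_Circle by blast
  qed
  then show "V - {k} \<in> closing_sets \<chi> k C A"
    using VC VA V by (auto simp: closing_sets_def)
  have dj2: "V \<inter> W = {}" if "W \<in> \<pi> - {V}" for W
    using that p V by (auto simp: partition_on_def disjoint_def)
  have CV: "C - (V - {k}) = insert k C - V" using V kC by blast
  have p': "partition_on (C - (V - {k})) (\<pi> - {V})"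
  proof -
    have "partition_on (insert k C) (insert V (\<pi> - {V}))" using p V by (simp add: insert_absorb)
    then show ?thesis using dj2 unfolding CV by (subst (asm) partition_on_insert) (auto simp: disjnt_def)
  qed
  have sub: "W \<subseteq> C" "W \<inter> V = {}" if "W \<in> \<pi> - {V}" for W
    using that p dj2[OF that] V by (auto simp: partition_on_def)
  have INC: "\<pi> - {V} \<in> INC_on (C - (V - {k})) \<chi>"
    unfolding INC_on_iff
  proof (intro conjI p' ballI impI)
    fix V' W s x t
    assume "V' \<in> \<pi> - {V}" "W \<in> \<pi> - {V}" "V' \<noteq> W" "s \<in> W" "x \<in> V'" "t \<in> W" "s < x" "x < t"
    then have "\<chi> x \<noteq> Circle \<and> (\<forall>u\<in>V'. u < t)" by (intro INC_onD[OF \<pi>I, of V' W s x t]) auto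
    then show "\<chi> x \<noteq> Circle" "\<And>u. u \<in> V' \<Longrightarrow> u < t" by blast+
  qed
  have "\<not> (s < a \<and> a < t)"
    if W: "W \<in> \<pi> - {V}" "s \<in> W" "t \<in> W" "a \<in> (V - {k}) \<union> A" for W s t a
  proof
    assume st: "s < a \<and> a < t"
    show False
    proof (cases "a \<in> A")
      case True
      with gap[of W s t a] W st show False by blast
    next
      case False
      have "k < s" using k[of s] sub(1)[OF W(1)] W(2) by blast
      then have "\<forall>u\<in>W. u < a"
        using INC_onD[OF \<pi>I, of W V k s a] W V st False by blast
      with W st show False by auto
    qed
  qed
  moreover have "\<chi> x \<noteq> Circle"
    if x: "x \<in> C - (V - {k})" "a \<in> (V - {k}) \<union> A" "x < a" for x a
  proof (cases "a \<in> A")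
    case True
    with bul[of x a] x show ?thesis by blast
  next
    case False
    obtain W where W: "W \<in> \<pi> - {V}" "x \<in> W" using x(1) p' by (auto simp: partition_on_def)
    have "k < x" using k x by blast
    then show ?thesis using INC_onD[OF \<pi>I, of W V k x a] W V x False by blast
  qed
  ultimately show "\<pi> - {V} \<in> open_INC (C - (V - {k})) ((V - {k}) \<union> A) \<chi>"
    using INC unfolding open_INC_def by blast
qed

text \<open>The recursion by which the weights of partitions with open blocks are computed from right to left;
it matches the splittings of words in the definition of the Fock vectors.\<close>

lemma open_sum_insert_closed:
  assumes C: "finite C" and dj: "C \<inter> A = {}" and k: "\<And>x. x \<in> C \<union> A \<Longrightarrow> k < x"
  shows "open_sum \<chi> K (insert k C) A =
    (\<Sum>U\<in>closing_sets \<chi> k C A. K (insert k U) * open_sum \<chi> K (C - U) (U \<union> A))"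
proof -
  have kC: "k \<notin> C" using k by blast
  have finU: "finite (closing_sets \<chi> k C A)"
    by (rule finite_subset[of _ "Pow C"]) (use C in \<open>auto simp: closing_sets_def\<close>)
  define blk where "blk \<pi> = (THE V. V \<in> \<pi> \<and> k \<in> V)" for \<pi> :: "nat set set"
  have blk: "blk \<pi> = V" if "partition_on S \<pi>" "V \<in> \<pi>" "k \<in> V" for \<pi> S V
    unfolding blk_def using that by (intro the_equality) (auto simp: partition_on_def disjoint_def)
  have "(\<Sum>U\<in>closing_sets \<chi> k C A. K (insert k U) * open_sum \<chi> K (C - U) (U \<union> A)) =
    (\<Sum>(U, \<rho>)\<in>Sigma (closing_sets \<chi> k C A) (\<lambda>U. open_INC (C - U) (U \<union> A) \<chi>).
       K (insert k U) * (\<Prod>V\<in>\<rho>. K V))"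
    unfolding open_sum_def sum_distrib_left
    using finU C finite_open_INC by (subst sum.Sigma) auto
  also have "\<dots> = open_sum \<chi> K (insert k C) A"
    unfolding open_sum_def
  proof (rule sum.reindex_bij_witness[where j = "\<lambda>(U, \<rho>). insert (insert k U) \<rho>"
        and i = "\<lambda>\<pi>. (blk \<pi> - {k}, \<pi> - {blk \<pi>})"], goal_cases)
    case (1 p)
    then obtain U \<rho> where p: "p = (U, \<rho>)" and U: "U \<in> closing_sets \<chi> k C A"
      and \<rho>: "\<rho> \<in> open_INC (C - U) (U \<union> A) \<chi>" by auto
    have 2: "insert k U \<notin> \<rho>" "partition_on (insert k C) (insert (insert k U) \<rho>)"
      using open_INC_close[OF dj k U \<rho>] open_INCD(2) by blast+
    have "blk (insert (insert k U) \<rho>) = insert k U" by (rule blk[OF 2(2)]) auto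
    moreover have "k \<notin> U" using kC U by (auto simp: closing_sets_def)
    ultimately show ?case using p 2(1) by simp
  next
    case (2 p)
    then show ?case using open_INC_close(1)[OF dj k] by auto
  next
    case (3 \<pi>)
    then have p: "partition_on (insert k C) \<pi>" using open_INCD(2) by blast
    then obtain V where V: "V \<in> \<pi>" "k \<in> V" by (auto simp: partition_on_def)
    then show ?case using blk[OF p V] by (auto simp: insert_absorb)
  next
    case (4 \<pi>)
    then have p: "partition_on (insert k C) \<pi>" using open_INCD(2) by blast
    then obtain V where V: "V \<in> \<pi>" "k \<in> V" by (auto simp: partition_on_def)
    then show ?case using blk[OF p V] open_INC_reopen[OF dj k 4 V] by simp
  next
    case (5 p)
    then obtain U \<rho> where p: "p = (U, \<rho>)" and U: "U \<in> closing_sets \<chi> k C A"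
      and \<rho>: "\<rho> \<in> open_INC (C - U) (U \<union> A) \<chi>" by auto
    have "finite \<rho>" using C open_INCD(2)[OF \<rho>] by (auto intro: finite_elements)
    then show ?case using p open_INC_close(2)[OF dj k U \<rho>] by simp
  qed
  finally show ?thesis ..
qed

section \<open>Fock space expansions\<close>

text \<open>The admissible lengths of the prefix of the word \<open>u\<close> of open letters that is closed by the letter \<open>a\<close>.\<close>

definition splits :: "('l \<Rightarrow> color) \<Rightarrow> 'l \<Rightarrow> 'l list \<Rightarrow> nat set" where
  "splits col a u = {j. j \<le> length u \<and>
     (j = length u \<or> (\<forall>b\<in>insert a (set (take j u)). col b = Bullet))}"

lemma finite_splits: "finite (splits col a u)"
  by (rule finite_subset[of _ "{..length u}"]) (auto simp: splits_def)

locale specified_rep = vector_space s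
  for s :: "complex \<Rightarrow> 'd::ab_group_add \<Rightarrow> 'd" +
  fixes D :: "'d set" and \<xi> :: 'd and \<phi> :: "'d \<Rightarrow> complex"
    and L :: "'l set" and T :: "'l \<Rightarrow> 'd \<Rightarrow> 'd" and col :: "'l \<Rightarrow> color"
  assumes subspace_D: "subspace D" and \<xi>_in: "\<xi> \<in> D"
    and \<phi>: "\<phi> \<in> lin_maps s (*) D UNIV" and \<phi>_\<xi>: "\<phi> \<xi> = 1"
    and T: "a \<in> L \<Longrightarrow> T a \<in> lin_ops s D"
begin

text \<open>The formula is \<open>T_fock\<close> below, solved for the vector of the longest word. The right-hand side
mentions the cumulants only through vectors of shorter words, so it is a recursion.\<close>

function fock :: "'l list \<Rightarrow> 'd" where
  "fock [] = \<xi>"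
| "fock (a # u) = T a (fock u)
     - (\<Sum>j\<in>splits col a u. s (\<phi> (T a (fock (take j u)))) (fock (drop j u)))"
  by pat_completeness auto
termination by (relation "measure length") auto

declare fock.simps(2) [simp del]

definition cum :: "'l list \<Rightarrow> complex" where
  "cum u = \<phi> (T (hd u) (fock (tl u)))"

lemma T_in: "a \<in> L \<Longrightarrow> x \<in> D \<Longrightarrow> T a x \<in> D"
  using T lin_mapsD(3) unfolding lin_ops_def by blast

lemma T_fock:
  "T a (fock u) = fock (a # u) + (\<Sum>j\<in>splits col a u. s (cum (a # take j u)) (fock (drop j u)))"
  by (simp add: fock.simps(2) cum_def)

lemma fock_in: "set u \<subseteq> L \<Longrightarrow> fock u \<in> D"
proof (induction u rule: length_induct)
  case (1 u)
  show ?case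
  proof (cases u)
    case Nil
    then show ?thesis by (simp add: \<xi>_in)
  next
    case (Cons a v)
    have "fock (take j v) \<in> D" "fock (drop j v) \<in> D" "fock v \<in> D" for j
      using 1 Cons set_take_subset[of j v] set_drop_subset[of j v] by auto
    then show ?thesis
      using 1 Cons by (auto simp: fock.simps(2) intro!: subspace_diff subspace_sum subspace_scale subspace_D T_in)
  qed
qed

lemma \<phi>_linear:
  "x \<in> D \<Longrightarrow> y \<in> D \<Longrightarrow> \<phi> (x + y) = \<phi> x + \<phi> y" "x \<in> D \<Longrightarrow> \<phi> (s c x) = c * \<phi> x"
  "(\<And>i. i \<in> A \<Longrightarrow> v i \<in> D) \<Longrightarrow> \<phi> (\<Sum>i\<in>A. v i) = (\<Sum>i\<in>A. \<phi> (v i))"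
proof -
  show "x \<in> D \<Longrightarrow> y \<in> D \<Longrightarrow> \<phi> (x + y) = \<phi> x + \<phi> y" "x \<in> D \<Longrightarrow> \<phi> (s c x) = c * \<phi> x"
    using lin_mapsD[OF \<phi>] by auto
  show "(\<And>i. i \<in> A \<Longrightarrow> v i \<in> D) \<Longrightarrow> \<phi> (\<Sum>i\<in>A. v i) = (\<Sum>i\<in>A. \<phi> (v i))"
    by (rule lin_maps_sum[OF vector_space_axioms vector_space_mult subspace_D \<phi>])
qed

text \<open>The functional kills all terms \<open>fock (drop j u)\<close> of \<open>T_fock\<close> except the one with \<open>j = length u\<close>,
whose coefficient is the value of the functional on the left-hand side.\<close>

lemma \<phi>_fock: "set u \<subseteq> L \<Longrightarrow> u \<noteq> [] \<Longrightarrow> \<phi> (fock u) = 0"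
proof (induction u rule: length_induct)
  case (1 u)
  then obtain a v where u: "u = a # v" by (cases u) auto
  have sub: "set (take j v) \<subseteq> L" "set (drop j v) \<subseteq> L" "set v \<subseteq> L" "a \<in> L" for j
    using 1 u set_take_subset[of j v] set_drop_subset[of j v] by auto
  have "\<phi> (T a (fock v)) = \<phi> (fock u)
      + (\<Sum>j\<in>splits col a v. cum (a # take j v) * \<phi> (fock (drop j v)))"
    using sub 1 u by (auto simp: T_fock fock_in \<phi>_linear subspace_scale subspace_sum subspace_D)
  also have "(\<Sum>j\<in>splits col a v. cum (a # take j v) * \<phi> (fock (drop j v)))
      = (\<Sum>j\<in>splits col a v. if j = length v then cum (a # v) else 0)"
    using 1 u sub by (intro sum.cong refl) (auto simp: splits_def \<phi>_\<xi>)
  also have "\<dots> = cum (a # v)"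
    using finite_splits by (simp add: splits_def)
  finally show ?case by (simp add: cum_def)
qed

text \<open>The induction adds positions on the left. The new operator sends the Fock vector of the open set \<open>A\<close>
to the one of \<open>insert k A\<close> and, for each admissible prefix \<open>U\<close> of \<open>A\<close>, to the one of \<open>B = A - U\<close>. The
coefficients of the latter are collected by \<open>open_sum_insert_closed\<close>.\<close>

lemma foldr_T_expansion:
  assumes "finite S" "z ` S \<subseteq> L" "\<And>k. k \<in> S \<Longrightarrow> col (z k) = \<chi> k"
  defines "word \<equiv> \<lambda>A. map z (sorted_list_of_set A)"
  shows "foldr T (word S) \<xi> =
    (\<Sum>A\<in>Pow S. s (open_sum \<chi> (\<lambda>V. cum (word V)) (S - A) A) (fock (word A)))"
  using assms(1-3)
proof (induction S rule: finite_linorder_min_induct)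
  case empty
  then show ?case
    by (simp add: word_def open_sum_def open_INC_empty INC_on_empty)
next
  case (insert k S)
  note k = insert.hyps(2)
  have kS: "k \<notin> S" using k by blast
  define c where "c B A = open_sum \<chi> (\<lambda>V. cum (word V)) B A" for B A
  have word_insert: "word (insert k A) = z k # word A" if "A \<subseteq> S" for A
  proof -
    have "sorted_list_of_set (insert k A) = k # sorted_list_of_set A"
      using that k insert.hyps(1) finite_subset[OF that]
      by (subst sorted_list_of_set_insert) (auto intro!: insort_is_Cons simp: less_imp_le subset_iff)
    then show ?thesis by (simp add: word_def)
  qed
  have zL: "z k \<in> L" and wL: "A \<subseteq> S \<Longrightarrow> set (word A) \<subseteq> L" for A
    using insert.prems finite_subset[OF _ insert.hyps(1), of A] by (auto simp: word_def)
  have cut: "set (take j (sorted_list_of_set A)) \<union> set (drop j (sorted_list_of_set A)) = A"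
      "j \<le> card A \<Longrightarrow> card (set (take j (sorted_list_of_set A))) = j"
      "u \<in> set (take j (sorted_list_of_set A)) \<Longrightarrow> a \<in> set (drop j (sorted_list_of_set A)) \<Longrightarrow> u < a"
      "sorted_list_of_set (set (take j (sorted_list_of_set A))) = take j (sorted_list_of_set A)"
      "sorted_list_of_set (set (drop j (sorted_list_of_set A))) = drop j (sorted_list_of_set A)"
    if A: "A \<subseteq> S" for A j u a
  proof -
    let ?l = "sorted_list_of_set A"
    have f: "finite A" using A insert.hyps(1) by (rule finite_subset)
    show "set (take j ?l) \<union> set (drop j ?l) = A"
      using f by (metis append_take_drop_id set_append set_sorted_list_of_set)
    show "j \<le> card A \<Longrightarrow> card (set (take j ?l)) = j" using f by (simp add: distinct_card)
    have s: "sorted_wrt (<) (take j ?l @ drop j ?l)" by simp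
    then show "u \<in> set (take j ?l) \<Longrightarrow> a \<in> set (drop j ?l) \<Longrightarrow> u < a"
      unfolding sorted_wrt_append by blast
    from s have "sorted_wrt (<) (take j ?l)" "sorted_wrt (<) (drop j ?l)"
      unfolding sorted_wrt_append by blast+
    then show "sorted_list_of_set (set (take j ?l)) = take j ?l" "sorted_list_of_set (set (drop j ?l)) = drop j ?l"
      by (auto intro!: strict_sorted_equal)
  qed
  have paste: "finite B \<and> finite U \<and> sorted_list_of_set (U \<union> B) = sorted_list_of_set U @ sorted_list_of_set B"
    if "B \<subseteq> S" "U \<in> closing_sets \<chi> k (S - B) B" for B U
  proof -
    have U: "U \<subseteq> S" "\<forall>u\<in>U. \<forall>b\<in>B. u < b" using that by (auto simp: closing_sets_def)
    then have f: "finite B" "finite U" using that(1) insert.hyps(1) finite_subset by blast+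
    have "sorted_list_of_set (U \<union> B) = sorted_list_of_set U @ sorted_list_of_set B"
      by (rule strict_sorted_equal) (use f U in \<open>auto simp: sorted_wrt_append\<close>)
    with f show ?thesis by simp
  qed
  have vs: "vector_space s" by (rule vector_space_axioms)
  have "foldr T (word (insert k S)) \<xi> = T (z k) (\<Sum>A\<in>Pow S. s (c (S - A) A) (fock (word A)))"
    using insert by (simp add: word_insert c_def)
  also have "\<dots> = (\<Sum>A\<in>Pow S. T (z k) (s (c (S - A) A) (fock (word A))))"
    by (rule lin_maps_sum[OF vs vs subspace_D T[OF zL, unfolded lin_ops_def]])
      (use wL fock_in subspace_scale subspace_D in auto)
  also have "\<dots> = (\<Sum>A\<in>Pow S. s (c (S - A) A) (T (z k) (fock (word A))))"
    using T[OF zL] wL fock_in by (intro sum.cong refl) (auto simp: lin_ops_def lin_mapsD(2))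
  also have "\<dots> = (\<Sum>A\<in>Pow S. s (c (S - A) A) (fock (z k # word A)))
      + (\<Sum>A\<in>Pow S. \<Sum>j\<in>splits col (z k) (word A).
          s (c (S - A) A * cum (z k # take j (word A))) (fock (drop j (word A))))"
    by (simp add: T_fock scale_right_distrib scale_sum_right sum.distrib)
  also have "(\<Sum>A\<in>Pow S. s (c (S - A) A) (fock (z k # word A)))
      = (\<Sum>A\<in>Pow S. s (c (insert k S - insert k A) (insert k A)) (fock (word (insert k A))))"
  proof (intro sum.cong refl)
    fix A assume "A \<in> Pow S"
    then have "insert k S - insert k A = S - A" "c (S - A) (insert k A) = c (S - A) A"
      using k kS by (auto simp: c_def intro!: open_sum_insert_open)
    then show "s (c (S - A) A) (fock (z k # word A)) =
        s (c (insert k S - insert k A) (insert k A)) (fock (word (insert k A)))"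
      using \<open>A \<in> Pow S\<close> by (simp add: word_insert)
  qed
  also have "\<dots> = (\<Sum>B\<in>insert k ` Pow S. s (c (insert k S - B) B) (fock (word B)))"
    using kS by (subst sum.reindex) (auto simp: inj_on_def o_def)
  also have "(\<Sum>A\<in>Pow S. \<Sum>j\<in>splits col (z k) (word A).
          s (c (S - A) A * cum (z k # take j (word A))) (fock (drop j (word A))))
      = (\<Sum>(A, j)\<in>Sigma (Pow S) (\<lambda>A. splits col (z k) (word A)).
          s (c (S - A) A * cum (z k # take j (word A))) (fock (drop j (word A))))"
    using insert.hyps(1) finite_splits by (subst sum.Sigma) auto
  \<comment> \<open>Regroup by the remaining open set \<open>B\<close>: a pair of an open set \<open>A\<close> and a prefix length is the same
    as the pair of the rest \<open>B\<close> and the closed part \<open>U\<close>.\<close>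
  also have "\<dots> = (\<Sum>(B, U)\<in>Sigma (Pow S) (\<lambda>B. closing_sets \<chi> k (S - B) B).
          s (cum (word (insert k U)) * c (S - B - U) (U \<union> B)) (fock (word B)))"
  proof (rule sum.reindex_bij_witness[where i = "\<lambda>(B, U). (U \<union> B, card U)"
        and j = "\<lambda>(A, j). (set (drop j (sorted_list_of_set A)), set (take j (sorted_list_of_set A)))"],
      goal_cases)
    case (1 p)
    then show ?case using cut(1,2) by (auto simp: splits_def word_def)
  next
    case (2 p)
    then obtain A j where p: "p = (A, j)" and A: "A \<subseteq> S" and j: "j \<in> splits col (z k) (word A)"
      by auto
    let ?u = "set (take j (sorted_list_of_set A))" and ?b = "set (drop j (sorted_list_of_set A))"
    have "?b = {} \<or> (\<forall>v\<in>insert k ?u. \<chi> v = Bullet)"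
    proof (cases "j = length (word A)")
      case False
      then have "\<forall>b\<in>insert (z k) (set (take j (word A))). col b = Bullet"
        using j by (auto simp: splits_def)
      then have "\<forall>v\<in>insert k ?u. col (z v) = Bullet" by (simp add: word_def take_map)
      moreover have "col (z v) = \<chi> v" if "v \<in> insert k ?u" for v
        using insert.prems(2) cut(1)[OF A, of j] A that by blast
      ultimately show ?thesis by simp
    qed (simp add: word_def)
    moreover have "?u \<inter> ?b = {}" using cut(3)[OF A, of _ j] by blast
    ultimately have "?u \<in> closing_sets \<chi> k (S - ?b) ?b"
      using cut(1)[OF A, of j] cut(3)[OF A] A by (auto simp: closing_sets_def)
    then show ?case using p cut(1)[OF A, of j] A by auto
  next
    case (3 p)
    then obtain B U where p: "p = (B, U)" and B: "B \<subseteq> S" "U \<in> closing_sets \<chi> k (S - B) B" by auto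
    show ?case using p paste[OF B] by simp
  next
    case (4 p)
    then obtain B U where p: "p = (B, U)" and B: "B \<subseteq> S" "U \<in> closing_sets \<chi> k (S - B) B" by auto
    have "card U \<in> splits col (z k) (word (U \<union> B))"
      using B paste[OF B] insert.prems(2) by (auto simp: closing_sets_def splits_def word_def)
    then show ?case using p B by (auto simp: closing_sets_def)
  next
    case (5 p)
    then obtain A j where p: "p = (A, j)" and A: "A \<subseteq> S" by auto
    let ?l = "sorted_list_of_set A"
    have un: "set (take j ?l) \<union> set (drop j ?l) = A" by (rule cut(1)[OF A])
    then have "S - set (drop j ?l) - set (take j ?l) = S - A" by blast
    moreover have "word (insert k (set (take j ?l))) = z k # take j (word A)"
      using word_insert[of "set (take j ?l)"] un A cut(4)[OF A] by (auto simp: word_def take_map)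
    moreover have "word (set (drop j ?l)) = drop j (word A)"
      using cut(5)[OF A] by (simp add: word_def drop_map)
    ultimately show ?case using p un by (simp add: mult.commute)
  qed
  also have "\<dots> = (\<Sum>B\<in>Pow S. \<Sum>U\<in>closing_sets \<chi> k (S - B) B.
          s (cum (word (insert k U)) * c (S - B - U) (U \<union> B)) (fock (word B)))"
  proof -
    have "finite (closing_sets \<chi> k (S - B) B)" for B
      by (rule finite_subset[of _ "Pow S"]) (use insert.hyps(1) in \<open>auto simp: closing_sets_def\<close>)
    then show ?thesis using insert.hyps(1) by (subst sum.Sigma) auto
  qed
  also have "\<dots> = (\<Sum>B\<in>Pow S. s (c (insert k S - B) B) (fock (word B)))"
  proof (intro sum.cong refl)
    fix B assume B: "B \<in> Pow S"
    then have "insert k S - B = insert k (S - B)" using kS by blast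
    moreover have "c (insert k (S - B)) B =
        (\<Sum>U\<in>closing_sets \<chi> k (S - B) B. cum (word (insert k U)) * c (S - B - U) (U \<union> B))"
      unfolding c_def by (rule open_sum_insert_closed) (use insert.hyps B in auto)
    ultimately show "(\<Sum>U\<in>closing_sets \<chi> k (S - B) B.
          s (cum (word (insert k U)) * c (S - B - U) (U \<union> B)) (fock (word B)))
        = s (c (insert k S - B) B) (fock (word B))"
      by (simp add: scale_sum_left)
  qed
  also have "(\<Sum>B\<in>insert k ` Pow S. s (c (insert k S - B) B) (fock (word B)))
      + (\<Sum>B\<in>Pow S. s (c (insert k S - B) B) (fock (word B)))
      = (\<Sum>B\<in>Pow (insert k S). s (c (insert k S - B) B) (fock (word B)))"
    unfolding Pow_insert using insert.hyps(1) kS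
    by (subst sum.union_disjoint) (auto simp: add.commute)
  finally show ?case by (simp add: c_def)
qed

text \<open>After all letters have been applied, only the term without open positions survives under the
functional.\<close>

lemma moment_eq_sum_INC:
  assumes "finite S" "z ` S \<subseteq> L" "\<And>k. k \<in> S \<Longrightarrow> col (z k) = \<chi> k"
  shows "\<phi> (foldr T (map z (sorted_list_of_set S)) \<xi>) =
    (\<Sum>\<pi>\<in>INC_on S \<chi>. \<Prod>V\<in>\<pi>. cum (map z (sorted_list_of_set V)))"
proof -
  let ?w = "\<lambda>A. map z (sorted_list_of_set A)"
  let ?c = "\<lambda>A. open_sum \<chi> (\<lambda>V. cum (?w V)) (S - A) A"
  have L: "set (?w A) \<subseteq> L" and fin: "finite A" if "A \<subseteq> S" for A
    using assms(2) that finite_subset[OF that assms(1)] by auto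
  have "\<phi> (foldr T (?w S) \<xi>) = (\<Sum>A\<in>Pow S. \<phi> (s (?c A) (fock (?w A))))"
    using foldr_T_expansion[OF assms] by simp (rule \<phi>_linear(3), use L fock_in in \<open>auto intro!: subspace_scale subspace_D\<close>)
  also have "\<dots> = (\<Sum>A\<in>Pow S. ?c A * \<phi> (fock (?w A)))"
    using L fock_in by (intro sum.cong refl \<phi>_linear(2)) auto
  also have "\<dots> = (\<Sum>A\<in>Pow S. if A = {} then ?c {} else 0)"
  proof (intro sum.cong refl)
    fix A assume "A \<in> Pow S"
    then show "?c A * \<phi> (fock (?w A)) = (if A = {} then ?c {} else 0)"
      using L[of A] fin[of A] by (auto simp: \<phi>_\<xi> \<phi>_fock)
  qed
  also have "\<dots> = ?c {}" using assms(1) by simp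
  finally show ?thesis by (simp add: open_sum_def open_INC_empty)
qed

end

section \<open>Linear maps as pullbacks of forms\<close>

text \<open>Spaces given by generators and relations consist of functionals on the forms \<open>f\<close> that respect the
relations. Every linear map between them used here is the transpose of a map \<open>F\<close> of forms. Transposes are
linear on the whole function space, so only their effect on generators has to be computed.\<close>

definition pullback :: "('h \<Rightarrow> complex) set \<Rightarrow> (('h \<Rightarrow> complex) \<Rightarrow> 'g \<Rightarrow> complex)
    \<Rightarrow> (('g \<Rightarrow> complex) \<Rightarrow> complex) \<Rightarrow> ('h \<Rightarrow> complex) \<Rightarrow> complex" where
  "pullback M F t = (\<lambda>f. if f \<in> M then t (F f) else 0)"

abbreviation fun_linear :: "(('x \<Rightarrow> complex) \<Rightarrow> 'y \<Rightarrow> complex) \<Rightarrow> bool" where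
  "fun_linear \<equiv> Vector_Spaces.linear (pscale (*)) (pscale (*))"

lemma linear_pullback: "fun_linear (pullback M F)"
  by (intro Vector_Spaces.linear.intro module_hom.intro module_hom_axioms.intro
      fun_space.vector_space_axioms fun_space.module_axioms)
    (auto simp: pullback_def pscale_def fun_eq_iff)

lemma pullback_add: "pullback M F (t + u) = pullback M F t + pullback M F u"
  and pullback_scale: "pullback M F (pscale (*) c t) = pscale (*) c (pullback M F t)"
  by (auto simp: pullback_def pscale_def fun_eq_iff)

lemma linear_in_cspan:
  assumes f: "fun_linear f"
    and S: "\<And>x. x \<in> S \<Longrightarrow> f x \<in> cspan E" and t: "t \<in> cspan S"
  shows "f t \<in> cspan E"
proof -
  interpret f: Vector_Spaces.linear "pscale (*)" "pscale (*)" f by fact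
  show ?thesis using t
  proof (induction rule: fun_space.span_induct_alt)
    case base
    show ?case unfolding f.zero by (rule fun_space.span_zero)
  next
    case (step c x y)
    then show ?case unfolding f.add f.scale by (intro fun_space.span_add fun_space.span_scale S[OF step(1)])
  qed
qed

lemma linear_eq_on_cspan:
  assumes f: "fun_linear f"
    and g: "fun_linear g"
    and S: "\<And>x. x \<in> S \<Longrightarrow> f x = g x" and t: "t \<in> cspan S"
  shows "f t = g t"
proof -
  interpret f: Vector_Spaces.linear "pscale (*)" "pscale (*)" f by fact
  interpret g: Vector_Spaces.linear "pscale (*)" "pscale (*)" g by fact
  show ?thesis using t
  proof (induction rule: fun_space.span_induct_alt)
    case base
    show ?case unfolding f.zero g.zero ..
  next
    case (step c x y)
    then show ?case unfolding f.add f.scale g.add g.scale by (simp only: S)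
  qed
qed

lemma linear_composition:
  assumes "fun_linear f" "fun_linear g"
  shows "fun_linear (\<lambda>x. g (f x))"
  using Vector_Spaces.linear_compose[OF assms] by (simp add: o_def)

lemma linear_identity: "fun_linear (\<lambda>x :: 'x \<Rightarrow> complex. x)"
  using fun_space.linear_id by (simp add: id_def)

lemma linear_restrict_lin_maps:
  assumes f: "fun_linear f"
    and S: "\<And>x. x \<in> cspan S \<Longrightarrow> f x \<in> E"
  shows "(\<lambda>t. if t \<in> cspan S then f t else 0) \<in> lin_maps (pscale (*)) (pscale (*)) (cspan S) E"
proof -
  interpret f: Vector_Spaces.linear "pscale (*)" "pscale (*)" f by fact
  show ?thesis
    using S by (auto simp: lin_maps_def f.add f.scale fun_space.span_add fun_space.span_scale)
qed

lemma lin_maps_zero_on_cspan: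
  assumes sE: "vector_space sE" and H: "H \<in> lin_maps (pscale (*)) sE (cspan S) E"
    and S': "S' \<subseteq> S" "\<And>x. x \<in> S' \<Longrightarrow> H x = 0" and t: "t \<in> cspan S'"
  shows "t \<in> cspan S \<and> H t = 0"
  using t
proof (induction rule: fun_space.span_induct_alt)
  case base
  interpret E: vector_space sE by fact
  show ?case
    using lin_mapsD(2)[OF H fun_space.span_zero, of 0] fun_space.span_zero[of S] by (metis E.scale_zero_left fun_space.scale_zero_left)
next
  case (step c x y)
  interpret E: vector_space sE by fact
  have x: "x \<in> cspan S" "H x = 0" using step(1) S' fun_space.span_base by blast+
  have cx: "pscale (*) c x \<in> cspan S" by (rule fun_space.span_scale[OF x(1)])
  have y: "y \<in> cspan S" "H y = 0" using step(2) by blast+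
  have "H (pscale (*) c x + y) = 0"
    unfolding lin_mapsD(1)[OF H cx y(1)] lin_mapsD(2)[OF H x(1)] x y by simp
  with fun_space.span_add[OF cx y(1)] show ?case by (rule conjI)
qed

lemma lin_extension_eqI:
  assumes "vector_space sE" "D = cspan (gen ` G)" "L \<in> lin_maps (pscale (*)) sE D UNIV"
    and "\<And>g. g \<in> G \<Longrightarrow> L (gen g) = F g"
  shows "lin_extension sE D gen G F = L"
  unfolding lin_extension_def
proof (rule the_equality)
  show "L \<in> lin_maps (pscale (*)) sE D UNIV \<and> (\<forall>g\<in>G. L (gen g) = F g)" using assms by blast
  fix K assume "K \<in> lin_maps (pscale (*)) sE D UNIV \<and> (\<forall>g\<in>G. K (gen g) = F g)"
  then show "K = L" using assms by (intro lin_maps_eqI[of sE K "gen ` G" UNIV L]) auto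
qed

lemma evaluation_apply: "f \<in> M \<Longrightarrow> evaluation M g f = f g"
  by (simp add: evaluation_def)

text \<open>Evaluations are linear in the form, as long as all forms involved respect the relations, and it suffices
to compare the forms on the generators.\<close>

lemma cspan_evaluation_combination:
  assumes t: "t \<in> cspan (evaluation M ` G)" and M: "f \<in> M" "g \<in> M" "h \<in> M"
    and h: "\<And>w. w \<in> G \<Longrightarrow> h w = a * f w + b * g w"
  shows "t h = a * t f + b * t g"
  using t
proof (induction rule: fun_space.span_induct_alt)
  case (step c x y)
  then obtain w where "x = evaluation M w" "w \<in> G" by blast
  then show ?case using step M h by (simp add: pscale_def evaluation_apply algebra_simps)
qed simp

section \<open>Specified functionals\<close>

lemma specified_functional_eqI:
  assumes s: "vector_space s" and X: "module.subspace s X" and \<xi>: "\<xi> \<in> X"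
    and f: "f \<in> lin_maps s (*) X UNIV" "f \<xi> = (1::complex)" "{x\<in>X. f x = 0} = X0"
  shows "specified_functional s X X0 \<xi> = f"
  unfolding specified_functional_def
proof (rule the_equality)
  interpret vector_space s by fact
  fix g assume "g \<in> lin_maps s (*) X UNIV \<and> g \<xi> = 1 \<and> {x\<in>X. g x = 0} = X0"
  then have g: "g \<in> lin_maps s (*) X UNIV" "g \<xi> = 1" "{x\<in>X. g x = 0} = X0" by auto
  show "g = f"
  proof
    fix x show "g x = f x"
    proof (cases "x \<in> X")
      case True
      let ?y = "x + s (- f x) \<xi>"
      have m: "s (- f x) \<xi> \<in> X" by (rule subspace_scale[OF X \<xi>])
      have y: "?y \<in> X" by (rule subspace_add[OF X True m])
      have "f ?y = 0"
        using lin_mapsD(1)[OF f(1) True m] lin_mapsD(2)[OF f(1) \<xi>, of "- f x"] f(2) by simp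
      then have "g ?y = 0" using y f(3) g(3) by blast
      then show ?thesis
        using lin_mapsD(1)[OF g(1) True m] lin_mapsD(2)[OF g(1) \<xi>, of "- f x"] g(2) by simp
    qed (use f g in \<open>auto simp: lin_maps_def\<close>)
  qed
qed (use f in auto)

text \<open>The value at \<open>x\<close> is the unique \<open>c\<close> with \<open>x - c \<cdot> \<xi>\<close> in the hyperplane.\<close>

lemma specified_functional:
  assumes s: "vector_space s" and sp: "specified_vector_space s X X0 \<xi>"
  defines "f \<equiv> specified_functional s X X0 \<xi>"
  shows "f \<in> lin_maps s (*) X UNIV" "f \<xi> = 1" "{x\<in>X. f x = 0} = X0"
proof -
  interpret vector_space s by fact
  obtain v where X: "subspace X" "subspace X0" "X0 \<subseteq> X" "\<xi> \<in> X" "\<xi> \<notin> X0" "v \<in> X"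
    "X = span (insert v X0)"
    using sp by (auto simp: specified_vector_space_def)
  have s0: "span X0 = X0" using X(2) by simp
  have X_eq: "x \<in> X \<longleftrightarrow> (\<exists>k. x - s k v \<in> X0)" for x
    unfolding X(7) span_insert s0 by simp
  obtain b where b: "\<xi> - s b v \<in> X0" using iffD1[OF X_eq X(4)] by (elim exE)
  have b0: "b \<noteq> 0" using b X(5) by auto
  have ex: "\<exists>c. x - s c \<xi> \<in> X0" if x: "x \<in> X" for x
  proof -
    obtain k where k: "x - s k v \<in> X0" using iffD1[OF X_eq x] by (elim exE)
    have "x - s (k / b) \<xi> = (x - s k v) - s (k / b) (\<xi> - s b v)"
      using b0 by (simp add: scale_right_diff_distrib)
    then show ?thesis using subspace_diff[OF X(2) k subspace_scale[OF X(2) b]] by metis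
  qed
  have uniq: "c = d" if "x - s c \<xi> \<in> X0" "x - s d \<xi> \<in> X0" for x c d
  proof (rule ccontr)
    assume "c \<noteq> d"
    have "s (c - d) \<xi> \<in> X0"
      using subspace_diff[OF X(2) that(2,1)] by (simp add: scale_left_diff_distrib)
    from subspace_scale[OF X(2) this, of "1 / (c - d)"] \<open>c \<noteq> d\<close> X(5) show False by simp
  qed
  define g where "g x = (if x \<in> X then THE c. x - s c \<xi> \<in> X0 else 0)" for x
  have g: "x - s (g x) \<xi> \<in> X0" if x: "x \<in> X" for x
  proof -
    have "\<exists>!c. x - s c \<xi> \<in> X0" using ex[OF x] uniq by blast
    from theI'[OF this] x show ?thesis by (simp add: g_def)
  qed
  have gI: "g x = c" if "x \<in> X" "x - s c \<xi> \<in> X0" for x c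
    using uniq[OF g[OF that(1)] that(2)] .
  have "g (x + y) = g x + g y" if "x \<in> X" "y \<in> X" for x y
  proof (rule gI)
    have "x + y - s (g x + g y) \<xi> = (x - s (g x) \<xi>) + (y - s (g y) \<xi>)"
      by (simp add: scale_left_distrib)
    then show "x + y - s (g x + g y) \<xi> \<in> X0"
      using subspace_add[OF X(2) g[OF that(1)] g[OF that(2)]] by (simp only:)
  qed (rule subspace_add[OF X(1) that])
  moreover have "g (s c x) = c * g x" if "x \<in> X" for c x
  proof (rule gI)
    have "s c x - s (c * g x) \<xi> = s c (x - s (g x) \<xi>)"
      by (simp add: scale_right_diff_distrib)
    then show "s c x - s (c * g x) \<xi> \<in> X0"
      using subspace_scale[OF X(2) g[OF that]] by (simp only:)
  qed (rule subspace_scale[OF X(1) that])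
  ultimately have 1: "g \<in> lin_maps s (*) X UNIV"
    by (auto simp: lin_maps_def g_def)
  have 2: "g \<xi> = 1" by (rule gI[OF X(4)]) (simp add: subspace_0[OF X(2)])
  have 3: "{x\<in>X. g x = 0} = X0"
  proof
    show "{x\<in>X. g x = 0} \<subseteq> X0"
    proof
      fix x assume "x \<in> {x\<in>X. g x = 0}"
      then show "x \<in> X0" using g[of x] by simp
    qed
    show "X0 \<subseteq> {x\<in>X. g x = 0}"
    proof
      fix x assume "x \<in> X0"
      then show "x \<in> {x\<in>X. g x = 0}" using gI[of x 0] X(3) by auto
    qed
  qed
  have "f = g" unfolding f_def by (rule specified_functional_eqI[OF s X(1,4) 1 2 3])
  with 1 2 3 show "f \<in> lin_maps s (*) X UNIV" "f \<xi> = 1" "{x\<in>X. f x = 0} = X0" by simp_all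
qed

section \<open>Reduced free products\<close>

context specified_family
begin

abbreviation forms :: "(('i \<times> 'v) list \<Rightarrow> complex) set" where
  "forms \<equiv> multilinear_forms scale words"

definition coef :: "'i \<Rightarrow> 'v \<Rightarrow> complex" where
  "coef i = specified_functional scale (X i) (X0 i) (\<xi> i)"

definition centred :: "'i \<Rightarrow> 'v \<Rightarrow> 'v" where
  "centred i x = x - scale (coef i x) (\<xi> i)"

lemma subspace_X: "i \<in> I \<Longrightarrow> subspace (X i)" and subspace_X0: "i \<in> I \<Longrightarrow> subspace (X0 i)"
  and X0_X: "i \<in> I \<Longrightarrow> x \<in> X0 i \<Longrightarrow> x \<in> X i" and \<xi>_X: "i \<in> I \<Longrightarrow> \<xi> i \<in> X i" 
  and \<xi>_X0: "i \<in> I \<Longrightarrow> \<xi> i \<notin> X0 i"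
  using specified[of i] unfolding specified_vector_space_def by blast+

lemma coef_lin: "i \<in> I \<Longrightarrow> coef i \<in> lin_maps scale (*) (X i) UNIV"
  and coef_\<xi>: "i \<in> I \<Longrightarrow> coef i (\<xi> i) = 1"
  and coef_zero: "i \<in> I \<Longrightarrow> {x\<in>X i. coef i x = 0} = X0 i"
  using specified_functional[OF vector_space_axioms specified] unfolding coef_def by auto

lemma coef_add: "i \<in> I \<Longrightarrow> x \<in> X i \<Longrightarrow> y \<in> X i \<Longrightarrow> coef i (x + y) = coef i x + coef i y"
  and coef_scale: "i \<in> I \<Longrightarrow> x \<in> X i \<Longrightarrow> coef i (scale c x) = c * coef i x"
  using lin_mapsD[OF coef_lin] by auto

lemma coef_X0: "i \<in> I \<Longrightarrow> x \<in> X0 i \<Longrightarrow> coef i x = 0"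
  using coef_zero by blast

lemma centred_\<xi>: "i \<in> I \<Longrightarrow> centred i (\<xi> i) = 0" and centred_X0: "i \<in> I \<Longrightarrow> x \<in> X0 i \<Longrightarrow> centred i x = x"
  by (simp_all add: centred_def coef_\<xi> coef_X0)

lemma centred_in:
  assumes "i \<in> I" "x \<in> X i"
  shows "centred i x \<in> X0 i"
proof -
  have m: "scale (- coef i x) (\<xi> i) \<in> X i"
    by (rule subspace_scale[OF subspace_X \<xi>_X]) (fact assms)+
  have e: "centred i x = x + scale (- coef i x) (\<xi> i)" by (simp add: centred_def)
  have "coef i (centred i x) = 0"
    unfolding e using coef_add[OF assms m] coef_scale[OF assms(1) \<xi>_X, of "- coef i x"] assms
    by (simp add: coef_\<xi>)
  moreover have "centred i x \<in> X i"
    unfolding e by (rule subspace_add[OF subspace_X _ m]) (fact assms)+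
  ultimately show ?thesis using coef_zero[OF assms(1)] by blast
qed

lemma centred_add: "i \<in> I \<Longrightarrow> x \<in> X i \<Longrightarrow> y \<in> X i \<Longrightarrow> centred i (x + y) = centred i x + centred i y"
  and centred_scale: "i \<in> I \<Longrightarrow> x \<in> X i \<Longrightarrow> centred i (scale c x) = scale c (centred i x)"
  by (simp_all add: centred_def coef_add coef_scale scale_left_distrib scale_right_diff_distrib)

lemma words_Nil: "[] \<in> words" by (simp add: words_def)

lemma words_letter: "p @ (j, x) # q \<in> words \<Longrightarrow> j \<in> I \<and> x \<in> X0 j"
  by (auto simp: words_def)

lemma words_replace: "p @ (j, x) # q \<in> words \<Longrightarrow> y \<in> X0 j \<Longrightarrow> p @ (j, y) # q \<in> words"
  by (auto simp: words_def)

lemma words_add: "p @ (j, x) # q \<in> words \<Longrightarrow> p @ (j, y) # q \<in> words \<Longrightarrow> p @ (j, x + y) # q \<in> words"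
  using words_letter subspace_X0 subspace_add words_replace by metis

lemma words_scale: "p @ (j, x) # q \<in> words \<Longrightarrow> p @ (j, scale c x) # q \<in> words"
  using words_letter subspace_X0 subspace_scale words_replace by metis

lemma words_combination: "p @ (j, x) # q \<in> words \<Longrightarrow> p @ (j, y) # q \<in> words \<Longrightarrow>
    p @ (j, scale a x + scale b y) # q \<in> words"
  by (rule words_add; rule words_scale)

text \<open>Treating additivity and homogeneity in one go halves the verifications below.\<close>

lemma formsI:
  assumes "\<And>p q j x y a b. p @ (j, x) # q \<in> words \<Longrightarrow> p @ (j, y) # q \<in> words \<Longrightarrow>
      p @ (j, scale a x + scale b y) # q \<in> words \<Longrightarrow>
      f (p @ (j, scale a x + scale b y) # q) = a * f (p @ (j, x) # q) + b * f (p @ (j, y) # q)"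
  shows "f \<in> forms"
proof -
  have "f (p @ (j, x + y) # q) = f (p @ (j, x) # q) + f (p @ (j, y) # q)"
    if "p @ (j, x) # q \<in> words" "p @ (j, y) # q \<in> words" for p q j x y
    using assms[OF that words_combination[OF that, of 1 1]] by simp
  moreover have "f (p @ (j, scale c x) # q) = c * f (p @ (j, x) # q)" if "p @ (j, x) # q \<in> words" for p q j x c
    using assms[OF that that words_combination[OF that that, of c 0]] by simp
  ultimately show ?thesis unfolding multilinear_forms_def by blast
qed

lemma forms_letter: "f \<in> forms \<Longrightarrow> p @ (j, x) # q \<in> words \<Longrightarrow> p @ (j, y) # q \<in> words \<Longrightarrow>
    f (p @ (j, scale a x + scale b y) # q) = a * f (p @ (j, x) # q) + b * f (p @ (j, y) # q)"
  using words_scale unfolding multilinear_forms_def by simp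

lemma forms_combination: "f \<in> forms \<Longrightarrow> g \<in> forms \<Longrightarrow> (\<lambda>w. a * f w + b * g w) \<in> forms"
  by (rule formsI) (simp add: forms_letter algebra_simps)

lemma word_tensor_letter: "p @ (j, x) # q \<in> words \<Longrightarrow> p @ (j, y) # q \<in> words \<Longrightarrow>
    word_tensor (p @ (j, scale a x + scale b y) # q) =
      pscale (*) a (word_tensor (p @ (j, x) # q)) + pscale (*) b (word_tensor (p @ (j, y) # q))"
  by (auto simp: word_tensor_def evaluation_def pscale_def fun_eq_iff forms_letter)

lemma word_tensor_apply: "f \<in> forms \<Longrightarrow> word_tensor w f = f w"
  by (simp add: word_tensor_def evaluation_def)

lemma word_tensor_FX: "w \<in> words \<Longrightarrow> word_tensor w \<in> FX"
  unfolding FX_def by (intro fun_space.span_base) auto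

lemma subspace_FX: "fun_space.subspace FX"
  by (simp add: FX_def)

end

text \<open>The isomorphisms \<open>V\<close> and \<open>W\<close> differ by the side on which a letter is attached to a word (\<open>put\<close>) and by
the order of the two factors of the tensor product (\<open>pair\<close>, with inverse \<open>unpair\<close>). Both are treated at
once; \<open>B\<close> is the set of bilinear forms and \<open>side\<close> the set of words to which a letter of index \<open>i\<close> can be
attached. The assumption \<open>letter_cases\<close> locates an arbitrary letter of a word: the word lies in \<open>side\<close>, or
the letter is the attached one, or it belongs to the word to which another letter was
attached. It reduces multilinearity to bilinearity.\<close>

locale free_product_side = specified_family scale I X X0 \<xi>
  for scale :: "complex \<Rightarrow> 'v::ab_group_add \<Rightarrow> 'v"
    and I :: "'i set" and X X0 :: "'i \<Rightarrow> 'v set" and \<xi> :: "'i \<Rightarrow> 'v" +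
  fixes i :: 'i and side :: "('i \<times> 'v) list set" and put :: "'i \<times> 'v \<Rightarrow> ('i \<times> 'v) list \<Rightarrow> ('i \<times> 'v) list"
    and B :: "('p \<Rightarrow> complex) set" and pair :: "'v \<Rightarrow> ((('i \<times> 'v) list \<Rightarrow> complex) \<Rightarrow> complex) \<Rightarrow> 'p"
    and unpair :: "'p \<Rightarrow> 'v \<times> ((('i \<times> 'v) list \<Rightarrow> complex) \<Rightarrow> complex)"
    and Y :: "((('i \<times> 'v) list \<Rightarrow> complex) \<Rightarrow> complex) set"
  assumes i: "i \<in> I" and unpair: "unpair (pair x t) = (x, t)"
    and Y: "Y = cspan (word_tensor ` side)"
    and B_iff: "b \<in> B \<longleftrightarrow>
     (\<forall>x\<in>X i. \<forall>x'\<in>X i. \<forall>t\<in>Y. b (pair (x + x') t) = b (pair x t) + b (pair x' t)) \<and>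
     (\<forall>x\<in>X i. \<forall>t\<in>Y. \<forall>t'\<in>Y. b (pair x (t + t')) = b (pair x t) + b (pair x t')) \<and>
     (\<forall>c. \<forall>x\<in>X i. \<forall>t\<in>Y. b (pair (scale c x) t) = c * b (pair x t) \<and>
        b (pair x (pscale (*) c t)) = c * b (pair x t))"
    and side_words: "side \<subseteq> words"
    and put_words: "w \<in> side \<Longrightarrow> x \<in> X0 i \<Longrightarrow> put (i, x) w \<in> words - side"
    and words_put: "w \<in> words - side \<Longrightarrow> \<exists>x\<in>X0 i. \<exists>v\<in>side. w = put (i, x) v"
    and put_inj: "put (i, x) v = put (i, y) w \<Longrightarrow> x = y \<and> v = w"
    and put_letter: "\<exists>p q. \<forall>z. put (i, z) w = p @ (i, z) # q"
    and put_around: "\<exists>p' q'. \<forall>z. put a (p @ (j, z) # q) = p' @ (j, z) # q'"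
    and letter_cases: "p @ (j, y) # q \<in> words \<Longrightarrow>
      (\<forall>z\<in>X0 j. p @ (j, z) # q \<in> side) \<or>
      (j = i \<and> (\<exists>w\<in>side. \<forall>z. p @ (j, z) # q = put (i, z) w)) \<or>
      (\<exists>x\<in>X0 i. \<exists>p' q'. \<forall>z\<in>X0 j. p @ (j, z) # q = put (i, x) (p' @ (j, z) # q') \<and>
         p' @ (j, z) # q' \<in> side)"
begin

text \<open>\<open>attach x t\<close> is the image of \<open>x \<otimes> t\<close> in the free product, namely \<open>coef i x\<close> times \<open>t\<close>
plus the tensor obtained by putting the centred part of \<open>x\<close> in front of (or behind) \<open>t\<close>.\<close>

definition attach_form where
  "attach_form x f w = coef i x * f w + (if w \<in> side then f (put (i, centred i x) w) else 0)"

definition attach where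
  "attach x = pullback forms (attach_form x)"

text \<open>\<open>merge\<close> is \<open>V\<close> or \<open>W\<close>, \<open>split\<close> its inverse, \<open>act T\<close> the operator \<open>T \<otimes> id\<close> or \<open>id \<otimes> T\<close>, and \<open>rep T\<close> the
resulting operator on the free product.\<close>

definition merge where
  "merge = pullback forms (\<lambda>f p. case unpair p of (x, t) \<Rightarrow> attach x t f)"

definition split_form where
  "split_form b w = (if w \<in> side then b (pair (\<xi> i) (word_tensor w))
     else case (SOME (x, v). x \<in> X0 i \<and> v \<in> side \<and> w = put (i, x) v) of
       (x, v) \<Rightarrow> b (pair x (word_tensor v)))"

definition split where
  "split = pullback B split_form"

definition act where
  "act T = pullback B (\<lambda>b p. case unpair p of (x, t) \<Rightarrow> b (pair (T x) t))"

definition tensors where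
  "tensors = cspan (evaluation B ` (case_prod pair ` (X i \<times> Y)))"

definition rep where
  "rep T t = (if t \<in> FX then merge (act T (split t)) else 0)"

lemma Y_FX: "t \<in> Y \<Longrightarrow> t \<in> FX"
  unfolding Y FX_def using fun_space.span_mono[OF image_mono[OF side_words]] by blast

lemma word_Y: "w \<in> side \<Longrightarrow> word_tensor w \<in> Y"
  unfolding Y by (intro fun_space.span_base) auto

lemma Y_add: "t \<in> Y \<Longrightarrow> t' \<in> Y \<Longrightarrow> t + t' \<in> Y" and Y_scale: "t \<in> Y \<Longrightarrow> pscale (*) c t \<in> Y"
  unfolding Y by (rule fun_space.span_add, assumption+) (rule fun_space.span_scale)

lemma put_linear: "f \<in> forms \<Longrightarrow> w \<in> side \<Longrightarrow> x \<in> X0 i \<Longrightarrow> y \<in> X0 i \<Longrightarrow>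
    f (put (i, scale a x + scale b y) w) = a * f (put (i, x) w) + b * f (put (i, y) w)"
proof -
  obtain p q where "\<And>z. put (i, z) w = p @ (i, z) # q" using put_letter[of w] by blast
  then show "f \<in> forms \<Longrightarrow> w \<in> side \<Longrightarrow> x \<in> X0 i \<Longrightarrow> y \<in> X0 i \<Longrightarrow> ?thesis"
    using put_words[of w] forms_letter[of f p i _ q] by simp
qed

lemma put_add: "f \<in> forms \<Longrightarrow> w \<in> side \<Longrightarrow> x \<in> X0 i \<Longrightarrow> y \<in> X0 i \<Longrightarrow>
    f (put (i, x + y) w) = f (put (i, x) w) + f (put (i, y) w)"
  and put_scale: "f \<in> forms \<Longrightarrow> w \<in> side \<Longrightarrow> x \<in> X0 i \<Longrightarrow> f (put (i, scale c x) w) = c * f (put (i, x) w)"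
  using put_linear[of f w x y 1 1] put_linear[of f w x x c 0] by simp_all

text \<open>Attaching a letter and detaching the attached letter have transposes that preserve multilinearity; this
is what the next two lemmas verify, and it makes the pullbacks below well behaved on word tensors.\<close>

lemma put_forms:
  assumes f: "f \<in> forms" and x: "x \<in> X0 i"
  shows "(\<lambda>w. if w \<in> side then f (put (i, x) w) else 0) \<in> forms"
proof (rule formsI, goal_cases)
  case (1 p q j y z a b)
  have m: "y \<in> X0 j" "z \<in> X0 j" "scale a y + scale b z \<in> X0 j" using words_letter 1 by blast+
  from letter_cases[OF 1(1)] show ?case
  proof (elim disjE)
    assume s: "\<forall>z\<in>X0 j. p @ (j, z) # q \<in> side"
    obtain p' q' where e: "\<And>z. put (i, x) (p @ (j, z) # q) = p' @ (j, z) # q'"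
      using put_around[of "(i, x)" p j q] by blast
    have "p' @ (j, y) # q' \<in> words" "p' @ (j, z) # q' \<in> words"
      using put_words[OF _ x] s m e by (metis DiffD1)+
    from forms_letter[OF f this] show ?thesis using s m e by simp
  next
    assume "j = i \<and> (\<exists>w\<in>side. \<forall>z. p @ (j, z) # q = put (i, z) w)"
    then have "\<forall>z\<in>X0 j. p @ (j, z) # q \<notin> side" using put_words by auto
    with m show ?thesis by simp
  next
    assume "\<exists>x\<in>X0 i. \<exists>p' q'. \<forall>z\<in>X0 j. p @ (j, z) # q = put (i, x) (p' @ (j, z) # q') \<and>
         p' @ (j, z) # q' \<in> side"
    then have "\<forall>z\<in>X0 j. p @ (j, z) # q \<notin> side" using put_words by (metis DiffE)
    with m show ?thesis by simp
  qed
qed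

lemma split_forms:
  assumes b: "b \<in> B" and g1: "\<And>w. w \<in> side \<Longrightarrow> g w = b (pair (\<xi> i) (word_tensor w))"
    and g2: "\<And>x w. x \<in> X0 i \<Longrightarrow> w \<in> side \<Longrightarrow> g (put (i, x) w) = b (pair x (word_tensor w))"
  shows "g \<in> forms"
proof (rule formsI, goal_cases)
  case (1 p q j y z c d)
  have m: "y \<in> X0 j" "z \<in> X0 j" "scale c y + scale d z \<in> X0 j" using words_letter 1 by blast+
  have b_left: "b (pair (scale c x + scale d x') t) = c * b (pair x t) + d * b (pair x' t)"
    if "x \<in> X i" "x' \<in> X i" "t \<in> Y" for x x' t
    using b that subspace_scale[OF subspace_X[OF i]] unfolding B_iff by simp
  have b_right: "b (pair x (pscale (*) c t + pscale (*) d t')) = c * b (pair x t) + d * b (pair x t')"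
    if "x \<in> X i" "t \<in> Y" "t' \<in> Y" for x t t'
    using b that Y_scale unfolding B_iff by simp
  from letter_cases[OF 1(1)] show ?case
  proof (elim disjE)
    assume "\<forall>z\<in>X0 j. p @ (j, z) # q \<in> side"
    then show ?thesis
      using m 1 b_right[OF \<xi>_X[OF i]] by (simp add: g1 word_Y word_tensor_letter)
  next
    assume "j = i \<and> (\<exists>w\<in>side. \<forall>z. p @ (j, z) # q = put (i, z) w)"
    then obtain w where w: "j = i" "w \<in> side" "\<And>z. p @ (j, z) # q = put (i, z) w" by blast
    then show ?thesis using m b_left word_Y by (simp add: g2 X0_X i)
  next
    assume "\<exists>x\<in>X0 i. \<exists>p' q'. \<forall>z\<in>X0 j. p @ (j, z) # q = put (i, x) (p' @ (j, z) # q') \<and>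
         p' @ (j, z) # q' \<in> side"
    then obtain x p' q' where w: "x \<in> X0 i" "\<And>z. z \<in> X0 j \<Longrightarrow> p @ (j, z) # q = put (i, x) (p' @ (j, z) # q')"
      "\<And>z. z \<in> X0 j \<Longrightarrow> p' @ (j, z) # q' \<in> side" by blast
    have "p' @ (j, y) # q' \<in> words" "p' @ (j, z) # q' \<in> words" using w(3) m side_words by blast+
    then show ?thesis
      using m w b_right[OF X0_X[OF i w(1)]] by (simp add: g2 word_Y word_tensor_letter)
  qed
qed

lemma attach_form_forms:
  assumes "f \<in> forms" "x \<in> X i" shows "attach_form x f \<in> forms"
  unfolding attach_form_def[abs_def]
  using forms_combination[OF assms(1) put_forms[OF assms(1) centred_in[OF i assms(2)]], of "coef i x" 1]
  by simp

lemma attach_word: "x \<in> X i \<Longrightarrow> w \<in> side \<Longrightarrow>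
    attach x (word_tensor w) = pscale (*) (coef i x) (word_tensor w) + word_tensor (put (i, centred i x) w)"
  using attach_form_forms[of _ x]
  by (auto simp: fun_eq_iff attach_def pullback_def pscale_def word_tensor_def evaluation_def attach_form_def)

lemma attach_add_left:
  assumes "x \<in> X i" "x' \<in> X i" "t \<in> Y"
  shows "attach (x + x') t = attach x t + attach x' t"
proof
  fix f
  have xx: "x + x' \<in> X i" using assms subspace_add[OF subspace_X[OF i]] by blast
  have "t (attach_form (x + x') f) = 1 * t (attach_form x f) + 1 * t (attach_form x' f)" if "f \<in> forms"
    by (rule cspan_evaluation_combination[OF assms(3)[unfolded Y word_tensor_def]])
      (use assms that i xx in \<open>auto intro!: attach_form_forms
        simp: attach_form_def coef_add centred_add put_add centred_in algebra_simps\<close>)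
  then show "attach (x + x') t f = (attach x t + attach x' t) f"
    by (simp add: attach_def pullback_def)
qed

lemma attach_scale_left:
  assumes "x \<in> X i" "t \<in> Y"
  shows "attach (scale c x) t = pscale (*) c (attach x t)"
proof
  fix f
  have xx: "scale c x \<in> X i" using assms subspace_scale[OF subspace_X[OF i]] by blast
  have "t (attach_form (scale c x) f) = c * t (attach_form x f) + 0 * t (attach_form x f)" if "f \<in> forms"
    by (rule cspan_evaluation_combination[OF assms(2)[unfolded Y word_tensor_def]])
      (use assms that i xx in \<open>auto intro!: attach_form_forms
        simp: attach_form_def coef_scale centred_scale put_scale centred_in algebra_simps\<close>)
  then show "attach (scale c x) t f = pscale (*) c (attach x t) f"
    by (simp add: attach_def pullback_def pscale_def)
qed

lemma attach_add_right: "attach x (t + t') = attach x t + attach x t'"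
  and attach_scale_right: "attach x (pscale (*) c t) = pscale (*) c (attach x t)"
  by (simp_all add: attach_def pullback_add pullback_scale)

lemma attach_in_cspan:
  assumes "x \<in> X i" "t \<in> cspan (word_tensor ` G)" "G \<subseteq> side"
    and "\<And>w. w \<in> G \<Longrightarrow> pscale (*) (coef i x) (word_tensor w) + word_tensor (put (i, centred i x) w) \<in> cspan E"
  shows "attach x t \<in> cspan E"
  unfolding attach_def
proof (rule linear_in_cspan[OF linear_pullback _ assms(2)], fold attach_def)
  fix u assume "u \<in> word_tensor ` G"
  then obtain w where w: "w \<in> G" "u = word_tensor w" by blast
  then show "attach x u \<in> cspan E" using assms(3) assms(4)[OF w(1)] attach_word[OF assms(1), of w] by auto
qed

lemma attach_FX:
  assumes x: "x \<in> X i" and t: "t \<in> Y" shows "attach x t \<in> FX"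
  unfolding FX_def
proof (rule attach_in_cspan[OF x t[unfolded Y] subset_refl])
  fix w assume w: "w \<in> side"
  show "pscale (*) (coef i x) (word_tensor w) + word_tensor (put (i, centred i x) w)
      \<in> cspan (word_tensor ` words)"
    using side_words w put_words[OF w centred_in[OF i x]]
    by (intro fun_space.span_add fun_space.span_scale fun_space.span_base) auto
qed

lemma attach_\<xi>_word: "w \<in> side \<Longrightarrow> attach (\<xi> i) (word_tensor w) = word_tensor w"
proof -
  assume w: "w \<in> side"
  have "word_tensor (put (i, 0) w) = 0"
    using put_scale[OF _ w, of _ 0 0] subspace_0[OF subspace_X0[OF i]]
    by (auto simp: word_tensor_def evaluation_def fun_eq_iff)
  then show ?thesis using attach_word[OF \<xi>_X[OF i] w] i by (simp add: centred_\<xi> coef_\<xi>)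
qed

lemma attach_X0_word: "x \<in> X0 i \<Longrightarrow> w \<in> side \<Longrightarrow> attach x (word_tensor w) = word_tensor (put (i, x) w)"
  using attach_word[OF X0_X[OF i]] i by (simp add: centred_X0 coef_X0)

lemma merge_form_B:
  assumes "f \<in> forms"
  shows "(\<lambda>p. case unpair p of (x, t) \<Rightarrow> attach x t f) \<in> B"
  unfolding B_iff unpair
  by (auto simp: attach_add_left attach_scale_left attach_add_right attach_scale_right pscale_def[of _ _ "attach _ _"])

lemma merge_eval: "merge (evaluation B (pair x t)) = attach x t"
  using merge_form_B
  by (auto simp: merge_def pullback_def evaluation_def unpair attach_def fun_eq_iff)

lemma split_form_put: "x \<in> X0 i \<Longrightarrow> w \<in> side \<Longrightarrow> split_form b (put (i, x) w) = b (pair x (word_tensor w))"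
proof -
  assume a: "x \<in> X0 i" "w \<in> side"
  have "(SOME (y, v). y \<in> X0 i \<and> v \<in> side \<and> put (i, x) w = put (i, y) v) = (x, w)"
    using a put_inj by (intro some_equality) auto
  then show ?thesis using put_words[OF a(2,1)] by (simp add: split_form_def)
qed

lemma split_form_forms: "b \<in> B \<Longrightarrow> split_form b \<in> forms"
  by (rule split_forms) (auto simp: split_form_put, simp add: split_form_def)

lemma split_side: "w \<in> side \<Longrightarrow> split (word_tensor w) = evaluation B (pair (\<xi> i) (word_tensor w))"
  using split_form_forms
  by (auto simp: split_def pullback_def word_tensor_apply fun_eq_iff evaluation_def split_form_def)

lemma split_put: "x \<in> X0 i \<Longrightarrow> w \<in> side \<Longrightarrow>
    split (word_tensor (put (i, x) w)) = evaluation B (pair x (word_tensor w))"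
  using split_form_forms
  by (auto simp: split_def pullback_def word_tensor_apply fun_eq_iff evaluation_def split_form_put)

lemma linear_merge: "fun_linear merge"
  and linear_split: "fun_linear split"
  and linear_act: "fun_linear (act T)"
  by (simp_all add: merge_def split_def act_def linear_pullback)

lemma eval_add_right: "x \<in> X i \<Longrightarrow> t \<in> Y \<Longrightarrow> t' \<in> Y \<Longrightarrow>
    evaluation B (pair x (t + t')) = evaluation B (pair x t) + evaluation B (pair x t')"
  and eval_scale_right: "x \<in> X i \<Longrightarrow> t \<in> Y \<Longrightarrow>
    evaluation B (pair x (pscale (*) c t)) = pscale (*) c (evaluation B (pair x t))"
  and eval_add_left: "x \<in> X i \<Longrightarrow> x' \<in> X i \<Longrightarrow> t \<in> Y \<Longrightarrow>
    evaluation B (pair (x + x') t) = evaluation B (pair x t) + evaluation B (pair x' t)"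
  and eval_scale_left: "x \<in> X i \<Longrightarrow> t \<in> Y \<Longrightarrow>
    evaluation B (pair (scale c x) t) = pscale (*) c (evaluation B (pair x t))"
  using B_iff by (auto simp: evaluation_def fun_eq_iff pscale_def)

text \<open>The tensors on which \<open>V\<close> and \<open>W\<close> are prescribed span the tensor product, because every \<open>x\<close> is a multiple of \<open>\<xi> i\<close>
plus its centred part. This makes the maps defined by \<open>lin_extension\<close> unique.\<close>

lemma tensors_generators:
  "tensors = cspan ((\<lambda>(x, w). evaluation B (pair x (word_tensor w))) ` (insert (\<xi> i) (X0 i) \<times> side))"
  (is "_ = cspan ?G")
proof
  have word: "evaluation B (pair x (word_tensor w)) \<in> cspan ?G" if x: "x \<in> X i" and w: "w \<in> side" for x w
  proof -
    have c: "centred i x \<in> X0 i" using centred_in[OF i x] .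
    have "x = scale (coef i x) (\<xi> i) + centred i x" by (simp add: centred_def)
    moreover have "scale (coef i x) (\<xi> i) \<in> X i" using subspace_scale[OF subspace_X \<xi>_X] i by blast
    ultimately have "evaluation B (pair x (word_tensor w)) =
        pscale (*) (coef i x) (evaluation B (pair (\<xi> i) (word_tensor w)))
        + evaluation B (pair (centred i x) (word_tensor w))"
      using eval_add_left[of "scale (coef i x) (\<xi> i)" "centred i x"] eval_scale_left[OF \<xi>_X[OF i]]
        X0_X[OF i c] word_Y[OF w] by metis
    also have "\<dots> \<in> cspan ?G"
      using c w by (intro fun_space.span_add fun_space.span_scale fun_space.span_base) force+
    finally show ?thesis .
  qed
  have "evaluation B (pair x t) \<in> cspan ?G" if x: "x \<in> X i" and t: "t \<in> Y" for x t
  proof -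
    have "t \<in> Y \<and> evaluation B (pair x t) \<in> cspan ?G"
      using t unfolding Y
    proof (induction rule: fun_space.span_induct_alt)
      case base
      have z: "0 \<in> Y" unfolding Y by (rule fun_space.span_zero)
      have e: "evaluation B (pair x 0) = 0" using eval_scale_right[OF x z, of 0] by simp
      show ?case unfolding e by (intro conjI fun_space.span_zero)
    next
      case (step c t u)
      then obtain w where w: "w \<in> side" "t = word_tensor w" by blast
      have u: "u \<in> Y" using step unfolding Y by blast
      have t: "t \<in> Y" "pscale (*) c t \<in> Y" using w word_Y Y_scale by auto
      have "evaluation B (pair x (pscale (*) c t + u)) \<in> cspan ?G"
        using eval_add_right[OF x t(2) u] eval_scale_right[OF x t(1)] word[OF x w(1)] w step
        by (simp add: fun_space.span_add fun_space.span_scale)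
      with Y_add[OF t(2) u] show ?case unfolding Y by blast
    qed
    then show ?thesis by blast
  qed
  then show "tensors \<subseteq> cspan ?G"
    unfolding tensors_def by (intro fun_space.span_minimal) auto
  show "cspan ?G \<subseteq> tensors"
    unfolding tensors_def using \<xi>_X[OF i] X0_X[OF i] word_Y by (intro fun_space.span_mono) force
qed

lemma eval_tensors: "x \<in> X i \<Longrightarrow> t \<in> Y \<Longrightarrow> evaluation B (pair x t) \<in> tensors"
  unfolding tensors_def by (intro fun_space.span_base) force

lemma merge_FX: "\<tau> \<in> tensors \<Longrightarrow> merge \<tau> \<in> FX"
  unfolding tensors_def FX_def by (rule linear_in_cspan[OF linear_merge])
    (use attach_FX in \<open>auto simp: merge_eval FX_def\<close>)

lemma split_tensors: "t \<in> FX \<Longrightarrow> split t \<in> tensors"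
  unfolding FX_def tensors_def
proof (rule linear_in_cspan[OF linear_split], fold tensors_def)
  fix x assume "x \<in> word_tensor ` words"
  then obtain w where w: "w \<in> words" "x = word_tensor w" by blast
  show "split x \<in> tensors"
  proof (cases "w \<in> side")
    case True
    then show ?thesis using w by (simp add: split_side eval_tensors \<xi>_X i word_Y)
  next
    case False
    then obtain y v where "y \<in> X0 i" "v \<in> side" "w = put (i, y) v" using words_put w by blast
    then show ?thesis using w by (simp add: split_put eval_tensors X0_X i word_Y)
  qed
qed

lemma split_merge: "\<tau> \<in> tensors \<Longrightarrow> split (merge \<tau>) = \<tau>"
  unfolding tensors_generators
  by (rule linear_eq_on_cspan[OF linear_composition[OF linear_merge linear_split] linear_identity])
    (auto simp: merge_eval attach_\<xi>_word attach_X0_word split_side split_put)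

lemma merge_split: "t \<in> FX \<Longrightarrow> merge (split t) = t"
  unfolding FX_def
proof (rule linear_eq_on_cspan[OF linear_composition[OF linear_split linear_merge] linear_identity])
  fix x assume "x \<in> word_tensor ` words"
  then obtain w where w: "w \<in> words" "x = word_tensor w" by blast
  show "merge (split x) = x"
  proof (cases "w \<in> side")
    case True
    then show ?thesis using w by (simp add: split_side merge_eval attach_\<xi>_word)
  next
    case False
    then obtain y v where "y \<in> X0 i" "v \<in> side" "w = put (i, y) v" using words_put w by blast
    then show ?thesis using w by (simp add: split_put merge_eval attach_X0_word)
  qed
qed

lemma inv_into_merge:
  assumes "t \<in> FX"
  shows "inv_into tensors (\<lambda>\<tau>. if \<tau> \<in> tensors then merge \<tau> else 0) t = split t"
proof -
  have "inj_on (\<lambda>\<tau>. if \<tau> \<in> tensors then merge \<tau> else 0) tensors"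
    by (rule inj_onI) (metis split_merge)
  from inv_into_f_f[OF this split_tensors[OF assms]] show ?thesis
    using merge_split split_tensors assms by simp
qed

lemma act_form_B:
  assumes T: "T \<in> lin_ops scale (X i)" and b: "b \<in> B"
  shows "(\<lambda>p. case unpair p of (x, t) \<Rightarrow> b (pair (T x) t)) \<in> B"
  using b lin_opsD[OF T] unfolding B_iff unpair by simp

lemma act_eval: "T \<in> lin_ops scale (X i) \<Longrightarrow>
    act T (evaluation B (pair x t)) = evaluation B (pair (T x) t)"
  using act_form_B by (auto simp: act_def pullback_def evaluation_def unpair fun_eq_iff)

lemma act_tensors:
  assumes T: "T \<in> lin_ops scale (X i)" and \<tau>: "\<tau> \<in> tensors"
  shows "act T \<tau> \<in> tensors"
  unfolding tensors_def
proof (rule linear_in_cspan[OF linear_act _ \<tau>[unfolded tensors_def]], fold tensors_def)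
  fix u assume "u \<in> evaluation B ` (case_prod pair ` (X i \<times> Y))"
  then obtain x t where "x \<in> X i" "t \<in> Y" "u = evaluation B (pair x t)" by auto
  then show "act T u \<in> tensors"
    using lin_opsD(3)[OF T] by (simp add: act_eval[OF T] eval_tensors)
qed

lemma lin_extension_merge:
  "lin_extension (pscale (*)) tensors (\<lambda>(x, w). evaluation B (pair x (word_tensor w)))
     (insert (\<xi> i) (X0 i) \<times> side)
     (\<lambda>(x, w). if x = \<xi> i then word_tensor w else word_tensor (put (i, x) w))
   = (\<lambda>\<tau>. if \<tau> \<in> tensors then merge \<tau> else 0)"
proof (rule lin_extension_eqI[OF fun_space.vector_space_axioms tensors_generators])
  show "(\<lambda>\<tau>. if \<tau> \<in> tensors then merge \<tau> else 0) \<in> lin_maps (pscale (*)) (pscale (*)) tensors UNIV"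
    unfolding tensors_def by (rule linear_restrict_lin_maps[OF linear_merge]) simp
  fix g assume "g \<in> insert (\<xi> i) (X0 i) \<times> side"
  then obtain x w where g: "g = (x, w)" "x = \<xi> i \<or> x \<in> X0 i" "w \<in> side" by auto
  have "evaluation B (pair x (word_tensor w)) \<in> tensors"
    using g \<xi>_X X0_X i word_Y by (intro eval_tensors) auto
  then show "(if (case g of (x, w) \<Rightarrow> evaluation B (pair x (word_tensor w))) \<in> tensors
      then merge (case g of (x, w) \<Rightarrow> evaluation B (pair x (word_tensor w))) else 0) =
      (case g of (x, w) \<Rightarrow> if x = \<xi> i then word_tensor w else word_tensor (put (i, x) w))"
    using g \<xi>_X0[OF i] by (auto simp: merge_eval attach_\<xi>_word attach_X0_word)
qed

lemma lin_extension_act: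
  assumes T: "T \<in> lin_ops scale (X i)"
  shows "lin_extension (pscale (*)) tensors (evaluation B) (case_prod pair ` (X i \<times> Y))
      (\<lambda>p. case unpair p of (x, t) \<Rightarrow> evaluation B (pair (T x) t))
    = (\<lambda>\<tau>. if \<tau> \<in> tensors then act T \<tau> else 0)"
proof (rule lin_extension_eqI[OF fun_space.vector_space_axioms tensors_def])
  show "(\<lambda>\<tau>. if \<tau> \<in> tensors then act T \<tau> else 0) \<in> lin_maps (pscale (*)) (pscale (*)) tensors UNIV"
    unfolding tensors_def by (rule linear_restrict_lin_maps[OF linear_act]) simp
qed (auto simp: unpair act_eval[OF T] eval_tensors)

lemma rep_eq:
  assumes T: "T \<in> lin_ops scale (X i)"
  defines "Vr \<equiv> (\<lambda>\<tau>. if \<tau> \<in> tensors then merge \<tau> else 0)"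
  shows "(\<lambda>t. if t \<in> FX then Vr ((\<lambda>\<tau>. if \<tau> \<in> tensors then act T \<tau> else 0) (inv_into tensors Vr t)) else 0) = rep T"
  using inv_into_merge act_tensors[OF T] split_tensors unfolding Vr_def rep_def by auto

lemma rep_lin_ops:
  assumes T: "T \<in> lin_ops scale (X i)"
  shows "rep T \<in> lin_ops (pscale (*)) FX"
  unfolding lin_ops_def rep_def[abs_def] FX_def
  by (rule linear_restrict_lin_maps[OF linear_composition[OF linear_split linear_composition[OF linear_act linear_merge]]])
    (fold FX_def, intro merge_FX act_tensors[OF T] split_tensors)

text \<open>The only property of the representation needed later: \<open>T\<close> acts on the attached factor.\<close>

lemma rep_attach:
  assumes "T \<in> lin_ops scale (X i)" "x \<in> X i" "t \<in> Y"
  shows "rep T (attach x t) = attach (T x) t"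
proof -
  have "split (attach x t) = evaluation B (pair x t)"
    using split_merge[OF eval_tensors[OF assms(2,3)]] by (simp add: merge_eval)
  then show ?thesis using attach_FX[OF assms(2,3)]
    by (simp add: rep_def act_eval[OF assms(1)] merge_eval)
qed

end

section \<open>Left representations and Boolean compressions\<close>

context specified_family
begin

lemma left_side:
  assumes i: "i \<in> I"
  shows "free_product_side scale I X X0 \<xi> i (words_left i) (#)
    (bilinear_forms scale (X i) (pscale (*)) (FX_left i)) Pair id (FX_left i)"
proof (unfold_locales, goal_cases)
  case (4 b)
  show ?case by (auto simp: bilinear_forms_def)
next
  case (6 w x)
  then show ?case using i by (auto simp: words_left_def words_def distinct_adj_Cons hd_map)
next
  case (7 w)
  then obtain y v where w: "w = (i, y) # v" by (cases w) (auto simp: words_left_def)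
  with 7 show ?case by (auto simp: words_left_def words_def distinct_adj_Cons hd_map)
next
  case (9 w)
  show ?case by (rule exI[of _ "[]"]) auto
next
  case (10 a p j q)
  show ?case by (rule exI[of _ "a # p"]) auto
next
  case (11 p j y q)
  show ?case
  proof (cases p)
    case Nil
    then show ?thesis using 11
      by (auto simp: words_left_def words_def distinct_adj_Cons hd_map)
  next
    case (Cons a p')
    show ?thesis
    proof (cases "fst a = i")
      case True
      have "snd a \<in> X0 i \<and> (\<forall>z\<in>X0 j. p @ (j, z) # q = (i, snd a) # (p' @ (j, z) # q) \<and>
          p' @ (j, z) # q \<in> words_left i)"
        using Cons True 11 by (cases p') (auto simp: words_left_def words_def distinct_adj_Cons hd_map)
      then show ?thesis by blast
    next
      case False
      then show ?thesis using Cons words_replace[OF 11] by (auto simp: words_left_def)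
    qed
  qed
qed (use i in \<open>auto simp: FX_left_def words_left_def\<close>)

lemma right_side:
  assumes i: "i \<in> I"
  shows "free_product_side scale I X X0 \<xi> i (words_right i) (\<lambda>a w. w @ [a])
    (bilinear_forms (pscale (*)) (FX_right i) scale (X i)) (\<lambda>x t. (t, x)) prod.swap (FX_right i)"
proof (unfold_locales, goal_cases)
  case (4 b)
  show ?case by (auto simp: bilinear_forms_def)
next
  case (6 w x)
  then show ?case using i by (auto simp: words_right_def words_def distinct_adj_append_iff last_map)
next
  case (7 w)
  then obtain y v where w: "w = v @ [(i, y)]" by (cases w rule: rev_cases) (auto simp: words_right_def)
  with 7 show ?case by (auto simp: words_right_def words_def distinct_adj_append_iff last_map)
next
  case (9 w)
  show ?case by (rule exI[of _ w]) auto
next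
  case (10 a p j q)
  show ?case by (rule exI[of _ p]) auto
next
  case (11 p j y q)
  show ?case
  proof (cases q rule: rev_cases)
    case Nil
    then show ?thesis using 11
      by (auto simp: words_right_def words_def distinct_adj_append_iff last_map)
  next
    case (snoc q' a)
    show ?thesis
    proof (cases "fst a = i")
      case True
      have "snd a \<in> X0 i \<and> v \<in> words_right i" if "v @ [a] \<in> words" for v
        using that True by (auto simp: words_right_def words_def distinct_adj_append_iff last_map)
      from this[of "p @ (j, y) # q'"] have "snd a \<in> X0 i" "p @ (j, y) # q' \<in> words_right i"
        using 11 snoc by simp_all
      then have "p @ (j, z) # q' \<in> words_right i" if "z \<in> X0 j" for z
        using words_replace[of p j y q' z] that by (auto simp: words_right_def last_append)
      with \<open>snd a \<in> X0 i\<close> have "snd a \<in> X0 i \<and> (\<forall>z\<in>X0 j. p @ (j, z) # q = (p @ (j, z) # q') @ [(i, snd a)] \<and>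
          p @ (j, z) # q' \<in> words_right i)"
        using snoc True by auto
      then show ?thesis by blast
    next
      case False
      then show ?thesis using snoc words_replace[OF 11] by (auto simp: words_right_def)
    qed
  qed
qed (use i in \<open>auto simp: FX_right_def words_right_def\<close>)

text \<open>The extension of \<open>x \<otimes> t\<close> to all \<open>x\<close> in \<open>X i\<close>: in particular \<open>\<xi> i\<close> disappears in front of \<open>t\<close>.\<close>

definition on_left where
  "on_left i = free_product_side.attach scale I X X0 \<xi> i (words_left i) (#)"

lemma left_rep_eq:
  assumes i: "i \<in> I" and T: "T \<in> lin_ops scale (X i)"
  shows "left_rep i T = free_product_side.rep scale I X X0 \<xi> i (words_left i) (#)
    (bilinear_forms scale (X i) (pscale (*)) (FX_left i)) Pair id T"
proof -
  interpret S: free_product_side scale I X X0 \<xi> i "words_left i" "(#)"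
    "bilinear_forms scale (X i) (pscale (*)) (FX_left i)" Pair id "FX_left i"
    by (rule left_side[OF i])
  have tensors: "S.tensors = tensor_space scale (X i) (pscale (*)) (FX_left i)"
    by (simp add: S.tensors_def tensor_space_def tensor_def)
  have "V i = (\<lambda>\<tau>. if \<tau> \<in> S.tensors then S.merge \<tau> else 0)"
    unfolding S.lin_extension_merge[symmetric] unfolding V_def tensors tensor_def ..
  moreover have "tensor_op scale (X i) (pscale (*)) (FX_left i) T id = (\<lambda>\<tau>. if \<tau> \<in> S.tensors then S.act T \<tau> else 0)"
    unfolding S.lin_extension_act[OF T, symmetric] unfolding tensor_op_def tensors tensor_def
    by (simp add: case_prod_unfold)
  ultimately show ?thesis
    unfolding S.rep_eq[OF T, symmetric] left_rep_def tensors by (simp only:)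
qed

lemma right_rep_eq:
  assumes i: "i \<in> I" and T: "T \<in> lin_ops scale (X i)"
  shows "right_rep i T = free_product_side.rep scale I X X0 \<xi> i (words_right i) (\<lambda>a w. w @ [a])
    (bilinear_forms (pscale (*)) (FX_right i) scale (X i)) (\<lambda>x t. (t, x)) prod.swap T"
proof -
  interpret S: free_product_side scale I X X0 \<xi> i "words_right i" "\<lambda>a w. w @ [a]"
    "bilinear_forms (pscale (*)) (FX_right i) scale (X i)" "\<lambda>x t. (t, x)" prod.swap "FX_right i"
    by (rule right_side[OF i])
  have sw: "(\<lambda>(x, t). (t, x)) ` (A \<times> B) = B \<times> A" for A :: "'x set" and B :: "'y set" by auto
  have tensors: "S.tensors = tensor_space (pscale (*)) (FX_right i) scale (X i)"
    by (simp add: S.tensors_def tensor_space_def tensor_def sw)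
  have "W i = (\<lambda>\<tau>. if \<tau> \<in> S.tensors then S.merge \<tau> else 0)"
    unfolding W_def
  proof (rule lin_extension_eqI[OF fun_space.vector_space_axioms])
    show "tensor_space (pscale (*)) (FX_right i) scale (X i) =
      cspan ((\<lambda>(w, x). tensor (pscale (*)) (FX_right i) scale (X i) (word_tensor w, x)) `
        (words_right i \<times> insert (\<xi> i) (X0 i)))"
      unfolding tensors[symmetric] S.tensors_generators tensor_def sw[of "insert (\<xi> i) (X0 i)" "words_right i", symmetric]
        image_image by (simp add: case_prod_unfold)
    show "(\<lambda>\<tau>. if \<tau> \<in> S.tensors then S.merge \<tau> else 0)
      \<in> lin_maps (pscale (*)) (pscale (*)) (tensor_space (pscale (*)) (FX_right i) scale (X i)) UNIV"
      unfolding tensors[symmetric] unfolding S.tensors_def by (rule linear_restrict_lin_maps[OF S.linear_merge]) simp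
    fix g assume "g \<in> words_right i \<times> insert (\<xi> i) (X0 i)"
    then obtain x w where g: "g = (w, x)" "x = \<xi> i \<or> x \<in> X0 i" "w \<in> words_right i" by auto
    have "evaluation (bilinear_forms (pscale (*)) (FX_right i) scale (X i)) (word_tensor w, x) \<in> S.tensors"
      using g \<xi>_X X0_X i S.word_Y by (intro S.eval_tensors) auto
    then show "(if (case g of (w, x) \<Rightarrow> tensor (pscale (*)) (FX_right i) scale (X i) (word_tensor w, x)) \<in> S.tensors
      then S.merge (case g of (w, x) \<Rightarrow> tensor (pscale (*)) (FX_right i) scale (X i) (word_tensor w, x)) else 0) =
      (case g of (w, x) \<Rightarrow> if x = \<xi> i then word_tensor w else word_tensor (w @ [(i, x)]))"
      using g \<xi>_X0[OF i] by (auto simp: tensor_def S.merge_eval S.attach_\<xi>_word S.attach_X0_word)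
  qed
  moreover have "tensor_op (pscale (*)) (FX_right i) scale (X i) id T = (\<lambda>\<tau>. if \<tau> \<in> S.tensors then S.act T \<tau> else 0)"
    unfolding S.lin_extension_act[OF T, symmetric] unfolding tensor_op_def tensors tensor_def sw
    by (simp add: case_prod_unfold)
  ultimately show ?thesis
    unfolding S.rep_eq[OF T, symmetric] right_rep_def tensors by (simp only:)
qed


lemma on_left_properties:
  assumes i: "i \<in> I"
  shows on_left_FX: "x \<in> X i \<Longrightarrow> t \<in> FX_left i \<Longrightarrow> on_left i x t \<in> FX"
    and on_left_add: "x \<in> X i \<Longrightarrow> y \<in> X i \<Longrightarrow> t \<in> FX_left i \<Longrightarrow>
      on_left i (x + y) t = on_left i x t + on_left i y t"
    and on_left_scale: "x \<in> X i \<Longrightarrow> t \<in> FX_left i \<Longrightarrow>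
      on_left i (scale c x) t = pscale (*) c (on_left i x t)"
    and on_left_\<xi>: "t \<in> FX_left i \<Longrightarrow> on_left i (\<xi> i) t = t"
    and on_left_word: "x \<in> X0 i \<Longrightarrow> w \<in> words_left i \<Longrightarrow>
      on_left i x (word_tensor w) = word_tensor ((i, x) # w)"
    and on_left_word_X: "x \<in> X i \<Longrightarrow> w \<in> words_left i \<Longrightarrow>
      on_left i x (word_tensor w) = pscale (*) (coef i x) (word_tensor w) + word_tensor ((i, centred i x) # w)"
    and linear_on_left: "fun_linear (on_left i x)"
    and word_cases_left: "w \<in> words \<Longrightarrow> w \<notin> words_left i \<Longrightarrow> \<exists>x\<in>X0 i. \<exists>v\<in>words_left i. w = (i, x) # v"
    and left_rep_on_left: "T \<in> lin_ops scale (X i) \<Longrightarrow> x \<in> X i \<Longrightarrow> t \<in> FX_left i \<Longrightarrow>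
      left_rep i T (on_left i x t) = on_left i (T x) t"
    and left_rep_lin_ops: "T \<in> lin_ops scale (X i) \<Longrightarrow> left_rep i T \<in> lin_ops (pscale (*)) FX"
proof -
  interpret S: free_product_side scale I X X0 \<xi> i "words_left i" "(#)"
    "bilinear_forms scale (X i) (pscale (*)) (FX_left i)" Pair id "FX_left i"
    by (rule left_side[OF i])
  show "x \<in> X i \<Longrightarrow> t \<in> FX_left i \<Longrightarrow> on_left i x t \<in> FX"
    unfolding on_left_def by (rule S.attach_FX)
  show "x \<in> X i \<Longrightarrow> y \<in> X i \<Longrightarrow> t \<in> FX_left i \<Longrightarrow>
      on_left i (x + y) t = on_left i x t + on_left i y t"
    unfolding on_left_def by (rule S.attach_add_left)
  show "x \<in> X i \<Longrightarrow> t \<in> FX_left i \<Longrightarrow> on_left i (scale c x) t = pscale (*) c (on_left i x t)"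
    unfolding on_left_def by (rule S.attach_scale_left)
  show lin: "fun_linear (on_left i x)" for x
    unfolding on_left_def S.attach_def by (rule linear_pullback)
  show "t \<in> FX_left i \<Longrightarrow> on_left i (\<xi> i) t = t"
    unfolding FX_left_def
    by (rule linear_eq_on_cspan[OF lin linear_identity]) (auto simp: on_left_def S.attach_\<xi>_word)
  show "x \<in> X0 i \<Longrightarrow> w \<in> words_left i \<Longrightarrow> on_left i x (word_tensor w) = word_tensor ((i, x) # w)"
    unfolding on_left_def by (rule S.attach_X0_word)
  show "x \<in> X i \<Longrightarrow> w \<in> words_left i \<Longrightarrow>
      on_left i x (word_tensor w) = pscale (*) (coef i x) (word_tensor w) + word_tensor ((i, centred i x) # w)"
    unfolding on_left_def by (rule S.attach_word)
  show "w \<in> words \<Longrightarrow> w \<notin> words_left i \<Longrightarrow> \<exists>x\<in>X0 i. \<exists>v\<in>words_left i. w = (i, x) # v"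
    using S.words_put by blast
  show "T \<in> lin_ops scale (X i) \<Longrightarrow> x \<in> X i \<Longrightarrow> t \<in> FX_left i \<Longrightarrow>
      left_rep i T (on_left i x t) = on_left i (T x) t"
    unfolding on_left_def left_rep_eq[OF i] by (rule S.rep_attach)
  show "T \<in> lin_ops scale (X i) \<Longrightarrow> left_rep i T \<in> lin_ops (pscale (*)) FX"
    unfolding left_rep_eq[OF i] by (rule S.rep_lin_ops)
qed

lemma vacuum_FX_left: "vacuum \<in> FX_left i"
  unfolding FX_left_def vacuum_def
  by (intro fun_space.span_base) (auto simp: words_left_def words_Nil)

text \<open>The canonical embedding of \<open>X i\<close> into the free product, with image spanned by the \<open>small_words\<close> below.\<close>

definition embed where "embed i x = on_left i x vacuum"

lemma embed_eq: "i \<in> I \<Longrightarrow> x \<in> X i \<Longrightarrow>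
    embed i x = pscale (*) (coef i x) vacuum + word_tensor [(i, centred i x)]"
  unfolding embed_def vacuum_def by (rule on_left_word_X) (auto simp: words_left_def words_Nil)

definition small_words where
  "small_words i = {w\<in>words. w = [] \<or> (\<exists>x. w = [(i, x)])}"

lemma zero_FX: "0 \<in> FX" unfolding FX_def by (rule fun_space.span_zero)

lemma lin_ops_zero: "H \<in> lin_ops (pscale (*)) FX \<Longrightarrow> H 0 = 0"
  using lin_mapsD(2)[OF _ zero_FX, of H "pscale (*)" "pscale (*)" FX 0] by (simp add: lin_ops_def)

lemma P_uplus_lin_ops: "P_uplus i \<in> lin_ops (pscale (*)) FX"
  and P_uplus_small: "w \<in> small_words i \<Longrightarrow> P_uplus i (word_tensor w) = word_tensor w"
  and P_uplus_large: "w \<in> words - small_words i \<Longrightarrow> P_uplus i (word_tensor w) = 0"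
proof -
  define F where "F f w = (if w = [] \<or> (\<exists>x. w = [(i, x)]) then f w else 0 :: complex)"
    for f and w :: "('i \<times> 'v) list"
  have small: "w = [] \<or> (\<exists>x. w = [(i, x)]) \<longleftrightarrow> length w \<le> 1 \<and> fst ` set w \<subseteq> {i}" for w :: "('i \<times> 'v) list"
    by (cases w; cases "tl w") auto
  have F_eq: "F f w = (if length w \<le> 1 \<and> fst ` set w \<subseteq> {i} then f w else 0)" for f w
    unfolding F_def small ..
  have F: "F f \<in> forms" if "f \<in> forms" for f
  proof (rule formsI, goal_cases)
    case (1 p q j x y a b)
    show ?case using forms_letter[OF that 1(1,2), of a b] by (auto simp: F_eq)
  qed
  have val: "pullback forms F (word_tensor w) = (if w = [] \<or> (\<exists>x. w = [(i, x)]) then word_tensor w else 0)" for w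
    using F by (auto simp: fun_eq_iff pullback_def word_tensor_def evaluation_def F_def)
  have in_FX: "pullback forms F t \<in> FX" if "t \<in> FX" for t
    unfolding FX_def
  proof (rule linear_in_cspan[OF linear_pullback _ that[unfolded FX_def]], fold FX_def)
    fix u assume "u \<in> word_tensor ` words"
    then show "pullback forms F u \<in> FX" using word_tensor_FX zero_FX by (auto simp: val)
  qed
  let ?P = "\<lambda>t. if t \<in> FX then pullback forms F t else 0"
  have lm: "?P \<in> lin_maps (pscale (*)) (pscale (*)) FX FX"
    unfolding FX_def by (rule linear_restrict_lin_maps[OF linear_pullback]) (fold FX_def, rule in_FX)
  have eq: "P_uplus i = ?P"
    unfolding P_uplus_def
  proof (rule lin_extension_eqI[OF fun_space.vector_space_axioms FX_def])
    show "?P \<in> lin_maps (pscale (*)) (pscale (*)) FX UNIV" using lm by (auto simp: lin_maps_def)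
  qed (simp add: val word_tensor_FX)
  show "P_uplus i \<in> lin_ops (pscale (*)) FX" unfolding eq lin_ops_def by (rule lm)
  show "w \<in> small_words i \<Longrightarrow> P_uplus i (word_tensor w) = word_tensor w"
    "w \<in> words - small_words i \<Longrightarrow> P_uplus i (word_tensor w) = 0"
    unfolding eq by (auto simp: val word_tensor_FX small_words_def)
qed

definition boolean_rep where
  "boolean_rep i T = P_uplus i \<circ> right_rep i T \<circ> P_uplus i"

lemma right_rep_lin_ops: "i \<in> I \<Longrightarrow> T \<in> lin_ops scale (X i) \<Longrightarrow> right_rep i T \<in> lin_ops (pscale (*)) FX"
  and right_rep_embed: "i \<in> I \<Longrightarrow> T \<in> lin_ops scale (X i) \<Longrightarrow> x \<in> X i \<Longrightarrow> right_rep i T (embed i x) = embed i (T x)"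
proof -
  assume i: "i \<in> I" and T: "T \<in> lin_ops scale (X i)"
  interpret S: free_product_side scale I X X0 \<xi> i "words_right i" "\<lambda>a w. w @ [a]"
    "bilinear_forms (pscale (*)) (FX_right i) scale (X i)" "\<lambda>x t. (t, x)" prod.swap "FX_right i"
    by (rule right_side[OF i])
  show "right_rep i T \<in> lin_ops (pscale (*)) FX"
    unfolding right_rep_eq[OF i T] by (rule S.rep_lin_ops[OF T])
  have nil: "[] \<in> words_right i" by (simp add: words_right_def words_Nil)
  have vec: "S.attach x vacuum = embed i x" if "x \<in> X i" for x
    using S.attach_word[OF that nil] embed_eq[OF i that] by (simp add: vacuum_def)
  assume x: "x \<in> X i"
  have "T x \<in> X i" using lin_opsD(3)[OF T x] .
  moreover have "right_rep i T (S.attach x vacuum) = S.attach (T x) vacuum"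
    unfolding right_rep_eq[OF i T] vacuum_def by (rule S.rep_attach[OF T x S.word_Y[OF nil]])
  ultimately show "right_rep i T (embed i x) = embed i (T x)" using vec x by simp
qed

lemma P_uplus_embed:
  assumes "i \<in> I" "x \<in> X i" shows "P_uplus i (embed i x) = embed i x"
proof -
  have c: "centred i x \<in> X0 i" by (rule centred_in[OF assms])
  have w: "[(i, centred i x)] \<in> small_words i" "[] \<in> small_words i"
    using c assms by (auto simp: small_words_def words_def)
  then have m: "word_tensor [(i, centred i x)] \<in> FX" "vacuum \<in> FX"
    by (auto simp: small_words_def vacuum_def intro: word_tensor_FX)
  have "pscale (*) (coef i x) vacuum \<in> FX" using m fun_space.span_scale unfolding FX_def by blast
  then show ?thesis
    unfolding embed_eq[OF assms]
    using lin_opsD(1,2)[OF P_uplus_lin_ops] m P_uplus_small[OF w(1)] P_uplus_small[OF w(2)]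
    by (simp add: vacuum_def)
qed

lemma boolean_rep_lin_ops: "i \<in> I \<Longrightarrow> T \<in> lin_ops scale (X i) \<Longrightarrow> boolean_rep i T \<in> lin_ops (pscale (*)) FX"
  unfolding boolean_rep_def by (intro lin_ops_comp P_uplus_lin_ops right_rep_lin_ops zero_FX)

text \<open>On \<open>X i\<close> the compressed right representation acts like \<open>T\<close>, so there it agrees with the left
representation; by \<open>boolean_rep_large\<close> it vanishes on all words outside \<open>small_words i\<close>.\<close>

lemma boolean_rep_embed:
  assumes "i \<in> I" "T \<in> lin_ops scale (X i)" "x \<in> X i"
  shows "boolean_rep i T (embed i x) = embed i (T x)"
  using assms lin_opsD(3)[OF assms(2)]
  by (simp add: boolean_rep_def P_uplus_embed right_rep_embed)

lemma boolean_rep_large: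
  assumes "i \<in> I" "T \<in> lin_ops scale (X i)" "t \<in> cspan (word_tensor ` (words - small_words i))"
  shows "boolean_rep i T t = 0"
proof -
  have "t \<in> FX \<and> P_uplus i t = 0"
    unfolding FX_def
    by (rule lin_maps_zero_on_cspan[OF fun_space.vector_space_axioms P_uplus_lin_ops[unfolded lin_ops_def FX_def] _ _ assms(3)])
      (auto simp: P_uplus_large)
  then show ?thesis
    using lin_ops_zero[OF right_rep_lin_ops[OF assms(1,2)]] lin_ops_zero[OF P_uplus_lin_ops]
    by (simp add: boolean_rep_def)
qed

definition vacuum_state where
  "vacuum_state t = (if t \<in> FX then t (\<lambda>w. if w = [] then 1 else 0) else 0)"

lemma vacuum_form: "(\<lambda>w. if w = [] then 1 else 0) \<in> forms"
  by (rule formsI) auto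

lemma vacuum_state_word: "w \<in> words \<Longrightarrow> vacuum_state (word_tensor w) = (if w = [] then 1 else 0)"
  by (simp add: vacuum_state_def word_tensor_FX word_tensor_apply[OF vacuum_form])

lemma vacuum_state_lin: "vacuum_state \<in> lin_maps (pscale (*)) (*) FX UNIV"
proof -
  have "pscale (*) c x f = c * x f" for c f and x :: "(('i \<times> 'v) list \<Rightarrow> complex) \<Rightarrow> complex"
    by (simp add: pscale_def)
  then show ?thesis
    unfolding lin_maps_def FX_def vacuum_state_def[abs_def]
    by (simp add: fun_space.span_add fun_space.span_scale)
qed

text \<open>The vacuum functional evaluates a functional on forms at one particular form.\<close>

lemma vacuum_functional_eq: "vacuum_functional T = vacuum_state (T vacuum)"
proof -
  have "specified_functional (pscale (*)) FX FX0 vacuum = vacuum_state"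
  proof (rule specified_functional_eqI[OF fun_space.vector_space_axioms subspace_FX _ vacuum_state_lin])
    show "vacuum \<in> FX" unfolding vacuum_def by (rule word_tensor_FX[OF words_Nil])
    show "vacuum_state vacuum = 1" unfolding vacuum_def by (simp add: vacuum_state_word words_Nil)
    have ins: "word_tensor ` words = insert vacuum (word_tensor ` (words - {[]}))"
      unfolding vacuum_def using words_Nil by auto
    show "{t\<in>FX. vacuum_state t = 0} = FX0"
    proof
      have "u \<in> FX \<and> vacuum_state u = 0" if "u \<in> FX0" for u
        unfolding FX_def
        by (rule lin_maps_zero_on_cspan[OF vector_space_mult vacuum_state_lin[unfolded FX_def] _ _ that[unfolded FX0_def]])
          (auto simp: vacuum_state_word split: if_splits)
      note FX0 = this
      then show "FX0 \<subseteq> {t\<in>FX. vacuum_state t = 0}" by blast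
      show "{t\<in>FX. vacuum_state t = 0} \<subseteq> FX0"
      proof
        fix t assume "t \<in> {t\<in>FX. vacuum_state t = 0}"
        then have t: "t \<in> FX" "vacuum_state t = 0" by auto
        then obtain k where k: "t - pscale (*) k vacuum \<in> FX0"
          unfolding FX_def FX0_def ins fun_space.span_insert by blast
        have v: "vacuum \<in> FX" "vacuum_state vacuum = 1"
          unfolding vacuum_def by (auto simp: vacuum_state_word words_Nil word_tensor_FX)
        have "pscale (*) k vacuum \<in> FX" using v fun_space.span_scale unfolding FX_def by blast
        then have "vacuum_state t = vacuum_state (t - pscale (*) k vacuum) + k * vacuum_state vacuum"
          using FX0[OF k] lin_mapsD(1)[OF vacuum_state_lin, of "t - pscale (*) k vacuum" "pscale (*) k vacuum"]
            lin_mapsD(2)[OF vacuum_state_lin v(1), of k] by simp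
        then have "k = 0" using FX0[OF k] t v by simp
        then show "t \<in> FX0" using k by simp
      qed
    qed
  qed
  then show ?thesis by (simp add: vacuum_functional_def)
qed

lemma FX_eqI:
  assumes "S \<in> lin_ops (pscale (*)) FX" "T \<in> lin_ops (pscale (*)) FX"
    and "\<And>w. w \<in> words \<Longrightarrow> S (word_tensor w) = T (word_tensor w)"
  shows "S = T"
  using assms unfolding lin_ops_def FX_def by (intro lin_maps_eqI[OF fun_space.vector_space_axioms]) auto

lemma word_on_left:
  assumes "i \<in> I" "w \<in> words"
  obtains x t where "x \<in> X i" "t \<in> FX_left i" "word_tensor w = on_left i x t"
proof (cases "w \<in> words_left i")
  case True
  then have "word_tensor w \<in> FX_left i" unfolding FX_left_def by (intro fun_space.span_base) auto
  then show ?thesis using that \<xi>_X[OF assms(1)] on_left_\<xi>[OF assms(1)] by metis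
next
  case False
  then obtain x v where v: "x \<in> X0 i" "v \<in> words_left i" "w = (i, x) # v"
    using word_cases_left[OF assms] by blast
  then have "word_tensor v \<in> FX_left i" unfolding FX_left_def by (intro fun_space.span_base) auto
  then show ?thesis using that v X0_X[OF assms(1)] on_left_word[OF assms(1)] by metis
qed

lemma small_word_embed:
  assumes "i \<in> I" "w \<in> small_words i"
  obtains x where "x \<in> X i" "word_tensor w = embed i x"
proof (cases "w = []")
  case True
  then have "word_tensor w = embed i (\<xi> i)"
    using on_left_\<xi>[OF assms(1) vacuum_FX_left] by (simp add: embed_def vacuum_def)
  then show ?thesis using that \<xi>_X[OF assms(1)] by blast
next
  case False
  then obtain x where w: "w = [(i, x)]" "x \<in> X0 i" using assms by (auto simp: small_words_def words_def)
  then have "word_tensor w = embed i x"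
    using on_left_word[OF assms(1) w(2), of "[]"] by (simp add: embed_def vacuum_def words_left_def words_Nil)
  then show ?thesis using that X0_X[OF assms(1)] w by blast
qed

lemma embed_add: "i \<in> I \<Longrightarrow> x \<in> X i \<Longrightarrow> y \<in> X i \<Longrightarrow> embed i (x + y) = embed i x + embed i y"
  and embed_scale: "i \<in> I \<Longrightarrow> x \<in> X i \<Longrightarrow> embed i (scale c x) = pscale (*) c (embed i x)"
  by (simp_all add: embed_def on_left_add on_left_scale vacuum_FX_left)

definition color_rep where
  "color_rep i c T = (case c of Bullet \<Rightarrow> left_rep i T | Circle \<Rightarrow> boolean_rep i T)"

lemma color_rep_lin_ops: "i \<in> I \<Longrightarrow> T \<in> lin_ops scale (X i) \<Longrightarrow> color_rep i c T \<in> lin_ops (pscale (*)) FX"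
  by (cases c) (simp_all add: color_rep_def left_rep_lin_ops boolean_rep_lin_ops)

lemma color_rep_embed: "i \<in> I \<Longrightarrow> T \<in> lin_ops scale (X i) \<Longrightarrow> x \<in> X i \<Longrightarrow>
    color_rep i c T (embed i x) = embed i (T x)"
  by (cases c) (simp_all add: color_rep_def boolean_rep_embed, simp add: embed_def left_rep_on_left vacuum_FX_left)

text \<open>On a given word, operators of either kind act through a linear map \<open>F\<close> out of \<open>X i\<close> that intertwines
them with the original operators: \<open>on_left\<close>, the embedding, or \<open>0\<close>. This gives the homomorphism
properties of both kinds at once.\<close>

lemma color_rep_word:
  assumes i: "i \<in> I" and w: "w \<in> words"
  obtains F x where "x \<in> X i"
    and "\<And>T. T \<in> lin_ops scale (X i) \<Longrightarrow> color_rep i c T (word_tensor w) = F (T x)"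
    and "\<And>T y. T \<in> lin_ops scale (X i) \<Longrightarrow> y \<in> X i \<Longrightarrow> color_rep i c T (F y) = F (T y)"
    and "\<And>y z. y \<in> X i \<Longrightarrow> z \<in> X i \<Longrightarrow> F (y + z) = F y + F z"
    and "\<And>a y. y \<in> X i \<Longrightarrow> F (scale a y) = pscale (*) a (F y)"
proof (cases c)
  case Bullet
  obtain x t where xt: "x \<in> X i" "t \<in> FX_left i" "word_tensor w = on_left i x t"
    by (rule word_on_left[OF i w])
  show ?thesis
    by (rule that[of x "\<lambda>y. on_left i y t"])
      (simp_all add: xt Bullet color_rep_def i left_rep_on_left on_left_add on_left_scale)
next
  case Circle
  show ?thesis
  proof (cases "w \<in> small_words i")
    case True
    obtain x where x: "x \<in> X i" "word_tensor w = embed i x" by (rule small_word_embed[OF i True])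
    show ?thesis
      by (rule that[of x "embed i"]) (simp_all add: x color_rep_embed i embed_add embed_scale)
  next
    case False
    have "color_rep i c T (word_tensor w) = 0" if "T \<in> lin_ops scale (X i)" for T
      unfolding color_rep_def Circle color.case
      using w False by (intro boolean_rep_large[OF i that] fun_space.span_base) blast
    then show ?thesis
      using that[of "\<xi> i" "\<lambda>_. 0"] \<xi>_X[OF i] lin_ops_zero[OF color_rep_lin_ops[OF i]] by force
  qed
qed

lemma color_rep_hom:
  assumes i: "i \<in> I" and ST: "S \<in> lin_ops scale (X i)" "T \<in> lin_ops scale (X i)"
  shows "color_rep i c (S + T) = color_rep i c S + color_rep i c T"
    and "color_rep i c (pscale scale a S) = pscale (pscale (*)) a (color_rep i c S)"
    and "color_rep i c (S \<circ> T) = color_rep i c S \<circ> color_rep i c T"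
proof -
  note vs = vector_space_axioms subspace_X[OF i] and fs = fun_space.vector_space_axioms subspace_FX
  note ops = lin_ops_add[OF vs ST] lin_ops_pscale[OF vs ST(1), of a]
    lin_ops_comp[OF ST subspace_0[OF subspace_X[OF i]]]
  note L = color_rep_lin_ops[OF i, where c = c]
  have eq: "color_rep i c (S + T) (word_tensor w) = (color_rep i c S + color_rep i c T) (word_tensor w) \<and>
      color_rep i c (pscale scale a S) (word_tensor w) = pscale (pscale (*)) a (color_rep i c S) (word_tensor w) \<and>
      color_rep i c (S \<circ> T) (word_tensor w) = (color_rep i c S \<circ> color_rep i c T) (word_tensor w)"
    if w: "w \<in> words" for w
  proof -
    obtain F x where F: "x \<in> X i" "\<And>T. T \<in> lin_ops scale (X i) \<Longrightarrow> color_rep i c T (word_tensor w) = F (T x)"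
      "\<And>T y. T \<in> lin_ops scale (X i) \<Longrightarrow> y \<in> X i \<Longrightarrow> color_rep i c T (F y) = F (T y)"
      "\<And>y z. y \<in> X i \<Longrightarrow> z \<in> X i \<Longrightarrow> F (y + z) = F y + F z"
      "\<And>a y. y \<in> X i \<Longrightarrow> F (scale a y) = pscale (*) a (F y)"
      using color_rep_word[OF i w, of c] by metis
    have inX: "S x \<in> X i" "T x \<in> X i" using lin_opsD(3)[OF ST(1) F(1)] lin_opsD(3)[OF ST(2) F(1)] .
    have "pscale scale a S x = scale a (S x)" by (simp add: pscale_def)
    then show ?thesis
      unfolding F(2)[OF ops(1)] F(2)[OF ops(2)] F(2)[OF ops(3)] pscale_def[of "pscale (*)"] o_apply
      using F(2)[OF ST(1)] F(2)[OF ST(2)] F(3)[OF ST(1) inX(2)] F(4)[OF inX] F(5)[OF inX(1)] by simp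
  qed
  show "color_rep i c (S + T) = color_rep i c S + color_rep i c T"
    by (rule FX_eqI[OF L[OF ops(1)] lin_ops_add[OF fs L[OF ST(1)] L[OF ST(2)]]]) (use eq in blast)
  show "color_rep i c (pscale scale a S) = pscale (pscale (*)) a (color_rep i c S)"
    by (rule FX_eqI[OF L[OF ops(2)] lin_ops_pscale[OF fs L[OF ST(1)]]]) (use eq in blast)
  show "color_rep i c (S \<circ> T) = color_rep i c S \<circ> color_rep i c T"
    by (rule FX_eqI[OF L[OF ops(3)] lin_ops_comp[OF L[OF ST(1)] L[OF ST(2)] zero_FX]]) (use eq in blast)
qed

end

section \<open>Fock vectors of the reduced free product\<close>

context specified_family
begin

definition starting :: "'i \<Rightarrow> ((('i \<times> 'v) list \<Rightarrow> complex) \<Rightarrow> complex) set" where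
  "starting j = cspan (word_tensor ` {w\<in>words. w \<noteq> [] \<and> fst (hd w) = j})"

lemma Cons_words: "i \<in> I \<Longrightarrow> x \<in> X0 i \<Longrightarrow> w \<in> words_left i \<Longrightarrow> (i, x) # w \<in> words"
  by (auto simp: words_left_def words_def distinct_adj_Cons hd_map)

lemma zero_starting: "0 \<in> starting j"
  unfolding starting_def by (rule fun_space.span_zero)

lemma starting_FX_left: "j \<noteq> i \<Longrightarrow> t \<in> starting j \<Longrightarrow> t \<in> FX_left i"
  unfolding starting_def FX_left_def words_left_def by (rule subsetD[OF fun_space.span_mono]) auto

lemma starting_large: "j \<noteq> i \<Longrightarrow> t \<in> starting j \<Longrightarrow> t \<in> cspan (word_tensor ` (words - small_words i))"
  unfolding starting_def small_words_def by (rule subsetD[OF fun_space.span_mono]) auto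

lemma on_left_starting:
  assumes "i \<in> I" "x \<in> X0 i" "t \<in> FX_left i" shows "on_left i x t \<in> starting i"
  unfolding starting_def
proof (rule linear_in_cspan[OF linear_on_left[OF assms(1)] _ assms(3)[unfolded FX_left_def]])
  fix u assume "u \<in> word_tensor ` words_left i"
  then obtain w where w: "w \<in> words_left i" "u = word_tensor w" by blast
  then show "on_left i x u \<in> cspan (word_tensor ` {w\<in>words. w \<noteq> [] \<and> fst (hd w) = i})"
    using on_left_word[OF assms(1,2) w(1)] Cons_words[OF assms(1,2) w(1)]
    by (auto intro: fun_space.span_base)
qed

lemma on_left_large:
  assumes "i \<in> I" "x \<in> X0 i" "j \<noteq> i" "t \<in> starting j"
  shows "on_left i x t \<in> cspan (word_tensor ` (words - small_words i))"
proof (rule linear_in_cspan[OF linear_on_left[OF assms(1)] _ assms(4)[unfolded starting_def]])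
  fix u assume "u \<in> word_tensor ` {w\<in>words. w \<noteq> [] \<and> fst (hd w) = j}"
  then obtain w where w: "w \<in> words" "w \<noteq> []" "fst (hd w) = j" "u = word_tensor w" by blast
  then have l: "w \<in> words_left i" using assms(3) by (simp add: words_left_def)
  have "(i, x) # w \<in> words - small_words i"
    using Cons_words[OF assms(1,2) l] w(2) by (simp add: small_words_def)
  then show "on_left i x u \<in> cspan (word_tensor ` (words - small_words i))"
    unfolding w(4) on_left_word[OF assms(1,2) l] by (intro fun_space.span_base) blast
qed

lemma vacuum_state_on_left:
  assumes i: "i \<in> I" and x: "x \<in> X i" and t: "t \<in> FX_left i"
  shows "vacuum_state (on_left i x t) = coef i x * vacuum_state t"
proof -
  let ?\<delta> = "\<lambda>w :: ('i \<times> 'v) list. if w = [] then 1 else 0 :: complex"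
  interpret S: free_product_side scale I X X0 \<xi> i "words_left i" "(#)"
    "bilinear_forms scale (X i) (pscale (*)) (FX_left i)" Pair id "FX_left i"
    by (rule left_side[OF i])
  have "t (S.attach_form x ?\<delta>) = coef i x * t ?\<delta> + 0 * t ?\<delta>"
    by (rule cspan_evaluation_combination[OF t[unfolded FX_left_def word_tensor_def]])
      (auto simp: S.attach_form_forms vacuum_form x S.attach_form_def)
  then show ?thesis
    using S.Y_FX[OF t] on_left_FX[OF i x t] vacuum_form
    by (simp add: vacuum_state_def on_left_def S.attach_def pullback_def)
qed

lemma on_left_zero_right: "i \<in> I \<Longrightarrow> on_left i x 0 = 0"
proof -
  assume "i \<in> I"
  then interpret l: Vector_Spaces.linear "pscale (*)" "pscale (*)" "on_left i x" by (rule linear_on_left)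
  show ?thesis by (rule l.zero)
qed

lemma on_left_sum:
  assumes i: "i \<in> I" and t: "t \<in> FX_left i" and y: "\<And>j. j \<in> J \<Longrightarrow> y j \<in> X i"
  shows "on_left i (\<Sum>j\<in>J. scale (c j) (y j)) t = (\<Sum>j\<in>J. pscale (*) (c j) (on_left i (y j) t))"
proof -
  have z: "on_left i 0 t = 0" using on_left_scale[OF i \<xi>_X[OF i] t, of 0] by simp
  show ?thesis using y
  proof (induction J rule: infinite_finite_induct)
    case (insert j J)
    have m: "scale (c j) (y j) \<in> X i" "(\<Sum>j\<in>J. scale (c j) (y j)) \<in> X i"
      using insert.prems by (auto intro!: subspace_sum subspace_scale subspace_X i)
    show ?case
      using insert on_left_add[OF i m t] on_left_scale[OF i _ t, of "y j" "c j"] by simp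
  qed (simp_all only: sum.infinite sum.empty z not_False_eq_True)
qed

lemma on_left_diff:
  assumes i: "i \<in> I" and t: "t \<in> FX_left i" and x: "x \<in> X i" "y \<in> X i"
  shows "on_left i (x - y) t = on_left i x t - on_left i y t"
  using on_left_add[OF i subspace_diff[OF subspace_X[OF i] x] x(2) t] by (simp add: algebra_simps)

end

locale free_boolean_model = specified_family scale I X X0 \<xi>
  for scale :: "complex \<Rightarrow> 'v::ab_group_add \<Rightarrow> 'v"
    and I :: "'i set" and X X0 :: "'i \<Rightarrow> 'v set" and \<xi> :: "'i \<Rightarrow> 'v" +
  fixes L :: "'l set" and idx :: "'l \<Rightarrow> 'i" and col :: "'l \<Rightarrow> color" and loc :: "'l \<Rightarrow> 'v \<Rightarrow> 'v"
  assumes idx: "a \<in> L \<Longrightarrow> idx a \<in> I" and loc: "a \<in> L \<Longrightarrow> loc a \<in> lin_ops scale (X (idx a))"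
begin

definition Op where
  "Op a = color_rep (idx a) (col a) (loc a)"

lemma Op_lin_ops: "a \<in> L \<Longrightarrow> Op a \<in> lin_ops (pscale (*)) FX"
  unfolding Op_def by (rule color_rep_lin_ops[OF idx loc])

lemma Op_embed: "a \<in> L \<Longrightarrow> x \<in> X (idx a) \<Longrightarrow> Op a (embed (idx a) x) = embed (idx a) (loc a x)"
  unfolding Op_def by (rule color_rep_embed[OF idx loc])

lemma vacuum_FX: "vacuum \<in> FX"
  unfolding vacuum_def by (rule word_tensor_FX[OF words_Nil])

lemma vacuum_state_vacuum: "vacuum_state vacuum = 1"
  unfolding vacuum_def by (simp add: vacuum_state_word words_Nil)

sublocale G: specified_rep "pscale (*)" FX vacuum vacuum_state L Op col
  by unfold_locales (auto simp: subspace_FX vacuum_FX vacuum_state_lin vacuum_state_vacuum Op_lin_ops)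

lemma local_rep: "i \<in> I \<Longrightarrow> specified_rep scale (X i) (\<xi> i) (coef i) {a\<in>L. idx a = i} loc"
  by unfold_locales (use subspace_X \<xi>_X coef_lin coef_\<xi> loc in auto)

text \<open>Fock vectors and cumulants of the letters of index \<open>i\<close>, computed in \<open>X i\<close>.\<close>

abbreviation lfock where "lfock i \<equiv> specified_rep.fock scale (\<xi> i) (coef i) loc col"
abbreviation lcum where "lcum i \<equiv> specified_rep.cum scale (\<xi> i) (coef i) loc col"

lemma vacuum_state_embed: "i \<in> I \<Longrightarrow> x \<in> X i \<Longrightarrow> vacuum_state (embed i x) = coef i x"
  unfolding embed_def by (simp add: vacuum_state_on_left vacuum_FX_left vacuum_state_vacuum)

lemma lfock_Nil: "i \<in> I \<Longrightarrow> lfock i [] = \<xi> i"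
  using specified_rep.fock.simps(1)[OF local_rep] .

lemma lfock_X: "i \<in> I \<Longrightarrow> set u \<subseteq> {a\<in>L. idx a = i} \<Longrightarrow> lfock i u \<in> X i"
  using specified_rep.fock_in[OF local_rep] .

lemma lfock_X0:
  assumes "i \<in> I" "set u \<subseteq> {a\<in>L. idx a = i}" "u \<noteq> []" shows "lfock i u \<in> X0 i"
  using specified_rep.\<phi>_fock[OF local_rep[OF assms(1)] assms(2,3)] lfock_X[OF assms(1,2)] coef_zero[OF assms(1)]
  by blast

lemma on_left_lfock_Cons:
  assumes i: "i \<in> I" and t: "t \<in> FX_left i" and a: "set (a # r) \<subseteq> {a\<in>L. idx a = i}"
  shows "on_left i (lfock i (a # r)) t = on_left i (loc a (lfock i r)) t
    - (\<Sum>j\<in>splits col a r. pscale (*) (lcum i (a # take j r)) (on_left i (lfock i (drop j r)) t))"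
proof -
  interpret l: specified_rep scale "X i" "\<xi> i" "coef i" "{a\<in>L. idx a = i}" loc col
    by (rule local_rep[OF i])
  have m: "lfock i (drop j r) \<in> X i" for j
    using a set_drop_subset[of j r] by (intro lfock_X[OF i]) auto
  have "lfock i (a # r) = loc a (lfock i r)
      - (\<Sum>j\<in>splits col a r. scale (lcum i (a # take j r)) (lfock i (drop j r)))"
    using l.T_fock[of a r] by (simp add: algebra_simps)
  moreover have "loc a (lfock i r) \<in> X i" using a by (intro l.T_in lfock_X[OF i]) auto
  moreover have "(\<Sum>j\<in>splits col a r. scale (lcum i (a # take j r)) (lfock i (drop j r))) \<in> X i"
    using m subspace_X[OF i] by (intro subspace_sum subspace_scale) auto
  ultimately show ?thesis
    using m by (simp add: on_left_diff[OF i t] on_left_sum[OF i t])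
qed

lemma cum_step:
  assumes i: "i \<in> I" and av: "set (a # v) \<subseteq> {a\<in>L. idx a = i}" and v: "G.fock v = embed i (lfock i v)"
  shows "G.cum (a # v) = lcum i (a # v)"
proof -
  interpret l: specified_rep scale "X i" "\<xi> i" "coef i" "{a\<in>L. idx a = i}" loc col
    by (rule local_rep[OF i])
  have "lfock i v \<in> X i" using av by (intro lfock_X[OF i]) auto
  moreover from this have m: "loc a (lfock i v) \<in> X i" using av by (intro l.T_in) auto
  ultimately have "Op a (embed i (lfock i v)) = embed i (loc a (lfock i v))"
    using Op_embed[of a "lfock i v"] av by auto
  then show ?thesis
    using v vacuum_state_embed[OF i m] by (simp add: G.cum_def l.cum_def)
qed

text \<open>On \<open>X i\<close> the operators of index \<open>i\<close> act as in \<open>X i\<close>, whatever their colour; so the recursions for the Fock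
vectors coincide.\<close>

lemma fock_mono:
  assumes i: "i \<in> I" and u: "set u \<subseteq> {a\<in>L. idx a = i}"
  shows "G.fock u = embed i (lfock i u)"
  using u
proof (induction u rule: length_induct)
  case (1 u)
  show ?case
  proof (cases u)
    case Nil
    then show ?thesis using on_left_\<xi>[OF i vacuum_FX_left] by (simp add: embed_def lfock_Nil i)
  next
    case (Cons a v)
    have sub: "set v \<subseteq> {a\<in>L. idx a = i}" "set (take j v) \<subseteq> {a\<in>L. idx a = i}"
      "set (drop j v) \<subseteq> {a\<in>L. idx a = i}" "a \<in> L" "idx a = i" for j
      using 1(2) Cons set_take_subset[of j v] set_drop_subset[of j v] by auto
    have IH: "G.fock v = embed i (lfock i v)" "G.fock (take j v) = embed i (lfock i (take j v))"
      "G.fock (drop j v) = embed i (lfock i (drop j v))" for j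
      using 1(1) sub Cons by auto
    have "G.fock u = Op a (G.fock v)
        - (\<Sum>j\<in>splits col a v. pscale (*) (G.cum (a # take j v)) (G.fock (drop j v)))"
      using G.T_fock[of a v] by (simp add: Cons algebra_simps)
    also have "(\<Sum>j\<in>splits col a v. pscale (*) (G.cum (a # take j v)) (G.fock (drop j v)))
        = (\<Sum>j\<in>splits col a v. pscale (*) (lcum i (a # take j v)) (embed i (lfock i (drop j v))))"
      using sub IH by (intro sum.cong refl) (simp add: cum_step[OF i])
    also have "Op a (G.fock v) = embed i (loc a (lfock i v))"
      using Op_embed[OF sub(4), of "lfock i v"] sub lfock_X[OF i sub(1)] IH by simp
    finally show ?thesis
      using on_left_lfock_Cons[OF i vacuum_FX_left, of a v] 1(2) Cons by (simp add: embed_def)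
  qed
qed

lemma cum_mono:
  assumes i: "i \<in> I" and u: "set u \<subseteq> {a\<in>L. idx a = i}" and "u \<noteq> []"
  shows "G.cum u = lcum i u"
proof -
  obtain a v where av: "u = a # v" using \<open>u \<noteq> []\<close> by (cases u) auto
  then have "set v \<subseteq> {a\<in>L. idx a = i}" using u by auto
  from fock_mono[OF i this] show ?thesis using cum_step[OF i] u av by simp
qed

text \<open>A circle compresses to \<open>X i\<close>, so it cannot be kept open on top of letters of other indices.\<close>

definition obstructed :: "'l list \<Rightarrow> bool" where
  "obstructed u \<longleftrightarrow> (\<exists>p a q. u = p @ a # q \<and> col a = Circle \<and> \<not> (\<forall>b\<in>set q. idx b = idx a))"

lemma obstructed_append:
  assumes "obstructed (p @ q)" "\<And>b. b \<in> set p \<Longrightarrow> col b = Bullet"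
  shows "obstructed q"
proof -
  obtain r a t where r: "p @ q = r @ a # t" "col a = Circle" "\<not> (\<forall>b\<in>set t. idx b = idx a)"
    using assms(1) unfolding obstructed_def by blast
  have "\<exists>r'. q = r' @ a # t"
    using r(1,2) assms(2) by (auto simp: append_eq_append_conv2 append_eq_Cons_conv)
  then show ?thesis using r unfolding obstructed_def by blast
qed

text \<open>The shape of the Fock vector of \<open>u\<close>. It is stated for a run \<open>r\<close> of bullets in front of a rest \<open>q\<close>; runs
containing a circle can only occur at the end of an unobstructed word.\<close>

definition fock_factors :: "'l list \<Rightarrow> bool" where
  "fock_factors u \<longleftrightarrow> (obstructed u \<longrightarrow> G.fock u = 0) \<and>
     (\<forall>i\<in>I. \<forall>r q. u = r @ q \<longrightarrow> (\<forall>b\<in>set r. idx b = i \<and> col b = Bullet) \<longrightarrow> q \<noteq> [] \<longrightarrow> idx (hd q) \<noteq> i \<longrightarrow>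
        G.fock u = on_left i (lfock i r) (G.fock q)) \<and>
     (u \<noteq> [] \<longrightarrow> G.fock u \<in> starting (idx (hd u)))"

lemma fock_factorsD:
  assumes "fock_factors u"
  shows "obstructed u \<Longrightarrow> G.fock u = 0"
    and "i \<in> I \<Longrightarrow> u = r @ q \<Longrightarrow> (\<forall>b\<in>set r. idx b = i \<and> col b = Bullet) \<Longrightarrow> q \<noteq> [] \<Longrightarrow>
      idx (hd q) \<noteq> i \<Longrightarrow> G.fock u = on_left i (lfock i r) (G.fock q)"
    and "u \<noteq> [] \<Longrightarrow> G.fock u \<in> starting (idx (hd u))"
  using assms unfolding fock_factors_def by (simp_all only:) blast+

lemma not_mono_split:
  assumes i: "i \<in> I" and u: "set u \<subseteq> L" and nm: "\<not> (\<forall>b\<in>set u. idx b = i)" and no: "\<not> obstructed u"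
  obtains r q where "u = r @ q" "q \<noteq> []" "idx (hd q) \<noteq> i" "\<forall>b\<in>set r. idx b = i \<and> col b = Bullet"
proof
  let ?r = "takeWhile (\<lambda>b. idx b = i) u" and ?q = "dropWhile (\<lambda>b. idx b = i) u"
  show "u = ?r @ ?q" by simp
  show q: "?q \<noteq> []" using nm by (auto simp: dropWhile_eq_Nil_conv)
  then show hd: "idx (hd ?q) \<noteq> i" using hd_dropWhile by fast
  show "\<forall>b\<in>set ?r. idx b = i \<and> col b = Bullet"
  proof
    fix b assume b: "b \<in> set ?r"
    then have bi: "idx b = i" using set_takeWhileD by fast
    obtain r1 r2 where r: "?r = r1 @ b # r2" using split_list[OF b] by blast
    have "u = r1 @ b # (r2 @ ?q)" using r takeWhile_dropWhile_id[of "\<lambda>b. idx b = i" u] by simp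
    moreover have "hd ?q \<in> set (r2 @ ?q)" using q by simp
    ultimately have "col b \<noteq> Circle" using no hd bi unfolding obstructed_def by blast
    then show "idx b = i \<and> col b = Bullet" using bi not_Circle by simp
  qed
qed

text \<open>How an operator of index \<open>i\<close> acts on the Fock vector of a word \<open>u\<close> that also contains other indices.
A circle gives \<open>0\<close> because the vector has no component in the image of \<open>X i\<close>. A bullet acts on the leading
run, and the functional vanishes on the result as it vanishes on the Fock vector of the rest \<open>q\<close>.\<close>

lemma Op_not_mono:
  assumes a: "a \<in> L" and ai: "idx a = i" and u: "set u \<subseteq> L" and nm: "\<not> (\<forall>b\<in>set u. idx b = i)"
    and ex: "fock_factors u" and exs: "\<forall>v. length v < length u \<longrightarrow> set v \<subseteq> L \<longrightarrow> fock_factors v"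
  shows "col a = Circle \<or> obstructed u \<Longrightarrow> Op a (G.fock u) = 0"
    and "col a = Bullet \<Longrightarrow> u = r @ q \<Longrightarrow> (\<forall>b\<in>set r. idx b = i \<and> col b = Bullet) \<Longrightarrow> q \<noteq> [] \<Longrightarrow>
      idx (hd q) \<noteq> i \<Longrightarrow> Op a (G.fock u) = on_left i (loc a (lfock i r)) (G.fock q)"
    and "G.cum (a # u) = 0"
proof -
  have i: "i \<in> I" using idx[OF a] by (simp add: ai)
  have loc_a: "loc a \<in> lin_ops scale (X i)" using loc[OF a] by (simp add: ai)
  have ext: "G.fock q \<in> starting (idx (hd q))" if rq: "u = r @ q" "q \<noteq> []" for r q
  proof (cases r)
    case Nil
    then show ?thesis using fock_factorsD(3)[OF ex] rq by simp
  next
    case (Cons b r')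
    then have "fock_factors q" using exs rq u by simp
    from fock_factorsD(3)[OF this rq(2)] show ?thesis .
  qed
  have fock_u: "G.fock u = on_left i (lfock i r) (G.fock q)" "G.fock q \<in> starting (idx (hd q))"
      "G.fock q \<in> FX_left i" "lfock i r \<in> X i"
    if rq: "u = r @ q" "\<forall>b\<in>set r. idx b = i \<and> col b = Bullet" "q \<noteq> []" "idx (hd q) \<noteq> i" for r q
  proof -
    show "G.fock u = on_left i (lfock i r) (G.fock q)" by (rule fock_factorsD(2)[OF ex i rq])
    show s: "G.fock q \<in> starting (idx (hd q))" by (rule ext[OF rq(1,3)])
    show "G.fock q \<in> FX_left i" by (rule starting_FX_left[OF rq(4) s])
    show "lfock i r \<in> X i" using rq(1,2) u by (intro lfock_X[OF i]) auto
  qed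
  show bul: "Op a (G.fock u) = on_left i (loc a (lfock i r)) (G.fock q)"
    if c: "col a = Bullet" and rq: "u = r @ q" "\<forall>b\<in>set r. idx b = i \<and> col b = Bullet" "q \<noteq> []"
      "idx (hd q) \<noteq> i" for r q
  proof -
    have "Op a = left_rep i (loc a)" using c by (simp add: Op_def ai color_rep_def)
    then show ?thesis unfolding fock_u(1)[OF rq]
      using left_rep_on_left[OF i loc_a fock_u(4)[OF rq] fock_u(3)[OF rq]] by simp
  qed
  have Op0: "Op a 0 = 0" using lin_ops_zero[OF Op_lin_ops[OF a]] .
  show zero: "Op a (G.fock u) = 0" if c: "col a = Circle \<or> obstructed u"
  proof (cases "obstructed u")
    case True
    show ?thesis unfolding fock_factorsD(1)[OF ex True] by (rule Op0)
  next
    case False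
    then have c: "col a = Circle" using c by blast
    obtain r q where rq: "u = r @ q" "q \<noteq> []" "idx (hd q) \<noteq> i" "\<forall>b\<in>set r. idx b = i \<and> col b = Bullet"
      by (rule not_mono_split[OF i u nm False])
    note f = fock_u[OF rq(1) rq(4,2,3)]
    have "G.fock u \<in> cspan (word_tensor ` (words - small_words i))"
    proof (cases r)
      case Nil
      then show ?thesis using rq(1) starting_large[OF rq(3) f(2)] by simp
    next
      case (Cons b r')
      have "set r \<subseteq> {a\<in>L. idx a = i}" using rq(1,4) u by auto
      then have "lfock i r \<in> X0 i" using Cons by (intro lfock_X0[OF i]) auto
      from on_left_large[OF i this rq(3) f(2)] show ?thesis unfolding f(1) .
    qed
    from boolean_rep_large[OF i loc_a this] show ?thesis using c by (simp add: Op_def ai color_rep_def)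
  qed
  show "G.cum (a # u) = 0"
  proof (cases "col a = Circle \<or> obstructed u")
    case True
    from zero[OF this] show ?thesis
      using lin_mapsD(2)[OF vacuum_state_lin zero_FX, of 0] by (simp add: G.cum_def)
  next
    case False
    then have no: "\<not> obstructed u" and c: "col a = Bullet" using not_Circle by auto
    obtain r q where rq: "u = r @ q" "q \<noteq> []" "idx (hd q) \<noteq> i" "\<forall>b\<in>set r. idx b = i \<and> col b = Bullet"
      by (rule not_mono_split[OF i u nm no])
    note f = fock_u[OF rq(1) rq(4,2,3)]
    have m: "loc a (lfock i r) \<in> X i"
      using lin_opsD(3)[OF loc_a f(4)] .
    have z: "vacuum_state (G.fock q) = 0" using rq(1,2) u by (intro G.\<phi>_fock) auto
    have "G.cum (a # u) = vacuum_state (Op a (G.fock u))" by (simp add: G.cum_def)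
    also have "\<dots> = coef i (loc a (lfock i r)) * vacuum_state (G.fock q)"
      unfolding bul[OF c rq(1) rq(4,2,3)] by (rule vacuum_state_on_left[OF i m f(3)])
    finally show ?thesis unfolding z by simp
  qed
qed

text \<open>By induction on the word. The cumulants of mixed prefixes vanish, so that the recursion for a word
starting with a run \<open>r\<close> only involves splittings within \<open>r\<close>, and these are the ones of the recursion in
\<open>X i\<close>.\<close>

lemma fock_factors_all: "set u \<subseteq> L \<Longrightarrow> fock_factors u"
proof (induction u rule: length_induct)
  case (1 u)
  show ?case
  proof (cases u)
    case Nil
    then show ?thesis by (simp add: fock_factors_def obstructed_def)
  next
    case (Cons a v)
    define i where "i = idx a"
    have aL: "a \<in> L" and vL: "set v \<subseteq> L" using 1(2) Cons by auto
    have i: "i \<in> I" using idx[OF aL] by (simp add: i_def)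
    have IH: "fock_factors w" if "length w \<le> length v" "set w \<subseteq> L" for w
      using 1(1) that Cons by simp
    have tl: "set (take j v) \<subseteq> L" "set (drop j v) \<subseteq> L" for j
      using vL set_take_subset[of j v] set_drop_subset[of j v] by auto
    have fock_u: "G.fock u = Op a (G.fock v)
        - (\<Sum>j\<in>splits col a v. pscale (*) (G.cum (a # take j v)) (G.fock (drop j v)))"
      using G.T_fock[of a v] by (simp add: Cons algebra_simps)
    have trivial: "G.fock u = on_left k (lfock k []) (G.fock u)"
      if "k \<in> I" "k \<noteq> i" "G.fock u \<in> starting i" for k
      using on_left_\<xi>[OF that(1)] starting_FX_left[of i k] that by (simp add: lfock_Nil)
    have hd: "idx (hd u) = i" by (simp add: Cons i_def)
    show ?thesis
    proof (cases "\<forall>b\<in>set v. idx b = i")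
      case True
      then have u: "set u \<subseteq> {a\<in>L. idx a = i}" using Cons aL vL by (auto simp: i_def)
      have start: "G.fock u \<in> starting i"
        unfolding fock_mono[OF i u] embed_def
        using lfock_X0[OF i u] Cons by (intro on_left_starting[OF i _ vacuum_FX_left]) simp
      have "\<not> obstructed u" unfolding obstructed_def using u by fastforce
      moreover have "G.fock u = on_left k (lfock k r) (G.fock q)"
        if "k \<in> I" "u = r @ q" "\<forall>b\<in>set r. idx b = k \<and> col b = Bullet" "q \<noteq> []" "idx (hd q) \<noteq> k" for k r q
      proof -
        have "hd q \<in> set u" using that(2) hd_in_set[OF that(4)] by simp
        then have "idx (hd q) = i" using u by blast
        moreover have "r = []"
        proof (cases r)
          case (Cons b r')
          then have "idx b = i" "idx b = k" using that(2,3) u by auto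
          then show ?thesis using \<open>idx (hd q) = i\<close> that(5) by simp
        qed
        ultimately show ?thesis using trivial[of k] start that by simp
      qed
      ultimately show ?thesis using start hd by (simp add: fock_factors_def)
    next
      case nm: False
      have IH': "\<forall>w. length w < length v \<longrightarrow> set w \<subseteq> L \<longrightarrow> fock_factors w" using IH by simp
      note Op_v = Op_not_mono[OF aL i_def[symmetric] vL nm IH[OF order.refl vL] IH']
      have cum_nm: "G.cum (a # take j v) = 0" if "\<not> (\<forall>b\<in>set (take j v). idx b = i)" for j
        by (rule Op_not_mono(3)[OF aL i_def[symmetric] tl(1) that]) (use IH tl in auto)
      show ?thesis
      proof (cases "col a = Circle \<or> obstructed v")
        case True
        \<comment> \<open>Here all terms of the recursion vanish: either the cumulant is mixed, or the closed prefix consists of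
          bullets and the obstruction survives in the rest.\<close>
        have terms: "pscale (*) (G.cum (a # take j v)) (G.fock (drop j v)) = 0" if j: "j \<in> splits col a v" for j
        proof (cases "j = length v")
          case True
          then show ?thesis using Op_v(3) by simp
        next
          case False
          then have b: "\<forall>b\<in>insert a (set (take j v)). col b = Bullet" using j by (simp add: splits_def)
          then have "obstructed v" using True by simp
          then have "obstructed (drop j v)"
            using obstructed_append[of "take j v" "drop j v"] b by simp
          then show ?thesis using fock_factorsD(1)[OF IH[OF _ tl(2)]] by simp
        qed
        have zero: "G.fock u = 0"
          unfolding fock_u Op_v(1)[OF True] by (simp only: sum.neutral[OF ballI[OF terms]] diff_zero)
        have "G.fock u = on_left k (lfock k r) (G.fock q)"
          if k: "k \<in> I" "u = r @ q" "\<forall>b\<in>set r. idx b = k \<and> col b = Bullet" "q \<noteq> []" "idx (hd q) \<noteq> k" for k r q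
        proof (cases r)
          case Nil
          then have "q = u" using k(2) by simp
          then have "k \<noteq> i" using k(5) hd by simp
          then show ?thesis using trivial[OF k(1)] zero_starting[of i] zero Nil \<open>q = u\<close> by metis
        next
          case (Cons b r')
          have r: "b = a" "v = r' @ q" using \<open>u = a # v\<close> k(2) Cons by simp_all
          have bul: "\<And>c. c \<in> set (b # r') \<Longrightarrow> col c = Bullet" using k(3) Cons by auto
          have "obstructed v" using True bul[of a] r(1) by simp
          then have "obstructed q" using obstructed_append[of r' q] r(2) bul by simp
          then have "G.fock q = 0" using fock_factorsD(1)[OF IH[of q]] r vL by simp
          then show ?thesis using zero on_left_zero_right[OF k(1)] by simp
        qed
        then show ?thesis using zero zero_starting by (simp add: fock_factors_def)
      next
        case False
        then have ab: "col a = Bullet" and no: "\<not> obstructed v" using not_Circle by auto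
        obtain r q where rq: "v = r @ q" "q \<noteq> []" "idx (hd q) \<noteq> i"
          and r: "\<forall>b\<in>set r. idx b = i \<and> col b = Bullet"
          using not_mono_split[OF i vL nm no] by blast
        have q: "G.fock q \<in> starting (idx (hd q))" using fock_factorsD(3)[OF IH[of q]] rq vL by simp
        then have qF: "G.fock q \<in> FX_left i" using starting_FX_left[OF rq(3)] by blast
        have arL: "set (a # r) \<subseteq> {a\<in>L. idx a = i}" using r rq vL aL by (auto simp: i_def)
        \<comment> \<open>Prefixes longer than the run \<open>r\<close> contain another index, so their cumulants vanish.\<close>
        have "(\<Sum>j\<in>splits col a v. pscale (*) (G.cum (a # take j v)) (G.fock (drop j v)))
          = (\<Sum>j\<in>splits col a r. pscale (*) (lcum i (a # take j r)) (on_left i (lfock i (drop j r)) (G.fock q)))"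
        proof (rule sum.mono_neutral_cong_right[OF finite_splits])
          show "splits col a r \<subseteq> splits col a v"
            using r ab rq by (auto simp: splits_def dest: in_set_takeD)
          show "\<forall>j\<in>splits col a v - splits col a r. pscale (*) (G.cum (a # take j v)) (G.fock (drop j v)) = 0"
          proof
            fix j assume j: "j \<in> splits col a v - splits col a r"
            have "length r < j"
            proof (rule ccontr)
              assume "\<not> length r < j"
              then have "j \<in> splits col a r" using r ab by (auto simp: splits_def dest: in_set_takeD)
              with j show False by blast
            qed
            then have "hd q \<in> set (take j v)" using rq(2) by (cases q) (auto simp: rq(1) take_Cons')
            then show "pscale (*) (G.cum (a # take j v)) (G.fock (drop j v)) = 0"
              using cum_nm[of j] rq(3) by auto
          qed
          fix j assume "j \<in> splits col a r"
          then have j: "j \<le> length r" by (simp add: splits_def)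
          have "set (a # take j r) \<subseteq> {a\<in>L. idx a = i}" using arL by (auto dest: in_set_takeD)
          then have "G.cum (a # take j v) = lcum i (a # take j r)"
            using cum_mono[OF i] rq(1) j by simp
          moreover have "G.fock (drop j v) = on_left i (lfock i (drop j r)) (G.fock q)"
            by (rule fock_factorsD(2)[OF IH[OF _ tl(2)] i _ _ rq(2,3)])
              (use rq(1) j r in \<open>auto dest: in_set_dropD\<close>)
          ultimately show "pscale (*) (G.cum (a # take j v)) (G.fock (drop j v))
            = pscale (*) (lcum i (a # take j r)) (on_left i (lfock i (drop j r)) (G.fock q))" by simp
        qed
        moreover have "Op a (G.fock v) = on_left i (loc a (lfock i r)) (G.fock q)"
          by (rule Op_v(2)[OF ab rq(1) r rq(2,3)])
        ultimately have main: "G.fock u = on_left i (lfock i (a # r)) (G.fock q)"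
          unfolding fock_u on_left_lfock_Cons[OF i qF arL] by simp
        have start: "G.fock u \<in> starting i"
          unfolding main using lfock_X0[OF i arL] by (intro on_left_starting[OF i _ qF]) simp
        have "\<not> obstructed u"
          using no obstructed_append[of "[a]" v] ab Cons by auto
        moreover have "G.fock u = on_left k (lfock k r') (G.fock q')"
          if k: "k \<in> I" "u = r' @ q'" "\<forall>b\<in>set r'. idx b = k \<and> col b = Bullet" "q' \<noteq> []" "idx (hd q') \<noteq> k" for k r' q'
        proof (cases r')
          case Nil
          then have "q' = u" using k(2) by simp
          then have "k \<noteq> i" using k(5) hd by simp
          then show ?thesis using trivial[OF k(1)] start Nil \<open>q' = u\<close> by metis
        next
          case (Cons b s)
          have s: "b = a" "v = s @ q'" using \<open>u = a # v\<close> k(2) Cons by simp_all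
          have ki: "k = i" using k(3) Cons s(1) by (simp add: i_def)
          have sb: "\<forall>c\<in>set s. idx c = i" using k(3) Cons ki by simp
          have "s = r \<and> q' = q"
          proof -
            have "takeWhile (\<lambda>b. idx b = i) v = r" "dropWhile (\<lambda>b. idx b = i) v = q"
              using rq r by (cases q; simp add: takeWhile_append dropWhile_append; fail)+
            moreover have "takeWhile (\<lambda>b. idx b = i) v = s" "dropWhile (\<lambda>b. idx b = i) v = q'"
              using s(2) k(4,5) ki sb by (cases q'; simp add: takeWhile_append dropWhile_append; fail)+
            ultimately show ?thesis by simp
          qed
          then show ?thesis using main Cons s ki by simp
        qed
        ultimately show ?thesis using start hd by (simp add: fock_factors_def)
      qed
    qed
  qed
qed

lemma mixed_cum_zero:
  assumes "set u \<subseteq> L" "u \<noteq> []" "\<not> (\<exists>i. \<forall>b\<in>set u. idx b = i)"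
  shows "G.cum u = 0"
proof -
  obtain a v where u: "u = a # v" using assms(2) by (cases u) auto
  show ?thesis unfolding u
    by (rule Op_not_mono(3)[OF _ refl]) (use assms u fock_factors_all in auto)
qed

end

section \<open>Joint distributions\<close>

lemma nonempty_prod_comp: "xs \<noteq> [] \<Longrightarrow> nonempty_prod (\<circ>) (map f xs) = foldr f xs"
proof -
  assume "xs \<noteq> []"
  have eq: "foldr (\<circ>) (map f ys) g = foldr f ys \<circ> g" for ys g by (induction ys) auto
  have "nonempty_prod (\<circ>) (map f xs) = foldr f (butlast xs) \<circ> f (last xs)"
    using \<open>xs \<noteq> []\<close> by (simp add: nonempty_prod_def eq last_map flip: map_butlast)
  also have "\<dots> = foldr f (butlast xs @ [last xs])" by (simp add: fun_eq_iff)
  finally show ?thesis using \<open>xs \<noteq> []\<close> by simp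
qed

lemma nonempty_prod_mult: "xs \<noteq> [] \<Longrightarrow> nonempty_prod (*) xs = prod_list xs" for xs :: "'a::monoid_mult list"
proof -
  assume "xs \<noteq> []"
  have eq: "foldr (*) ys g = prod_list ys * g" for ys and g :: 'a by (induction ys) (auto simp: mult.assoc)
  have "nonempty_prod (*) xs = prod_list (butlast xs @ [last xs])" by (simp add: nonempty_prod_def eq)
  then show ?thesis using \<open>xs \<noteq> []\<close> by simp
qed

text \<open>The universal property of the free product in the form needed below: it suffices that the products of
words respect the relations under every linear functional.\<close>

lemma free_product_hom_word:
  assumes sE: "vector_space sE"
    and F: "\<And>k. Vector_Spaces.linear sE (*) k \<Longrightarrow>
      (\<lambda>w. k (nonempty_prod mult (map (\<lambda>(j, b). h j b) w))) \<in> free_product_forms s J B"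
  shows "free_product_hom s J B sE mult h \<in> lin_maps (pscale (*)) sE (free_product s J B) UNIV"
    and "w \<in> free_product_words J B \<Longrightarrow>
      free_product_hom s J B sE mult h (evaluation (free_product_forms s J B) w)
      = nonempty_prod mult (map (\<lambda>(j, b). h j b) w)"
  unfolding free_product_hom_def free_product_def
  by (rule lin_extension_evaluation(1)[OF sE F], assumption) (rule lin_extension_evaluation(2)[OF sE F])

locale labelled_family = nc_prob_space scale \<phi>
  for scale :: "complex \<Rightarrow> 'a::ring_1 \<Rightarrow> 'a" and \<phi> :: "'a \<Rightarrow> complex" +
  fixes J :: "'j set" and B :: "'j \<Rightarrow> 'a set"
begin

abbreviation prod_words where "prod_words \<equiv> free_product_words J B"
abbreviation prod_forms where "prod_forms \<equiv> free_product_forms scale J B"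

lemma prod_words_iff: "p @ (j, x) # q \<in> prod_words \<longleftrightarrow> set p \<subseteq> Sigma J B \<and> j \<in> J \<and> x \<in> B j \<and> set q \<subseteq> Sigma J B"
  by (auto simp: free_product_words_def)

lemma prod_formsI:
  assumes "\<And>p q j x y. set p \<subseteq> Sigma J B \<Longrightarrow> set q \<subseteq> Sigma J B \<Longrightarrow> j \<in> J \<Longrightarrow> x \<in> B j \<Longrightarrow> y \<in> B j \<Longrightarrow>
      f (p @ (j, x + y) # q) = f (p @ (j, x) # q) + f (p @ (j, y) # q)"
    and "\<And>p q j x c. set p \<subseteq> Sigma J B \<Longrightarrow> set q \<subseteq> Sigma J B \<Longrightarrow> j \<in> J \<Longrightarrow> x \<in> B j \<Longrightarrow>
      f (p @ (j, scale c x) # q) = c * f (p @ (j, x) # q)"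
    and "\<And>p q j x y. set p \<subseteq> Sigma J B \<Longrightarrow> set q \<subseteq> Sigma J B \<Longrightarrow> j \<in> J \<Longrightarrow> x \<in> B j \<Longrightarrow> y \<in> B j \<Longrightarrow>
      f (p @ (j, x) # (j, y) # q) = f (p @ (j, x * y) # q)"
  shows "f \<in> prod_forms"
proof -
  have "f \<in> multilinear_forms scale prod_words"
    unfolding multilinear_forms_def using assms(1,2) by (simp add: prod_words_iff)
  moreover have "f (p @ (j, a) # (j, b) # q) = f (p @ (j, a * b) # q)"
    if "p @ (j, a) # (j, b) # q \<in> prod_words" for p q j a b
    using that assms(3)[of p q j a b] by (simp add: prod_words_iff)
  ultimately show ?thesis by (simp add: free_product_forms_def)
qed

lemma algebra_hom_word:
  shows "free_product_hom scale J B scale (*) (\<lambda>_ a. a) \<in> lin_maps (pscale (*)) scale (free_product scale J B) UNIV"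
    and "w \<in> prod_words \<Longrightarrow> free_product_hom scale J B scale (*) (\<lambda>_ a. a) (evaluation prod_forms w)
      = prod_list (map snd w)"
proof -
  have eq: "nonempty_prod (*) (map (\<lambda>(j, b). b) w) = prod_list (map snd w)" if "w \<noteq> []" for w :: "('j \<times> 'a) list"
  proof -
    have "(\<lambda>(j, b). b) = (snd :: 'j \<times> 'a \<Rightarrow> 'a)" by auto
    then show ?thesis using that nonempty_prod_mult[of "map snd w"] by simp
  qed
  have F: "(\<lambda>w. k (nonempty_prod (*) (map (\<lambda>(j, b). b) w))) \<in> prod_forms"
    if k: "Vector_Spaces.linear scale (*) k" for k
  proof -
    interpret k: Vector_Spaces.linear scale "(*)" k by fact
    have eq2: "nonempty_prod (*) (map (\<lambda>(j, b). b) (p @ a # q)) = prod_list (map snd (p @ a # q))"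
      for p q and a :: "'j \<times> 'a" by (rule eq) simp
    show ?thesis
      by (rule prod_formsI; unfold eq2)
        (simp_all add: distrib_left distrib_right k.add mult.assoc
          k.scale flip: scale_mult_left scale_mult_right)
  qed
  note h = free_product_hom_word[OF vector_space_axioms F]
  show "free_product_hom scale J B scale (*) (\<lambda>_ a. a) \<in> lin_maps (pscale (*)) scale (free_product scale J B) UNIV"
    by (rule h(1))
  show "free_product_hom scale J B scale (*) (\<lambda>_ a. a) (evaluation prod_forms w) = prod_list (map snd w)"
    if "w \<in> prod_words"
    using h(2)[OF _ that] eq[of w] that by (auto simp: free_product_words_def)
qed

end

locale operator_family = labelled_family scale \<phi> J B
  for scale :: "complex \<Rightarrow> 'a::ring_1 \<Rightarrow> 'a" and \<phi> :: "'a \<Rightarrow> complex"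
    and J :: "'j set" and B :: "'j \<Rightarrow> 'a set" +
  fixes h :: "'j \<Rightarrow> 'a \<Rightarrow> ('x \<Rightarrow> complex) \<Rightarrow> ('x \<Rightarrow> complex)" and D :: "('x \<Rightarrow> complex) set"
  assumes D: "fun_space.subspace D"
    and ops: "\<And>j b. j \<in> J \<Longrightarrow> b \<in> B j \<Longrightarrow> h j b \<in> lin_ops (pscale (*)) D"
    and add: "\<And>j b c. j \<in> J \<Longrightarrow> b \<in> B j \<Longrightarrow> c \<in> B j \<Longrightarrow> h j (b + c) = h j b + h j c"
    and sc: "\<And>j b c. j \<in> J \<Longrightarrow> b \<in> B j \<Longrightarrow> h j (scale c b) = pscale (pscale (*)) c (h j b)"
    and mult: "\<And>j b c. j \<in> J \<Longrightarrow> b \<in> B j \<Longrightarrow> c \<in> B j \<Longrightarrow> h j (b * c) = h j b \<circ> h j c"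
begin

lemma operator_hom_word:
  shows "free_product_hom scale J B (pscale (pscale (*))) (\<circ>) h
      \<in> lin_maps (pscale (*)) (pscale (pscale (*))) (free_product scale J B) UNIV"
    and "w \<in> prod_words \<Longrightarrow> free_product_hom scale J B (pscale (pscale (*))) (\<circ>) h (evaluation prod_forms w)
      = foldr (\<lambda>(j, b). h j b) w"
proof -
  let ?H = "\<lambda>(j, b). h j b"
  have in_D: "h j b v \<in> D" if "j \<in> J" "b \<in> B j" for j b v
    using ops[OF that] fun_space.subspace_0[OF D]
    by (cases "v \<in> D") (auto simp: lin_ops_def lin_maps_def)
  have lin: "foldr ?H p u \<in> D \<and> foldr ?H p (u + v) = foldr ?H p u + foldr ?H p v
      \<and> foldr ?H p (pscale (*) c u) = pscale (*) c (foldr ?H p u)"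
    if "set p \<subseteq> Sigma J B" "u \<in> D" "v \<in> D" for p u v c
    using that
  proof (induction p arbitrary: u v)
    case (Cons a p)
    obtain j b where a: "a = (j, b)" "j \<in> J" "b \<in> B j" using Cons.prems(1) by auto
    note H = lin_opsD[OF ops[OF a(2,3)]]
    have p: "set p \<subseteq> Sigma J B" using Cons.prems by simp
    note u = Cons.IH[OF p Cons.prems(2,3)] and v = Cons.IH[OF p Cons.prems(3,3)]
    have "h j b (foldr ?H p u + foldr ?H p v) = h j b (foldr ?H p u) + h j b (foldr ?H p v)"
      using H(1) u v by blast
    moreover have "h j b (pscale (*) c (foldr ?H p u)) = pscale (*) c (h j b (foldr ?H p u))"
      using H(2) u by blast
    ultimately show ?case using u in_D[OF a(2,3)] by (simp only: a(1) foldr.simps o_apply prod.case)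
  qed simp
  have eq: "nonempty_prod (\<circ>) (map ?H w) = foldr ?H w" if "w \<noteq> []" for w :: "('j \<times> 'a) list"
    using nonempty_prod_comp[OF that] .
  have F: "(\<lambda>w. k (nonempty_prod (\<circ>) (map ?H w))) \<in> prod_forms"
    if k: "Vector_Spaces.linear (pscale (pscale (*))) (*) k" for k
  proof -
    interpret k: Vector_Spaces.linear "pscale (pscale (*))" "(*)" k by fact
    have eq2: "nonempty_prod (\<circ>) (map ?H (p @ a # q)) = foldr ?H (p @ a # q)" for p a q
      by (rule eq) simp
    show ?thesis
    proof (rule prod_formsI, goal_cases)
      case (1 p q j x y)
      have "foldr ?H (p @ (j, x + y) # q) = foldr ?H (p @ (j, x) # q) + foldr ?H (p @ (j, y) # q)"
        using lin[OF 1(1) in_D[OF 1(3,4)] in_D[OF 1(3,5)]] by (intro ext) (simp add: add[OF 1(3-5)])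
      then show ?case unfolding eq2 by (simp only: k.add)
    next
      case (2 p q j x c)
      have "foldr ?H (p @ (j, scale c x) # q) = pscale (pscale (*)) c (foldr ?H (p @ (j, x) # q))"
        using lin[OF 2(1) in_D[OF 2(3,4)] in_D[OF 2(3,4)]]
        by (intro ext) (simp add: sc[OF 2(3,4)] pscale_def[of "pscale (*)"])
      then show ?case unfolding eq2 by (simp only: k.scale)
    next
      case (3 p q j x y)
      have "foldr ?H (p @ (j, x) # (j, y) # q) = foldr ?H (p @ (j, x * y) # q)"
        by (intro ext) (simp add: mult[OF 3(3-5)])
      then show ?case unfolding eq2 by (simp only:)
    qed
  qed
  have vs: "vector_space (pscale (pscale (*)) :: complex \<Rightarrow> (('x \<Rightarrow> complex) \<Rightarrow> 'x \<Rightarrow> complex) \<Rightarrow> _)"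
    by (rule vector_space_pscale[OF fun_space.vector_space_axioms])
  note h = free_product_hom_word[where sE = "pscale (pscale (*))" and mult = "(\<circ>)" and h = h and s = scale
      and J = J and B = B, OF vs F]
  show "free_product_hom scale J B (pscale (pscale (*))) (\<circ>) h
      \<in> lin_maps (pscale (*)) (pscale (pscale (*))) (free_product scale J B) UNIV"
    by (rule h(1))
  show "free_product_hom scale J B (pscale (pscale (*))) (\<circ>) h (evaluation prod_forms w) = foldr ?H w"
    if "w \<in> prod_words"
    using h(2)[OF _ that] eq[of w] that by (auto simp: free_product_words_def)
qed

text \<open>Equality of joint distributions is equality of the moments of all words, as both sides are linear
in \<open>t\<close> and the words span the free product.\<close>

lemma joint_distribution_eq_iff:
  assumes v: "v \<in> D" and \<psi>: "\<psi> \<in> lin_maps (pscale (*)) (*) D UNIV"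
  shows "(\<forall>t\<in>free_product scale J B.
        joint_distribution scale J B (pscale (pscale (*))) (\<circ>) (\<lambda>T. \<psi> (T v)) h t
      = joint_distribution scale J B scale (*) \<phi> (\<lambda>_ a. a) t)
    \<longleftrightarrow> (\<forall>w\<in>prod_words. \<psi> (foldr (\<lambda>(j, b). h j b) w v) = \<phi> (prod_list (map snd w)))"
    (is "?L \<longleftrightarrow> ?R")
proof
  note A = algebra_hom_word and O = operator_hom_word
  show ?R if L: ?L
  proof
    fix w assume w: "w \<in> prod_words"
    then have "evaluation prod_forms w \<in> free_product scale J B"
      unfolding free_product_def by (intro fun_space.span_base) auto
    with L have "joint_distribution scale J B (pscale (pscale (*))) (\<circ>) (\<lambda>T. \<psi> (T v)) h (evaluation prod_forms w)
      = joint_distribution scale J B scale (*) \<phi> (\<lambda>_ a. a) (evaluation prod_forms w)" by blast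
    then show "\<psi> (foldr (\<lambda>(j, b). h j b) w v) = \<phi> (prod_list (map snd w))"
      unfolding joint_distribution_def O(2)[OF w] A(2)[OF w] .
  qed
  show ?L if R: ?R
  proof
    interpret \<phi>: Vector_Spaces.linear scale "(*)" \<phi> by (rule linear_state)
    let ?H = "free_product_hom scale J B (pscale (pscale (*))) (\<circ>) h"
    let ?A = "free_product_hom scale J B scale (*) (\<lambda>_ a. a)"
    have word: "foldr (\<lambda>(j, b). h j b) w v \<in> D" if "set w \<subseteq> Sigma J B" for w
      using that
    proof (induction w)
      case (Cons a w)
      then obtain j b where a: "a = (j, b)" "j \<in> J" "b \<in> B j" by auto
      then show ?case using lin_opsD(3)[OF ops[OF a(2,3)]] Cons by simp
    qed (simp add: v)
    fix t assume t: "t \<in> free_product scale J B"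
    have "t \<in> free_product scale J B \<and> ?H t v \<in> D \<and> \<psi> (?H t v) = \<phi> (?A t)"
      using t unfolding free_product_def
    proof (induction rule: fun_space.span_induct_alt)
      case base
      have m: "0 \<in> free_product scale J B" unfolding free_product_def by (rule fun_space.span_zero)
      have A0: "?A 0 = 0" using lin_mapsD(2)[OF A(1) m, of 0] by simp
      have "?H 0 v = pscale (pscale (*)) 0 (?H 0) v"
        using lin_mapsD(2)[OF O(1) m, of 0] by (simp only: fun_space.scale_zero_left)
      then have H: "?H 0 v = 0" unfolding pscale_def[of "pscale (*)"] by (simp only: fun_space.scale_zero_left)
      have "\<psi> 0 = 0" using lin_mapsD(2)[OF \<psi> fun_space.subspace_0[OF D], of 0] by simp
      then show ?case
        unfolding H A0 \<phi>.zero using m[unfolded free_product_def] fun_space.subspace_0[OF D] by (intro conjI)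
    next
      case (step c x y)
      then obtain w where w: "w \<in> prod_words" "x = evaluation prod_forms w" by blast
      then have x: "x \<in> free_product scale J B"
        unfolding free_product_def by (auto intro: fun_space.span_base)
      then have cx: "pscale (*) c x \<in> free_product scale J B"
        unfolding free_product_def by (rule fun_space.span_scale)
      have y: "y \<in> free_product scale J B" "?H y v \<in> D" "\<psi> (?H y v) = \<phi> (?A y)"
        using step(2) unfolding free_product_def by blast+
      have Hx: "?H x v \<in> D" "\<psi> (?H x v) = \<phi> (?A x)"
        using word[of w] w R O(2)[OF w(1)] A(2)[OF w(1)] by (auto simp: free_product_words_def)
      have H: "?H (pscale (*) c x + y) v = pscale (*) c (?H x v) + ?H y v"
        unfolding lin_mapsD(1)[OF O(1) cx y(1)] lin_mapsD(2)[OF O(1) x]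
        by (simp add: pscale_def[of "pscale (*)"])
      have A': "?A (pscale (*) c x + y) = scale c (?A x) + ?A y"
        unfolding lin_mapsD(1)[OF A(1) cx y(1)] lin_mapsD(2)[OF A(1) x] ..
      have cD: "pscale (*) c (?H x v) \<in> D" by (rule fun_space.subspace_scale[OF D Hx(1)])
      have 1: "pscale (*) c x + y \<in> free_product scale J B"
        using cx y(1) unfolding free_product_def by (rule fun_space.span_add)
      have 2: "?H (pscale (*) c x + y) v \<in> D"
        unfolding H by (rule fun_space.subspace_add[OF D cD y(2)])
      have 3: "\<psi> (?H (pscale (*) c x + y) v) = \<phi> (?A (pscale (*) c x + y))"
        unfolding H A' lin_mapsD(1)[OF \<psi> cD y(2)] lin_mapsD(2)[OF \<psi> Hx(1)] Hx(2) y(3) \<phi>.add \<phi>.scale ..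
      show ?case using conjI[OF 1 conjI[OF 2 3]] unfolding free_product_def .
    qed
    then show "joint_distribution scale J B (pscale (pscale (*))) (\<circ>) (\<lambda>T. \<psi> (T v)) h t
      = joint_distribution scale J B scale (*) \<phi> (\<lambda>_ a. a) t"
      by (simp add: joint_distribution_def)
  qed
qed

end

section \<open>Free-Boolean independence\<close>

definition face_color :: "face \<Rightarrow> color" where
  "face_color f = (case f of LeftFace \<Rightarrow> Bullet | RightFace \<Rightarrow> Circle)"

definition letter_color :: "('i \<times> face) \<times> 'a \<Rightarrow> color" where
  "letter_color b = face_color (snd (fst b))"

definition letter_op :: "('i \<Rightarrow> 'a \<Rightarrow> 'v \<Rightarrow> 'v) \<Rightarrow> ('i \<Rightarrow> 'a \<Rightarrow> 'v \<Rightarrow> 'v) \<Rightarrow> ('i \<times> face) \<times> 'a \<Rightarrow> 'v \<Rightarrow> 'v" where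
  "letter_op l r b = (case b of ((i, f), a) \<Rightarrow> case f of LeftFace \<Rightarrow> l i a | RightFace \<Rightarrow> r i a)"

lemma face_color_eq: "face_color f = Bullet \<longleftrightarrow> f = LeftFace"
  by (cases f) (simp_all add: face_color_def)

locale face_family = nc_prob_space scale \<phi>
  for scale :: "complex \<Rightarrow> 'a::ring_1 \<Rightarrow> 'a" and \<phi> :: "'a \<Rightarrow> complex" +
  fixes I :: "'i set" and A :: "'i \<Rightarrow> face \<Rightarrow> 'a set"
begin

definition letters :: "(('i \<times> face) \<times> 'a) set" where
  "letters = Sigma (I \<times> UNIV) (\<lambda>(i, f). A i f)"

definition letter_words :: "(('i \<times> face) \<times> 'a) list set" where
  "letter_words = {w. w \<noteq> [] \<and> set w \<subseteq> letters}"

lemma letters_iff: "((i, f), a) \<in> letters \<longleftrightarrow> i \<in> I \<and> a \<in> A i f"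
  by (auto simp: letters_def)

lemma free_boolean_model_letters:
  assumes "specified_family sV I X X0 \<xi>"
    and "\<forall>i\<in>I. algebra_hom_into_lin_ops scale (A i LeftFace) sV (X i) (l i)"
    and "\<forall>i\<in>I. algebra_hom_into_lin_ops scale (A i RightFace) sV (X i) (r i)"
  shows "free_boolean_model sV I X X0 \<xi> letters (\<lambda>b. fst (fst b)) (letter_op l r)"
proof -
  interpret F: specified_family sV I X X0 \<xi> by fact
  show ?thesis
    by unfold_locales
      (use assms(2,3) in \<open>auto simp: letters_def letter_op_def algebra_hom_into_lin_ops_def split: face.splits\<close>)
qed

lemma joint_distribution_iff:
  assumes sf: "specified_family sV I X X0 \<xi>"
    and l: "\<forall>i\<in>I. algebra_hom_into_lin_ops scale (A i LeftFace) sV (X i) (l i)"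
    and r: "\<forall>i\<in>I. algebra_hom_into_lin_ops scale (A i RightFace) sV (X i) (r i)"
  shows "(let J = I \<times> UNIV;
             B = (\<lambda>(i, f). A i f);
             P = specified_family.P_uplus sV I X0;
             lrep = specified_family.left_rep sV I X X0 \<xi>;
             rrep = specified_family.right_rep sV I X X0 \<xi>;
             h = (\<lambda>(i, f) a. case f of
                    LeftFace \<Rightarrow> lrep i (l i a)
                  | RightFace \<Rightarrow> P i \<circ> rrep i (r i a) \<circ> P i)
         in \<forall>t\<in>free_product scale J B.
              joint_distribution scale J B (pscale (pscale (*))) (\<circ>)
                (specified_family.vacuum_functional sV I X0) h t
            = joint_distribution scale J B scale (*) \<phi> (\<lambda>_ a. a) t)
    \<longleftrightarrow> (\<forall>w\<in>letter_words. specified_family.vacuum_state sV I X0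
          (foldr (free_boolean_model.Op sV I X X0 \<xi> (\<lambda>b. fst (fst b)) letter_color (letter_op l r)) w
            (specified_family.vacuum sV I X0)) = \<phi> (prod_list (map snd w)))"
proof -
  interpret M: free_boolean_model sV I X X0 \<xi> letters "\<lambda>b. fst (fst b)" letter_color "letter_op l r"
    by (rule free_boolean_model_letters[OF sf l r])
  define h where "h = (\<lambda>(i, f) a. case f of LeftFace \<Rightarrow> M.left_rep i (l i a)
                  | RightFace \<Rightarrow> M.P_uplus i \<circ> M.right_rep i (r i a) \<circ> M.P_uplus i)"
  define k where "k i f a = letter_op l r ((i, f), a)" for i f a
  have h_eq: "h (i, f) = (\<lambda>a. M.color_rep i (face_color f) (k i f a))" for i f
    by (cases f) (simp_all add: h_def k_def letter_op_def face_color_def M.color_rep_def M.boolean_rep_def)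
  have Op: "(\<lambda>(j, b). h j b) = M.Op"
    by (auto simp: fun_eq_iff M.Op_def h_eq letter_color_def k_def)
  have hom: "k i f a \<in> lin_ops sV (X i)" "k i f (scale c a) = pscale sV c (k i f a)"
      "b \<in> A i f \<Longrightarrow> k i f (a + b) = k i f a + k i f b" "b \<in> A i f \<Longrightarrow> k i f (a * b) = k i f a \<circ> k i f b"
    if "i \<in> I" "a \<in> A i f" for i f a b c
    using bspec[OF l that(1)] bspec[OF r that(1)] that(2) unfolding algebra_hom_into_lin_ops_def k_def letter_op_def
    by (cases f; simp)+
  interpret O: operator_family scale \<phi> "I \<times> (UNIV :: face set)" "\<lambda>(i, f). A i f" h M.FX
  proof (unfold_locales, goal_cases)
    case 1
    show ?case by (rule M.subspace_FX)
  next
    case (2 j b)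
    then obtain i f where j: "j = (i, f)" and i: "i \<in> I" "b \<in> A i f" by auto
    show ?case unfolding j h_eq by (rule M.color_rep_lin_ops[OF i(1) hom(1)[OF i]])
  next
    case (3 j b c)
    then obtain i f where j: "j = (i, f)" and i: "i \<in> I" "b \<in> A i f" "c \<in> A i f" by auto
    show ?case unfolding j h_eq hom(3)[OF i]
      by (rule M.color_rep_hom(1)[OF i(1) hom(1)[OF i(1,2)] hom(1)[OF i(1,3)]])
  next
    case (4 j b c)
    then obtain i f where j: "j = (i, f)" and i: "i \<in> I" "b \<in> A i f" by auto
    show ?case unfolding j h_eq hom(2)[OF i] by (rule M.color_rep_hom(2)[OF i(1) hom(1)[OF i] hom(1)[OF i]])
  next
    case (5 j b c)
    then obtain i f where j: "j = (i, f)" and i: "i \<in> I" "b \<in> A i f" "c \<in> A i f" by auto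
    show ?case unfolding j h_eq hom(4)[OF i]
      by (rule M.color_rep_hom(3)[OF i(1) hom(1)[OF i(1,2)] hom(1)[OF i(1,3)]])
  qed
  have vf: "M.vacuum_functional = (\<lambda>T. M.vacuum_state (T M.vacuum))"
    by (rule ext) (rule M.vacuum_functional_eq)
  have words: "free_product_words (I \<times> UNIV) (\<lambda>(i, f). A i f) = letter_words"
    by (simp add: free_product_words_def letter_words_def letters_def)
  show ?thesis
    unfolding Let_def h_def[symmetric] vf
    using O.joint_distribution_eq_iff[OF M.vacuum_FX M.vacuum_state_lin] unfolding Op words .
qed

text \<open>If a representation reproduces the moments of the faces, then the cumulants of the faces can be computed
from its Fock vectors.\<close>

lemma letter_list_cumulant:
  fixes T :: "('i \<times> face) \<times> 'a \<Rightarrow> 'd::ab_group_add \<Rightarrow> 'd"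
  assumes R: "specified_rep s D \<eta> \<psi> letters T"
    and mom: "\<And>w. w \<in> letter_words \<Longrightarrow> \<psi> (foldr T w \<eta>) = \<phi> (prod_list (map snd w))"
    and n: "n \<ge> 1" and z: "z ` {1..n} \<subseteq> letters"
    and \<chi>: "\<And>k. k \<in> {1..n} \<Longrightarrow> \<chi> k = letter_color (z k)"
  shows "cumulant \<phi> n \<chi> {{1..n}} (\<lambda>k. snd (z k)) = specified_rep.cum s \<eta> \<psi> T letter_color (map z [1..<Suc n])"
proof -
  interpret R: specified_rep s D \<eta> \<psi> letters T letter_color by (rule R)
  let ?w = "\<lambda>S. map z (sorted_list_of_set S)"
  have "cumulant \<phi> n \<chi> {{1..n}} (\<lambda>k. snd (z k)) = R.cum (?w {1..n})"
  proof (rule cumulant_top_eqI[OF n])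
    fix S assume S: "S \<subseteq> {1..n}" "S \<noteq> {}"
    then have f: "finite S" using finite_subset by blast
    have "?w S \<in> letter_words" using S f z by (auto simp: letter_words_def)
    from mom[OF this] have "\<phi> (prod_list (map (\<lambda>k. snd (z k)) (sorted_list_of_set S))) = \<psi> (foldr T (?w S) \<eta>)"
      by (simp add: o_def)
    also have "\<dots> = (\<Sum>\<pi>\<in>INC_on S \<chi>. \<Prod>V\<in>\<pi>. R.cum (?w V))"
      by (rule R.moment_eq_sum_INC[OF f]) (use S z \<chi> in auto)
    finally show "\<phi> (prod_list (map (\<lambda>k. snd (z k)) (sorted_list_of_set S)))
      = (\<Sum>\<pi>\<in>INC_on S \<chi>. \<Prod>V\<in>\<pi>. R.cum (?w V))" .
  qed
  also have "sorted_list_of_set {1..n} = [1..<Suc n]"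
    by (metis atLeastLessThanSuc_atLeastAtMost sorted_list_of_set_range)
  finally show ?thesis .
qed

lemma free_boolean_imp_combinatorial:
  assumes "free_boolean_independent sV scale \<phi> I A"
  shows "combinatorially_free_boolean_independent \<phi> I A"
  using assms unfolding free_boolean_independent_def
proof (elim exE conjE, goal_cases)
  case (1 X X0 \<xi> l r)
  note sf = 1(1) and l = 1(2) and r = 1(3)
  note joint = 1(4)[unfolded joint_distribution_iff[OF sf l r]]
  interpret M: free_boolean_model sV I X X0 \<xi> letters "\<lambda>b. fst (fst b)" letter_color "letter_op l r"
    by (rule free_boolean_model_letters[OF sf l r])
  show ?thesis
    unfolding combinatorially_free_boolean_independent_def
  proof (intro allI impI, elim conjE)
    fix n :: nat and \<chi> \<beta> \<omega> z
    assume n: "1 \<le> n" and \<beta>: "{k \<in> {1..n}. \<beta> k = LeftFace} = {k \<in> {1..n}. \<chi> k = Bullet}"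
      and \<omega>: "\<forall>k\<in>{1..n}. \<omega> k \<in> I" "\<nexists>i. \<forall>k\<in>{1..n}. \<omega> k = i" and z: "\<forall>k\<in>{1..n}. z k \<in> A (\<omega> k) (\<beta> k)"
    define b where "b k = ((\<omega> k, \<beta> k), z k)" for k
    have \<chi>: "\<chi> k = letter_color (b k)" if "k \<in> {1..n}" for k
    proof -
      have "\<beta> k = LeftFace \<longleftrightarrow> \<chi> k = Bullet" using \<beta> that by blast
      then show ?thesis
        by (cases "\<beta> k"; cases "\<chi> k") (auto simp: b_def letter_color_def face_color_def)
    qed
    have b: "b ` {1..n} \<subseteq> letters" using \<omega> z by (auto simp: b_def letters_iff)
    have "cumulant \<phi> n \<chi> {{1..n}} (\<lambda>k. snd (b k)) = M.G.cum (map b [1..<Suc n])"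
      by (rule letter_list_cumulant[OF M.G.specified_rep_axioms _ n b]) (erule bspec[OF joint], erule \<chi>)
    also have "\<dots> = 0"
    proof (rule M.mixed_cum_zero)
      show "set (map b [1..<Suc n]) \<subseteq> letters" "map b [1..<Suc n] \<noteq> []" using b n by auto
      show "\<nexists>i. \<forall>c\<in>set (map b [1..<Suc n]). fst (fst c) = i"
        using \<omega>(2) by (auto simp: b_def atLeastLessThanSuc_atLeastAtMost simp del: upt_Suc)
    qed
    finally show "cumulant \<phi> n \<chi> {{1..n}} z = 0" by (simp add: b_def)
  qed
qed

lemma list_positions:
  defines "z \<equiv> \<lambda>w k. w ! (k - 1)"
  shows "map (z w) [1..<Suc (length w)] = w" "z w ` {1..length w} = set w"
    "map (z w) (sorted_list_of_set {1..length w}) = w"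
proof -
  show w: "map (z w) [1..<Suc (length w)] = w"
    unfolding z_def by (intro nth_equalityI) (auto simp del: upt_Suc)
  then show "z w ` {1..length w} = set w"
    by (metis atLeastLessThanSuc_atLeastAtMost set_map set_upt)
  show "map (z w) (sorted_list_of_set {1..length w}) = w"
    using w by (metis atLeastLessThanSuc_atLeastAtMost sorted_list_of_set_range)
qed

text \<open>Two representations of the letters are compared: on the reduced free product of copies of the algebra,
and on the algebra itself (\<open>R\<close>), both built from left multiplication. The latter has the right moments by
construction.\<close>

lemma combinatorial_imp_free_boolean:
  assumes comb: "combinatorially_free_boolean_independent \<phi> I A"
  shows "free_boolean_independent scale scale \<phi> I A"
proof -
  interpret \<phi>: Vector_Spaces.linear scale "(*)" \<phi> by (rule linear_state)
  have \<phi>_maps: "\<phi> \<in> lin_maps scale (*) UNIV UNIV"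
    by (simp add: lin_maps_def \<phi>.add \<phi>.scale)
  define X where "X = (\<lambda>i :: 'i. UNIV :: 'a set)"
  define X0 where "X0 = (\<lambda>i :: 'i. {x. \<phi> x = 0})"
  define \<xi> where "\<xi> = (\<lambda>i :: 'i. 1 :: 'a)"
  define l where "l = (\<lambda>(i :: 'i) (a :: 'a) x. a * x)"
  have ker: "subspace {x. \<phi> x = 0}"
    by (intro subspaceI) (auto simp: \<phi>.zero \<phi>.add \<phi>.scale)
  have span: "UNIV = span (insert 1 {x. \<phi> x = 0})"
  proof -
    have "x - scale (\<phi> x) 1 \<in> span {x. \<phi> x = 0}" for x
      by (rule span_base) (simp add: \<phi>.diff \<phi>.scale state_one)
    then show ?thesis unfolding span_insert by blast
  qed
  have sf: "specified_family scale I X X0 \<xi>"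
  proof unfold_locales
    fix i assume "i \<in> I"
    show "specified_vector_space scale (X i) (X0 i) (\<xi> i)"
      unfolding specified_vector_space_def X_def X0_def \<xi>_def
      using ker span state_one by (auto intro: bexI[of _ 1])
  qed
  have hom: "\<forall>i\<in>I. algebra_hom_into_lin_ops scale (A i f) scale (X i) (l i)" for f
    unfolding algebra_hom_into_lin_ops_def lin_ops_def lin_maps_def l_def X_def
    by (auto simp: fun_eq_iff algebra_simps pscale_def simp flip: scale_mult_left scale_mult_right)
  interpret free_boolean_model scale I X X0 \<xi> letters "\<lambda>b. fst (fst b)" letter_color "letter_op l l"
    by (rule free_boolean_model_letters[OF sf hom hom])
  have coef: "coef i = \<phi>" for i
    unfolding coef_def[of i] unfolding X_def X0_def \<xi>_def
    by (rule specified_functional_eqI[OF vector_space_axioms _ _ \<phi>_maps]) (auto simp: state_one)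
  have op: "letter_op l l b x = snd b * x" for b x
    by (simp add: letter_op_def l_def case_prod_unfold split: face.splits)
  have R: "specified_rep scale UNIV 1 \<phi> letters (letter_op l l)"
    by unfold_locales (auto simp: \<phi>.add \<phi>.scale state_one lin_ops_def lin_maps_def op algebra_simps simp flip: scale_mult_right)
  interpret R: specified_rep scale UNIV 1 \<phi> letters "letter_op l l" letter_color by (rule R)
  have prod: "foldr (letter_op l l) w 1 = prod_list (map snd w)" for w
    by (induction w) (simp_all add: op)
  \<comment> \<open>Words of one index: the copy \<open>X i\<close> is literally the representation \<open>R\<close>. Mixed words: both cumulants vanish.\<close>
  have cum: "G.cum w = R.cum w" if w: "w \<in> letter_words" for w
  proof (cases "\<exists>i. \<forall>b\<in>set w. fst (fst b) = i")
    case True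
    then obtain i where i: "\<forall>b\<in>set w. fst (fst b) = i" by blast
    then have "i \<in> I" using w by (cases w) (auto simp: letter_words_def letters_def)
    moreover have "set w \<subseteq> {b\<in>letters. fst (fst b) = i}" using w i by (auto simp: letter_words_def)
    ultimately show ?thesis
      using cum_mono[of i w] w unfolding coef by (simp add: letter_words_def \<xi>_def)
  next
    case False
    have "G.cum w = 0" using w False by (intro mixed_cum_zero) (auto simp: letter_words_def)
    moreover have "R.cum w = 0"
    proof -
      let ?n = "length w" and ?z = "\<lambda>k. w ! (k - 1)"
      have n: "1 \<le> ?n" using w by (cases w) (auto simp: letter_words_def)
      note wz = list_positions(1)[of w] and im = list_positions(2)[of w]
      have z: "?z ` {1..?n} \<subseteq> letters" unfolding im using w by (simp add: letter_words_def)
      have "cumulant \<phi> ?n (\<lambda>k. letter_color (?z k)) {{1..?n}} (\<lambda>k. snd (?z k)) = R.cum (map ?z [1..<Suc ?n])"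
        by (rule letter_list_cumulant[OF R _ n z]) (simp_all add: prod)
      moreover have "cumulant \<phi> ?n (\<lambda>k. letter_color (?z k)) {{1..?n}} (\<lambda>k. snd (?z k)) = 0"
      proof (rule comb[unfolded combinatorially_free_boolean_independent_def, rule_format,
            of _ "\<lambda>k. snd (fst (?z k))" _ "\<lambda>k. fst (fst (?z k))"], intro conjI)
        show "1 \<le> ?n" by (rule n)
        show "{k \<in> {1..?n}. snd (fst (?z k)) = LeftFace} = {k \<in> {1..?n}. letter_color (?z k) = Bullet}"
          by (simp add: letter_color_def face_color_eq)
        have "?z k \<in> letters" if "k \<in> {1..?n}" for k using z that by blast
        then show "\<forall>k\<in>{1..?n}. fst (fst (?z k)) \<in> I" "\<forall>k\<in>{1..?n}. snd (?z k) \<in> A (fst (fst (?z k))) (snd (fst (?z k)))"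
          by (metis letters_iff prod.collapse)+
        show "\<nexists>i. \<forall>k\<in>{1..?n}. fst (fst (?z k)) = i"
          using False unfolding im[symmetric] by blast
      qed
      ultimately show ?thesis using wz by simp
    qed
    ultimately show ?thesis by simp
  qed
  have "\<forall>w\<in>letter_words. vacuum_state (foldr Op w vacuum) = \<phi> (prod_list (map snd w))"
  proof
    fix w assume w: "w \<in> letter_words"
    let ?n = "length w" and ?z = "\<lambda>k. w ! (k - 1)"
    let ?u = "\<lambda>S. map ?z (sorted_list_of_set S)"
    have z: "?z ` {1..?n} \<subseteq> letters"
      unfolding list_positions(2) using w by (simp add: letter_words_def)
    note srt = list_positions(3)[of w]
    have "vacuum_state (foldr Op (?u {1..?n}) vacuum)
        = (\<Sum>\<pi>\<in>INC_on {1..?n} (\<lambda>k. letter_color (?z k)). \<Prod>V\<in>\<pi>. G.cum (?u V))"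
      by (rule G.moment_eq_sum_INC) (use z in simp_all)
    also have "\<dots> = (\<Sum>\<pi>\<in>INC_on {1..?n} (\<lambda>k. letter_color (?z k)). \<Prod>V\<in>\<pi>. R.cum (?u V))"
    proof (intro sum.cong prod.cong refl cum)
      fix \<pi> V assume "\<pi> \<in> INC_on {1..?n} (\<lambda>k. letter_color (?z k))" "V \<in> \<pi>"
      then have V: "V \<subseteq> {1..?n}" "V \<noteq> {}" by (auto simp: INC_on_def partition_on_def)
      then have f: "finite V" using finite_subset by blast
      have "set (?u V) = ?z ` V" using f by simp
      then show "?u V \<in> letter_words" using V z f unfolding letter_words_def by auto
    qed
    also have "\<dots> = \<phi> (foldr (letter_op l l) (?u {1..?n}) 1)"
      by (rule R.moment_eq_sum_INC[symmetric]) (use z in simp_all)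
    finally show "vacuum_state (foldr Op w vacuum) = \<phi> (prod_list (map snd w))"
      by (simp only: srt prod)
  qed
  then show ?thesis
    unfolding free_boolean_independent_def
    using sf hom joint_distribution_iff[OF sf hom hom]
    by (intro exI[of _ X] exI[of _ X0] exI[of _ \<xi>] exI[of _ l] conjI) simp_all
qed

end

theorem theorem7p5:
  fixes scale :: "complex \<Rightarrow> 'a::ring_1 \<Rightarrow> 'a"
    and \<phi> :: "'a \<Rightarrow> complex"
    and I :: "'i set"
    and A :: "'i \<Rightarrow> face \<Rightarrow> 'a set"
    and scaleV :: "complex \<Rightarrow> 'v::ab_group_add \<Rightarrow> 'v"
  assumes "nc_prob_space scale \<phi>"
    and "\<And>i f. i \<in> I \<Longrightarrow> nonunital_subalgebra scale (A i f)"
    and "vector_space scaleV"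
  shows "(free_boolean_independent scaleV scale \<phi> I A
            \<longrightarrow> combinatorially_free_boolean_independent \<phi> I A) \<and>
         (free_boolean_independent scale scale \<phi> I A
            \<longleftrightarrow> combinatorially_free_boolean_independent \<phi> I A)"
proof -
  interpret nc_prob_space scale \<phi> by fact
  interpret face_family scale \<phi> I A by unfold_locales
  show ?thesis using free_boolean_imp_combinatorial[of scaleV] free_boolean_imp_combinatorial[of scale]
      combinatorial_imp_free_boolean by blast
qed

end
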